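(* Let $p>1$, $m\ge3$ and $r>0$, and let $\varphi:M^m\hookrightarrow\mathbb{R}^n=\mathbb{R}^{n-1}\times\mathbb{R}$ be a complete minimal isometric immersion of an $m$-dimensional manifold with second fundamental form $A$. Let $x_0\in\mathbb{R}^{n-1}$ and let $\Omega_r\subset\varphi^{-1}\left(B_{\mathbb{R}^{n-1}}(x_0,r)\times\mathbb{R}\right)$ be a connected component. Suppose that $$\|A\|\ \le\ \frac{m-1}{p\,r}\quad\text{in }\Omega_r.$$ Then $\Omega_r$ is $p$-stable with respect to the potential $\|A\|^p$.
   Context: $p$-stability: for a domain $\Omega\subset M$ and $\mathcal{V}\in L^\infty(\Omega)$, $\mathcal{V}\ge0$, $\Omega$ is $p$-stable with respect to $\mathcal{V}$ if $\int_\Omega\left(|\nabla u|^p-\mathcal{V}|u|^p\right)d\mu\ge0$ for every $u\in\mathcal{C}_0^\infty(\Omega)$, where $d\mu$ is the Riemannian measure of the induced metric. $\|A\|$ is the usual (Hilbert–Schmidt) norm of the second fundamental form. $B_{\mathbb{R}^{n-1}}(x_0,r)$ is the Euclidean ball. *)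

theory Defs
  imports "HOL-Analysis.Analysis"
begin

section \<open>Smooth maps between Euclidean spaces\<close>

text \<open>Meant for open \<open>S\<close>: \<open>f\<close> is \<open>k\<close> times continuously differentiable on \<open>S\<close>.\<close>

primrec Ck_on :: "nat \<Rightarrow> 'b::euclidean_space set \<Rightarrow> ('b \<Rightarrow> 'c::real_normed_vector) \<Rightarrow> bool" where
  "Ck_on 0 S f \<longleftrightarrow> continuous_on S f"
| "Ck_on (Suc k) S f \<longleftrightarrow> (\<forall>x\<in>S. f differentiable at x)
     \<and> (\<forall>v. Ck_on k S (\<lambda>x. frechet_derivative f (at x) v))"

definition smooth_on :: "'b::euclidean_space set \<Rightarrow> ('b \<Rightarrow> 'c::real_normed_vector) \<Rightarrow> bool" where
  "smooth_on S f \<longleftrightarrow> (\<forall>k. Ck_on k S f)"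

definition pd :: "(real^'m \<Rightarrow> 'c::real_normed_vector) \<Rightarrow> 'm::finite \<Rightarrow> real^'m \<Rightarrow> 'c" where
  "pd f i x = frechet_derivative f (at x) (axis i 1)"

section \<open>Smooth manifolds\<close>

text \<open>The manifold is the whole type \<open>'a\<close>; its dimension is \<open>CARD('m)\<close>.
  A chart is a pair of its domain and its coordinate map.\<close>

type_synonym ('a, 'm) chart = "'a set \<times> ('a \<Rightarrow> real^'m)"

definition chart_inv :: "('a, 'm::finite) chart \<Rightarrow> real^'m \<Rightarrow> 'a" where
  "chart_inv c = inv_into (fst c) (snd c)"

definition is_chart :: "('a::topological_space, 'm::finite) chart \<Rightarrow> bool" where
  "is_chart c \<longleftrightarrow> open (fst c) \<and> open (snd c ` fst c)
     \<and> homeomorphism (fst c) (snd c ` fst c) (snd c) (chart_inv c)"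

text \<open>The atlas need not be maximal: all notions below are invariant under smooth changes
  of coordinates.\<close>

definition smooth_atlas ::
  "('a::{t2_space,second_countable_topology}, 'm::finite) chart set \<Rightarrow> bool" where
  "smooth_atlas \<A> \<longleftrightarrow> (\<forall>c\<in>\<A>. is_chart c) \<and> (\<Union>c\<in>\<A>. fst c) = UNIV
     \<and> (\<forall>c\<in>\<A>. \<forall>d\<in>\<A>. smooth_on (snd c ` (fst c \<inter> fst d)) (snd d \<circ> chart_inv c))"

definition chart_at :: "('a, 'm::finite) chart set \<Rightarrow> 'a \<Rightarrow> ('a, 'm) chart" where
  "chart_at \<A> q = (SOME c. c \<in> \<A> \<and> q \<in> fst c)"

definition smooth_map ::
  "('a, 'm::finite) chart set \<Rightarrow> ('a \<Rightarrow> 'e::real_normed_vector) \<Rightarrow> bool" where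
  "smooth_map \<A> f \<longleftrightarrow> (\<forall>c\<in>\<A>. smooth_on (snd c ` fst c) (f \<circ> chart_inv c))"

definition immersion ::
  "('a, 'm::finite) chart set \<Rightarrow> ('a \<Rightarrow> 'e::euclidean_space) \<Rightarrow> bool" where
  "immersion \<A> \<phi> \<longleftrightarrow> smooth_map \<A> \<phi>
     \<and> (\<forall>c\<in>\<A>. \<forall>x\<in>snd c ` fst c. inj (frechet_derivative (\<phi> \<circ> chart_inv c) (at x)))"

section \<open>Local geometry of a parametrized submanifold\<close>

text \<open>Here \<open>F = \<phi> \<circ> \<psi>\<^sup>-\<^sup>1\<close> is an immersion \<open>\<phi>\<close> read in a chart \<open>\<psi>\<close>. The manifold
  carries the metric induced by \<open>\<phi>\<close>, with coefficients \<open>g\<^sub>i\<^sub>j = \<langle>\<partial>\<^sub>iF, \<partial>\<^sub>jF\<rangle>\<close>, so that \<open>\<phi>\<close> is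
  an isometric immersion by construction.\<close>

definition metric :: "(real^'m \<Rightarrow> 'e::euclidean_space) \<Rightarrow> real^'m \<Rightarrow> real^'m^'m::finite" where
  "metric F x = (\<chi> i j. pd F i x \<bullet> pd F j x)"

definition metric_inv :: "(real^'m \<Rightarrow> 'e::euclidean_space) \<Rightarrow> real^'m \<Rightarrow> real^'m^'m::finite" where
  "metric_inv F x = matrix_inv (metric F x)"

text \<open>Component of \<open>z\<close> orthogonal to the tangent space spanned by the \<open>\<partial>\<^sub>kF\<close>.\<close>

definition normal_part ::
  "(real^'m::finite \<Rightarrow> 'e::euclidean_space) \<Rightarrow> real^'m \<Rightarrow> 'e \<Rightarrow> 'e" where
  "normal_part F x z =
     z - (\<Sum>k\<in>UNIV. \<Sum>l\<in>UNIV. (metric_inv F x $ k $ l * (z \<bullet> pd F l x)) *\<^sub>R pd F k x)"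

text \<open>\<open>A(\<partial>\<^sub>i, \<partial>\<^sub>j)\<close>, the normal component of the ambient derivative of \<open>\<partial>\<^sub>jF\<close> along \<open>\<partial>\<^sub>i\<close>.\<close>

definition second_ff ::
  "(real^'m::finite \<Rightarrow> 'e::euclidean_space) \<Rightarrow> real^'m \<Rightarrow> 'm \<Rightarrow> 'm \<Rightarrow> 'e" where
  "second_ff F x i j = normal_part F x (pd (pd F j) i x)"

definition mean_curvature ::
  "(real^'m::finite \<Rightarrow> 'e::euclidean_space) \<Rightarrow> real^'m \<Rightarrow> 'e" where
  "mean_curvature F x = (\<Sum>i\<in>UNIV. \<Sum>j\<in>UNIV. metric_inv F x $ i $ j *\<^sub>R second_ff F x i j)"

definition second_ff_norm_local ::
  "(real^'m::finite \<Rightarrow> 'e::euclidean_space) \<Rightarrow> real^'m \<Rightarrow> real" where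
  "second_ff_norm_local F x = sqrt (\<Sum>i\<in>UNIV. \<Sum>j\<in>UNIV. \<Sum>k\<in>UNIV. \<Sum>l\<in>UNIV.
     metric_inv F x $ i $ k * metric_inv F x $ j $ l * (second_ff F x i j \<bullet> second_ff F x k l))"

text \<open>\<open>|\<nabla>w|\<^sup>2 = g\<^sup>i\<^sup>j \<partial>\<^sub>iw \<partial>\<^sub>jw\<close>.\<close>

definition grad_norm_local ::
  "(real^'m::finite \<Rightarrow> 'e::euclidean_space) \<Rightarrow> (real^'m \<Rightarrow> real) \<Rightarrow> real^'m \<Rightarrow> real" where
  "grad_norm_local F w x =
     sqrt (\<Sum>i\<in>UNIV. \<Sum>j\<in>UNIV. metric_inv F x $ i $ j * pd w i x * pd w j x)"

section \<open>Geometry of an immersed manifold\<close>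

definition minimal_immersion ::
  "('a, 'm::finite) chart set \<Rightarrow> ('a \<Rightarrow> 'e::euclidean_space) \<Rightarrow> bool" where
  "minimal_immersion \<A> \<phi> \<longleftrightarrow> immersion \<A> \<phi>
     \<and> (\<forall>c\<in>\<A>. \<forall>x\<in>snd c ` fst c. mean_curvature (\<phi> \<circ> chart_inv c) x = 0)"

definition second_ff_norm ::
  "('a, 'm::finite) chart set \<Rightarrow> ('a \<Rightarrow> 'e::euclidean_space) \<Rightarrow> 'a \<Rightarrow> real" where
  "second_ff_norm \<A> \<phi> q =
     (let c = chart_at \<A> q in second_ff_norm_local (\<phi> \<circ> chart_inv c) (snd c q))"

definition grad_norm ::
  "('a, 'm::finite) chart set \<Rightarrow> ('a \<Rightarrow> 'e::euclidean_space) \<Rightarrow> ('a \<Rightarrow> real) \<Rightarrow> 'a \<Rightarrow> real" where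
  "grad_norm \<A> \<phi> u q = (let c = chart_at \<A> q in
     grad_norm_local (\<phi> \<circ> chart_inv c) (u \<circ> chart_inv c) (snd c q))"

text \<open>The unique Borel measure that has density \<open>sqrt (det g)\<close> in every chart.\<close>

definition riemannian_measure ::
  "('a::topological_space, 'm::finite) chart set \<Rightarrow> ('a \<Rightarrow> 'e::euclidean_space) \<Rightarrow> 'a measure" where
  "riemannian_measure \<A> \<phi> = (THE \<mu>. sets \<mu> = sets borel
     \<and> (\<forall>c\<in>\<A>. \<forall>B\<in>sets borel. B \<subseteq> fst c \<longrightarrow>
          emeasure \<mu> B =
            (\<integral>\<^sup>+x\<in>snd c ` B. ennreal (sqrt (det (metric (\<phi> \<circ> chart_inv c) x))) \<partial>lborel)))"

definition piecewise_C1_curve ::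
  "('a::topological_space, 'm::finite) chart set \<Rightarrow> (real \<Rightarrow> 'a) \<Rightarrow> bool" where
  "piecewise_C1_curve \<A> \<gamma> \<longleftrightarrow> continuous_on {0..1} \<gamma>
     \<and> (\<forall>c\<in>\<A>. \<forall>a b. 0 \<le> a \<and> a \<le> b \<and> b \<le> 1 \<and> \<gamma> ` {a..b} \<subseteq> fst c
          \<longrightarrow> (snd c \<circ> \<gamma>) piecewise_C1_differentiable_on {a..b})"

text \<open>In the induced metric the speed of \<open>\<gamma>\<close> is the Euclidean speed of \<open>\<phi> \<circ> \<gamma>\<close>.\<close>

definition curve_length :: "('a \<Rightarrow> 'e::euclidean_space) \<Rightarrow> (real \<Rightarrow> 'a) \<Rightarrow> real" where
  "curve_length \<phi> \<gamma> = integral {0..1} (\<lambda>t. norm (vector_derivative (\<phi> \<circ> \<gamma>) (at t)))"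

text \<open>Points in different components have distance \<open>\<infinity>\<close>.\<close>

definition riemannian_dist ::
  "('a::topological_space, 'm::finite) chart set \<Rightarrow> ('a \<Rightarrow> 'e::euclidean_space)
     \<Rightarrow> 'a \<Rightarrow> 'a \<Rightarrow> ereal" where
  "riemannian_dist \<A> \<phi> x y =
     (INF \<gamma>\<in>{\<gamma>. piecewise_C1_curve \<A> \<gamma> \<and> \<gamma> 0 = x \<and> \<gamma> 1 = y}. ereal (curve_length \<phi> \<gamma>))"

definition complete_immersion ::
  "('a::topological_space, 'm::finite) chart set \<Rightarrow> ('a \<Rightarrow> 'e::euclidean_space) \<Rightarrow> bool" where
  "complete_immersion \<A> \<phi> \<longleftrightarrow> (\<forall>s :: nat \<Rightarrow> 'a.
     (\<forall>e>0. \<exists>N. \<forall>i\<ge>N. \<forall>j\<ge>N. riemannian_dist \<A> \<phi> (s i) (s j) < ereal e)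
       \<longrightarrow> (\<exists>x. (\<lambda>i. riemannian_dist \<A> \<phi> (s i) x) \<longlonglongrightarrow> 0))"

section \<open>Stability\<close>

text \<open>\<open>C\<^sub>0\<^sup>\<infinity>(\<Omega>)\<close>, each function being extended by zero to the whole manifold.\<close>

definition test_functions ::
  "('a::topological_space, 'm::finite) chart set \<Rightarrow> 'a set \<Rightarrow> ('a \<Rightarrow> real) set" where
  "test_functions \<A> \<Omega> = {u. smooth_map \<A> u
     \<and> compact (closure {q. u q \<noteq> 0}) \<and> closure {q. u q \<noteq> 0} \<subseteq> \<Omega>}"

text \<open>The first two conjuncts say that \<open>V \<in> L\<^sup>\<infinity>(\<Omega>)\<close> and \<open>V \<ge> 0\<close>; they make the integrand of
  the last one integrable, so that the integral there never takes its default value.\<close>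

definition p_stable ::
  "real \<Rightarrow> ('a::topological_space, 'm::finite) chart set \<Rightarrow> ('a \<Rightarrow> 'e::euclidean_space)
     \<Rightarrow> 'a set \<Rightarrow> ('a \<Rightarrow> real) \<Rightarrow> bool" where
  "p_stable p \<A> \<phi> \<Omega> V \<longleftrightarrow>
     set_borel_measurable (riemannian_measure \<A> \<phi>) \<Omega> V
     \<and> (\<exists>C. AE q\<in>\<Omega> in riemannian_measure \<A> \<phi>. 0 \<le> V q \<and> V q \<le> C)
     \<and> (\<forall>u\<in>test_functions \<A> \<Omega>.
          0 \<le> (LINT q:\<Omega>|riemannian_measure \<A> \<phi>.
                 grad_norm \<A> \<phi> u q powr p - V q * \<bar>u q\<bar> powr p))"

end

theory Submission
  imports Defs
begin

text \<open>Let \<open>X\<close> be the field \<open>v \<mapsto> (fst v - x0, 0)\<close> on the ambient space. Since the immersion is minimal,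
  the divergence of the tangential part of \<open>X\<close> equals the trace over the tangent space of the
  projection to the first factor, which is at least \<open>m - 1\<close>; over the cylinder, \<open>X\<close> has norm at most
  \<open>r\<close>. Integrating the divergence of \<open>\<bar>u\<bar>\<^sup>p X\<^sup>T\<close> and applying Young's inequality pointwise gives
  \<open>((m - 1) / (p r))\<^sup>p \<integral>\<bar>u\<bar>\<^sup>p \<le> \<integral>\<bar>\<nabla>u\<bar>\<^sup>p\<close>, and the curvature bound does the rest.\<close>

section \<open>Change of variables for nonnegative functions\<close>

text \<open>The cylinder has one unbounded direction, and the projection to that single line
  contributes at most 1 to a trace over a tangent space: hence m - 1. The factor p in the bound
  comes from the gradient of |u|^p. With l = (m - 1) / (p r) and the weight l^(p-1) / r, the trace
  term is at least p (l |u|)^p; Young's inequality takes back (p - 1) (l |u|)^p, so one (l |u|)^p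
  remains to dominate the potential term.

  Three obstacles shape the rest. For p close to 1 the function |u|^p need not be smooth, so the
  calculus is built for class C1. The support of u need not lie in one chart, so the divergence
  theorem is proved in a chart and glued with bump functions. The measure is a definite description
  and norms are computed in a chart chosen by \<open>SOME\<close>, so existence, uniqueness and
  independence of the chart come before any integration. Tangent vectors, gradients and the second
  fundamental form are treated as vectors of the ambient space, where different charts can be
  compared directly and no Christoffel symbols occur.\<close>

text \<open>The change of variables theorem of HOL-Analysis needs a well-ordered index type; the copy
  supplies one for every finite index type.\<close>

typedef 'n ordcopy = "UNIV :: 'n set" ..

instance ordcopy :: (finite) finite
proof
  have "(UNIV :: 'a ordcopy set) \<subseteq> Abs_ordcopy ` UNIV"
    by (metis Rep_ordcopy_inverse UNIV_I image_eqI subsetI)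
  then show "finite (UNIV :: 'a ordcopy set)"
    by (rule finite_surj[OF finite])
qed

text \<open>The order is pulled back from \<open>nat\<close> along this injection, so
  well-foundedness is inherited. Any injection would do, hence the choice by
  \<open>SOME\<close>.\<close>

definition ordcopy_index :: "'n::finite ordcopy \<Rightarrow> nat" where
  "ordcopy_index = (SOME f. inj f)"

lemma inj_ordcopy_index: "inj (ordcopy_index :: 'n::finite ordcopy \<Rightarrow> nat)"
proof -
  obtain f :: "'n ordcopy \<Rightarrow> nat" where "inj f"
    using finite_imp_inj_to_nat_seg[of "UNIV :: 'n ordcopy set"] by auto
  then show ?thesis
    unfolding ordcopy_index_def by (rule someI[where P = inj])
qed

instantiation ordcopy :: (finite) wellorder
begin

definition "x \<le> y \<longleftrightarrow> ordcopy_index x \<le> ordcopy_index y" for x y :: "'a ordcopy"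
definition "x < y \<longleftrightarrow> ordcopy_index x < ordcopy_index y" for x y :: "'a ordcopy"

instance
proof (intro_classes, goal_cases)
  case (4 x y)
  then have "ordcopy_index x = ordcopy_index y"
    by (simp add: less_eq_ordcopy_def)
  then show ?case
    by (rule injD[OF inj_ordcopy_index])
next
  case (6 P a)
  show ?case
  proof (induction a rule: measure_induct_rule[where f = ordcopy_index])
    case (less x)
    show ?case
      by (rule 6) (use less in \<open>simp add: less_ordcopy_def\<close>)
  qed
qed (simp_all add: less_eq_ordcopy_def less_ordcopy_def less_le_not_le nat_le_linear)

end

lemma bij_Rep_ordcopy: "bij Rep_ordcopy"
  by (metis Abs_ordcopy_inverse Rep_ordcopy_inverse UNIV_I bijI')

text \<open>For a bijection \<open>e\<close> this permutes coordinates between vectors over two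
  index types; it is the bridge between a type and its well-ordered copy.\<close>

definition reindex :: "('b \<Rightarrow> 'a) \<Rightarrow> real^'a::finite \<Rightarrow> real^'b::finite" where
  "reindex e x = (\<chi> i. x $ e i)"

lemma linear_reindex: "linear (reindex e)"
  by (rule linearI) (simp_all add: reindex_def vec_eq_iff)

lemma reindex_measurable [measurable]: "reindex e \<in> borel_measurable borel"
  by (intro borel_measurable_continuous_onI linear_continuous_on linear_conv_bounded_linear[THEN iffD1] linear_reindex)

lemma reindex_inverse:
  assumes "bij e"
  shows "reindex (inv e) (reindex e x) = x" "reindex e (reindex (inv e) y) = y"
  using assms by (simp_all add: reindex_def vec_eq_iff bij_is_surj surj_f_inv_f bij_is_inj)

text \<open>A coordinate permutation turns boxes into boxes with the same side lengths, and Lebesgue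
  measure is determined by its values on boxes.\<close>

lemma distr_lborel_reindex:
  fixes e :: "'b::finite \<Rightarrow> 'a::finite"
  assumes e: "bij e"
  shows "distr lborel borel (reindex e) = lborel"
proof (rule lborel_eqI[symmetric])
  fix l u :: "real^'b"
  assume lu: "\<And>b. b \<in> Basis \<Longrightarrow> l \<bullet> b \<le> u \<bullet> b"
  have le: "l $ i \<le> u $ i" for i
    using lu[of "axis i 1"] by (metis axis_in_Basis_iff Basis_real_def insertI1 inner_axis inner_real_def mult.right_neutral)
  have "reindex e -` box l u = box (reindex (inv e) l) (reindex (inv e) u)"
  proof -
    have "(\<forall>i. P (e i) i) \<longleftrightarrow> (\<forall>j. P j (inv e j))" for P
      by (metis bij_inv_eq_iff e)
    from this[of "\<lambda>j i. l $ i < x $ j \<and> x $ j < u $ i" for x] show ?thesis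
      by (simp add: mem_box_cart reindex_def set_eq_iff)
  qed
  then have "emeasure (distr lborel borel (reindex e)) (box l u)
      = emeasure lborel (box (reindex (inv e) l) (reindex (inv e) u))"
    by (simp add: emeasure_distr)
  also have "\<dots> = (\<Prod>b\<in>Basis. (reindex (inv e) u - reindex (inv e) l) \<bullet> b)"
    using le by (intro emeasure_lborel_box) (auto simp: Basis_vec_def inner_axis reindex_def)
  also have "(\<Prod>b\<in>Basis. (reindex (inv e) u - reindex (inv e) l) \<bullet> b)
      = (\<Prod>i\<in>UNIV. (u - l) $ inv e i)"
  proof -
    have B: "(Basis :: (real^'a) set) = (\<lambda>i. axis i 1) ` UNIV"
      by (auto simp: Basis_vec_def)
    show ?thesis unfolding B
      by (subst prod.reindex) (auto simp: inj_on_def axis_eq_axis inner_axis reindex_def)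
  qed
  also have "\<dots> = (\<Prod>i\<in>UNIV. (u - l) $ i)"
    by (rule prod.reindex_bij_betw) (simp add: e bij_imp_bij_inv)
  also have "\<dots> = (\<Prod>b\<in>Basis. (u - l) \<bullet> b)"
  proof -
    have B: "(Basis :: (real^'b) set) = (\<lambda>i. axis i 1) ` UNIV"
      by (auto simp: Basis_vec_def)
    show ?thesis unfolding B
      by (subst prod.reindex) (auto simp: inj_on_def axis_eq_axis inner_axis)
  qed
  finally show "emeasure (distr lborel borel (reindex e)) (box l u) = (\<Prod>b\<in>Basis. (u - l) \<bullet> b)" .
qed simp

lemma nn_integral_reindex:
  assumes "bij e" "f \<in> borel_measurable borel"
  shows "(\<integral>\<^sup>+x. f (reindex e x) \<partial>lborel) = (\<integral>\<^sup>+y. f y \<partial>lborel)"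
proof -
  have "(\<integral>\<^sup>+y. f y \<partial>lborel) = (\<integral>\<^sup>+y. f y \<partial>distr lborel borel (reindex e))"
    using assms by (simp add: distr_lborel_reindex)
  also have "\<dots> = (\<integral>\<^sup>+x. f (reindex e x) \<partial>lborel)"
    using assms by (intro nn_integral_distr) auto
  finally show ?thesis ..
qed

text \<open>Conjugation with \<open>e\<close> maps the permutations of one index type to those of
  the other and keeps signs, so the two Leibniz sums agree term by term.\<close>

lemma det_reindex:
  fixes A :: "real^'a::finite^'a" and e :: "'b::finite \<Rightarrow> 'a"
  assumes e: "bij e"
  shows "det (\<chi> i j. A $ e i $ e j) = det A"
proof -
  have 1: "bij_betw (map_permutation UNIV e) {p. p permutes UNIV} {p. p permutes UNIV}"
  proof -
    have "map_permutation UNIV e = (\<lambda>p x. if x \<in> UNIV then e (p (inv e x)) else x)"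
      using bij_is_surj[OF e] by (simp add: map_permutation_def restrict_id_def fun_eq_iff)
    then show ?thesis
      using bij_betw_permutations[OF e] by simp
  qed
  have "det A = (\<Sum>p | p permutes UNIV. of_int (sign (map_permutation UNIV e p))
       * (\<Prod>i\<in>UNIV. A $ i $ map_permutation UNIV e p i))"
    unfolding det_def
    by (rule sum.reindex_bij_betw[OF 1, symmetric,
          of "\<lambda>p. of_int (sign p) * (\<Prod>i\<in>UNIV. A $ i $ p i)"])
  also have "\<dots> = (\<Sum>p | p permutes UNIV. of_int (sign p) * (\<Prod>i\<in>UNIV. A $ e i $ e (p i)))"
  proof (rule sum.cong[OF refl])
    fix p :: "'b \<Rightarrow> 'b" assume p: "p \<in> {p. p permutes UNIV}"
    have "(\<Prod>i\<in>UNIV. A $ i $ map_permutation UNIV e p i)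
        = (\<Prod>i\<in>UNIV. A $ e i $ map_permutation UNIV e p (e i))"
      by (rule prod.reindex_bij_betw[symmetric]) (simp add: e)
    also have "\<dots> = (\<Prod>i\<in>UNIV. A $ e i $ e (p i))"
      using bij_is_surj[OF e] bij_is_inj[OF e] by (simp add: map_permutation_def restrict_id_def)
    finally show "of_int (sign (map_permutation UNIV e p)) * (\<Prod>i\<in>UNIV. A $ i $ map_permutation UNIV e p i)
        = of_int (sign p) * (\<Prod>i\<in>UNIV. A $ e i $ e (p i))"
      using p bij_is_inj[OF e] by (simp add: sign_map_permutation)
  qed
  finally show ?thesis
    by (simp add: det_def)
qed

text \<open>Dictionary between two ways of giving a finite integral: integrability together with the
  value \<open>b\<close>, the form in which change of variables is available, and a nonnegative
  Lebesgue integral, which may also be infinite.\<close>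

lemma nonneg_absolutely_integrable_iff:
  fixes f :: "'a::euclidean_space \<Rightarrow> real"
  assumes nonneg: "\<And>x. x \<in> S \<Longrightarrow> 0 \<le> f x"
    and meas: "(\<lambda>x. indicator S x * f x) \<in> borel_measurable borel"
  shows "f absolutely_integrable_on S \<and> integral S f = b \<longleftrightarrow>
    0 \<le> b \<and> (\<integral>\<^sup>+x. ennreal (indicator S x * f x) \<partial>lborel) = ennreal b"
proof -
  let ?g = "\<lambda>x. indicator S x * f x"
  have g0: "0 \<le> ?g x" for x
    using nonneg by (auto simp: indicator_def)
  have int: "f absolutely_integrable_on S \<longleftrightarrow> integrable lborel ?g"
    using meas by (simp add: set_integrable_def integrable_completion)
  have eq: "integral S f = integral\<^sup>L lborel ?g" if "f absolutely_integrable_on S"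
    using set_lebesgue_integral_eq_integral(2)[OF that] meas
    by (simp add: set_lebesgue_integral_def integral_completion)
  show ?thesis
  proof safe
    assume *: "f absolutely_integrable_on S"
    show "0 \<le> integral S f"
      using eq[OF *] g0 by simp
    show "(\<integral>\<^sup>+x. ennreal (?g x) \<partial>lborel) = ennreal (integral S f)"
      using * int eq g0 by (simp add: nn_integral_eq_integral)
  next
    assume b: "0 \<le> b" "(\<integral>\<^sup>+x. ennreal (?g x) \<partial>lborel) = ennreal b"
    have I: "integrable lborel ?g"
      by (rule integrableI_nonneg) (use meas g0 b in auto)
    then show "f absolutely_integrable_on S"
      using int by simp
    then show "integral S f = b"
      using eq I b g0 by (simp add: nn_integral_eq_integral)
  qed
qed

text \<open>The two integrals attain the same finite values; if one of them is infinite, the other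
  cannot be finite, so both are infinite. No integrability has to be assumed.\<close>

lemma nn_integral_change_of_variables_wellorder:
  fixes g :: "real^'m::{finite,wellorder} \<Rightarrow> real^'m::_" and h :: "real^'m::_ \<Rightarrow> real"
  assumes S: "S \<in> sets borel"
    and der: "\<And>x. x \<in> S \<Longrightarrow> (g has_derivative g' x) (at x within S)"
    and inj: "inj_on g S"
    and nonneg: "\<And>x. x \<in> S \<Longrightarrow> 0 \<le> h (g x)"
    and m1: "(\<lambda>y. indicator (g ` S) y * h y) \<in> borel_measurable borel"
    and m2: "(\<lambda>x. indicator S x * (\<bar>det (matrix (g' x))\<bar> * h (g x))) \<in> borel_measurable borel"
  shows "(\<integral>\<^sup>+y. ennreal (indicator (g ` S) y * h y) \<partial>lborel)
    = (\<integral>\<^sup>+x. ennreal (indicator S x * (\<bar>det (matrix (g' x))\<bar> * h (g x))) \<partial>lborel)"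
    (is "?L = ?R")
proof -
  have S': "S \<in> sets lebesgue"
    using S by auto
  have *: "?R = ennreal b \<longleftrightarrow> ?L = ennreal b" if "b \<ge> 0" for b
  proof -
    \<comment> \<open>The vector-valued theorem is applied to \<open>h\<close> read as a function
      into the one-dimensional space \<open>real^1\<close>.\<close>
    have "(\<lambda>x. \<bar>det (matrix (g' x))\<bar> * h (g x)) absolutely_integrable_on S
          \<and> integral S (\<lambda>x. \<bar>det (matrix (g' x))\<bar> * h (g x)) = b
      \<longleftrightarrow> h absolutely_integrable_on (g ` S) \<and> integral (g ` S) h = b"
      using has_absolute_integral_change_of_variables[OF S' der inj, of "\<lambda>y. vec (h y) :: real^1" "vec b"]
      by (simp add: absolutely_integrable_on_1_iff integral_on_1_eq vec_eq_iff)
    then show ?thesis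
      using nonneg_absolutely_integrable_iff[of S "\<lambda>x. \<bar>det (matrix (g' x))\<bar> * h (g x)" b]
        nonneg_absolutely_integrable_iff[of "g ` S" h b] nonneg m1 m2 that by auto
  qed
  show ?thesis
  proof (cases ?L)
    case (real b)
    then show ?thesis using *[of b] by auto
  next
    case top
    show ?thesis
    proof (cases ?R)
      case (real b)
      then show ?thesis using *[of b] top by auto
    qed (use top in simp)
  qed
qed

text \<open>Conjugating \<open>g\<close> with the coordinate permutation \<open>reindex e\<close>
  moves the problem to the well-ordered copy; Lebesgue measure and the Jacobian determinant are
  unaffected.\<close>

lemma nn_integral_change_of_variables:
  fixes g :: "real^'m::finite \<Rightarrow> real^'m" and h :: "real^'m \<Rightarrow> real"
  assumes S: "S \<in> sets borel"
    and der: "\<And>x. x \<in> S \<Longrightarrow> (g has_derivative g' x) (at x within S)"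
    and inj: "inj_on g S"
    and nonneg: "\<And>x. x \<in> S \<Longrightarrow> 0 \<le> h (g x)"
    and m1: "(\<lambda>y. indicator (g ` S) y * h y) \<in> borel_measurable borel"
    and m2: "(\<lambda>x. indicator S x * (\<bar>det (matrix (g' x))\<bar> * h (g x))) \<in> borel_measurable borel"
  shows "(\<integral>\<^sup>+y. ennreal (indicator (g ` S) y * h y) \<partial>lborel)
    = (\<integral>\<^sup>+x. ennreal (indicator S x * (\<bar>det (matrix (g' x))\<bar> * h (g x))) \<partial>lborel)"
proof -
  define e :: "'m ordcopy \<Rightarrow> 'm" where "e = Rep_ordcopy"
  have e: "bij e" "bij (inv e)"
    using bij_Rep_ordcopy bij_imp_bij_inv by (auto simp: e_def)
  let ?R = "reindex e" and ?Q = "reindex (inv e)"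
  note RQ [simp] = reindex_inverse[OF e(1)]
  define T where "T = ?R ` S"
  have "y \<in> ?R ` S" if "?Q y \<in> S" for S y
    using that RQ(2)[of y] by (metis imageI)
  then have img: "?R ` S = ?Q -` S" for S
    by auto
  then have T: "T = ?Q -` S"
    by (simp add: T_def)
  have iT: "indicator T y = (indicator S (?Q y) :: real)" for y
    by (simp add: T indicator_def)
  define G where "G = (\<lambda>y. ?R (g (?Q y)))"
  define G' where "G' = (\<lambda>y v. ?R (g' (?Q y) (?Q v)))"
  have GT: "G ` T = ?Q -` (g ` S)"
    unfolding img[symmetric] by (simp add: T_def G_def image_image)
  have iGT: "indicator (G ` T) y = (indicator (g ` S) (?Q y) :: real)" for y
    by (simp add: GT indicator_def)
  have det: "det (matrix (G' y)) = det (matrix (g' (?Q y)))" for y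
  proof -
    have ax: "?Q (axis j 1) = axis (e j) 1" for j
      using bij_inv_eq_iff[OF e(1)] by (simp add: reindex_def vec_eq_iff axis_def) (metis)
    have "matrix (G' y) = (\<chi> i j. matrix (g' (?Q y)) $ e i $ e j)"
      by (simp add: matrix_def G'_def ax vec_eq_iff) (simp add: reindex_def)
    then show ?thesis
      using det_reindex[OF e(1)] by metis
  qed
  have bl: "bounded_linear (reindex f)" for f :: "'i::finite \<Rightarrow> 'j::finite"
    using linear_reindex linear_conv_bounded_linear by blast
  have "(\<integral>\<^sup>+y. ennreal (indicator (G ` T) y * h (?Q y)) \<partial>lborel)
    = (\<integral>\<^sup>+x. ennreal (indicator T x * (\<bar>det (matrix (G' x))\<bar> * h (?Q (G x)))) \<partial>lborel)"
  proof (rule nn_integral_change_of_variables_wellorder[where h = "\<lambda>y. h (?Q y)"])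
    have "?Q -` S \<inter> space borel \<in> sets borel"
      by (rule measurable_sets[OF reindex_measurable S])
    then show "T \<in> sets borel" by (simp add: T)
    show "(G has_derivative G' x) (at x within T)" if "x \<in> T" for x
    proof -
      have img: "?Q ` T = S"
        by (auto simp: T_def image_image)
      have "(?Q has_derivative ?Q) (at x within T)"
        by (rule bounded_linear_imp_has_derivative[OF bl])
      moreover have "(g has_derivative g' (?Q x)) (at (?Q x) within ?Q ` T)"
        unfolding img by (rule der) (use that T in auto)
      ultimately have "((\<lambda>y. g (?Q y)) has_derivative (\<lambda>v. g' (?Q x) (?Q v))) (at x within T)"
        by (rule has_derivative_in_compose)
      then show ?thesis
        unfolding G_def G'_def by (rule bounded_linear.has_derivative[OF bl])
    qed
    show "inj_on G T"
      using inj by (auto simp: inj_on_def G_def T_def) (metis RQ(1))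
    show "0 \<le> h (?Q (G x))" if "x \<in> T" for x
      using nonneg that by (auto simp: G_def T)
    show "(\<lambda>y. indicator (G ` T) y * h (?Q y)) \<in> borel_measurable borel"
      unfolding iGT by (rule measurable_compose[OF reindex_measurable m1])
    show "(\<lambda>x. indicator T x * (\<bar>det (matrix (G' x))\<bar> * h (?Q (G x)))) \<in> borel_measurable borel"
      unfolding iT det G_def RQ by (rule measurable_compose[OF reindex_measurable m2])
  qed
  then have "(\<integral>\<^sup>+y. ennreal (indicator (g ` S) (?Q y) * h (?Q y)) \<partial>lborel)
    = (\<integral>\<^sup>+x. ennreal (indicator S (?Q x) * (\<bar>det (matrix (g' (?Q x)))\<bar> * h (g (?Q x)))) \<partial>lborel)"
    unfolding iT det iGT unfolding G_def RQ .
  then show ?thesis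
    using nn_integral_reindex[OF e(2), of "\<lambda>y. ennreal (indicator (g ` S) y * h y)"]
      nn_integral_reindex[OF e(2), of "\<lambda>x. ennreal (indicator S x * (\<bar>det (matrix (g' x))\<bar> * h (g x)))"] m1 m2
    by simp
qed

section \<open>Gram matrices and dual frames\<close>

definition gram :: "('m::finite \<Rightarrow> 'e::real_inner) \<Rightarrow> real^'m^'m" where
  "gram v = (\<chi> i j. v i \<bullet> v j)"

text \<open>Linear independence of an indexed family, so repetitions are excluded. The coefficients
  form a vector, which links the condition to the kernel of \<open>gram v\<close>.\<close>

definition frame :: "('m::finite \<Rightarrow> 'e::real_inner) \<Rightarrow> bool" where
  "frame v \<longleftrightarrow> (\<forall>c :: real^'m. (\<Sum>i\<in>UNIV. c $ i *\<^sub>R v i) = 0 \<longrightarrow> c = 0)"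

text \<open>The basis of the span of \<open>v\<close> dual to \<open>v\<close>, obtained by raising
  indices with the inverse Gram matrix. It is meaningful for frames, where \<open>matrix_inv\<close>
  is a true inverse.\<close>

definition dual_frame :: "('m::finite \<Rightarrow> 'e::real_inner) \<Rightarrow> 'm \<Rightarrow> 'e" where
  "dual_frame v l = (\<Sum>k\<in>UNIV. matrix_inv (gram v) $ k $ l *\<^sub>R v k)"

lemma gram_mult: "(gram v *v c) $ i = v i \<bullet> (\<Sum>j\<in>UNIV. c $ j *\<^sub>R v j)"
  by (simp add: gram_def matrix_vector_mult_def inner_sum_right mult.commute)

text \<open>The Gram matrix represents the squared norm of a combination of the \<open>v j\<close>;
  it is therefore positive semidefinite, and definite exactly for a frame.\<close>

lemma inner_gram: "c \<bullet> (gram v *v c) = (norm (\<Sum>j\<in>UNIV. c $ j *\<^sub>R v j))\<^sup>2"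
proof -
  have "c \<bullet> (gram v *v c) = (\<Sum>i\<in>UNIV. c $ i * (v i \<bullet> (\<Sum>j\<in>UNIV. c $ j *\<^sub>R v j)))"
    by (simp add: inner_vec_def gram_mult)
  also have "\<dots> = (\<Sum>j\<in>UNIV. c $ j *\<^sub>R v j) \<bullet> (\<Sum>j\<in>UNIV. c $ j *\<^sub>R v j)"
    by (subst inner_sum_left) simp
  finally show ?thesis
    by (simp add: power2_norm_eq_inner)
qed

lemma det_ne_0_iff_ker: "det (A :: real^'m::finite^'m) \<noteq> 0 \<longleftrightarrow> (\<forall>c. A *v c = 0 \<longrightarrow> c = 0)"
  using invertible_det_nz[of A] invertible_left_inverse[of A] matrix_left_invertible_ker[of A] by simp

text \<open>Along the segment from the Gram matrix to the identity all matrices are positive definite,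
  so the determinant has no zero there.\<close>

lemma det_gram_pos:
  fixes v :: "'m::finite \<Rightarrow> 'e::real_inner"
  assumes "frame v"
  shows "det (gram v) > 0"
proof (rule ccontr)
  assume neg: "\<not> det (gram v) > 0"
  define A where "A t = t *\<^sub>R mat 1 + (1 - t) *\<^sub>R gram v" for t :: real
  have A: "A t *v c = t *\<^sub>R c + (1 - t) *\<^sub>R (gram v *v c)" for t c
    by (simp add: A_def matrix_vector_mult_add_rdistrib flip: scaleR_matrix_vector_assoc)
  have "det (A t) \<noteq> 0" if t: "0 \<le> t" "t \<le> 1" for t
    unfolding det_ne_0_iff_ker
  proof safe
    fix c assume "A t *v c = 0"
    then have "c \<bullet> (t *\<^sub>R c + (1 - t) *\<^sub>R (gram v *v c)) = 0"
      by (simp add: A)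
    then have 0: "t * (norm c)\<^sup>2 + (1 - t) * (norm (\<Sum>j\<in>UNIV. c $ j *\<^sub>R v j))\<^sup>2 = 0"
      by (simp add: inner_add_right inner_gram power2_norm_eq_inner)
    have ge: "0 \<le> t * (norm c)\<^sup>2" "0 \<le> (1 - t) * (norm (\<Sum>j\<in>UNIV. c $ j *\<^sub>R v j))\<^sup>2"
      using t by simp_all
    have "t = 0 \<or> norm c = 0" "t = 1 \<or> norm (\<Sum>j\<in>UNIV. c $ j *\<^sub>R v j) = 0"
      using 0 ge by (auto simp: add_nonneg_eq_0_iff)
    then show "c = 0"
      using assms by (auto simp: frame_def)
  qed
  moreover have "continuous_on {0..1} (\<lambda>t. det (A t))"
    unfolding det_def A_def by (intro continuous_intros)
  moreover have "det (A 0) \<le> 0" "0 \<le> det (A 1)"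
    using neg by (simp_all add: A_def)
  ultimately show False
    using IVT'[of "\<lambda>t. det (A t)" 0 0 1] by auto
qed

lemma matrix_inv_gram:
  assumes "frame v"
  shows "gram v ** matrix_inv (gram v) = mat 1" "matrix_inv (gram v) ** gram v = mat 1"
proof -
  have "\<exists>B. gram v ** B = mat 1 \<and> B ** gram v = mat 1"
    using det_gram_pos[OF assms] invertible_det_nz[of "gram v"] by (simp add: invertible_def)
  then have "gram v ** matrix_inv (gram v) = mat 1 \<and> matrix_inv (gram v) ** gram v = mat 1"
    unfolding matrix_inv_def by (rule someI_ex)
  then show "gram v ** matrix_inv (gram v) = mat 1" "matrix_inv (gram v) ** gram v = mat 1"
    by auto
qed

lemma transpose_gram: "transpose (gram v) = gram v"
  by (simp add: transpose_def gram_def vec_eq_iff inner_commute)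

lemma matrix_inv_gram_sym:
  assumes "frame v"
  shows "matrix_inv (gram v) $ i $ j = matrix_inv (gram v) $ j $ i"
proof -
  let ?B = "matrix_inv (gram v)"
  have "transpose ?B ** gram v = mat 1"
    using arg_cong[OF matrix_inv_gram(1)[OF assms], of transpose]
    by (simp add: matrix_transpose_mul transpose_gram)
  then have "transpose ?B ** (gram v ** ?B) = ?B"
    by (simp add: matrix_mul_assoc)
  then have "transpose ?B = ?B"
    by (simp add: matrix_inv_gram(1)[OF assms])
  from arg_cong[OF this, of "\<lambda>M. M $ j $ i"] show ?thesis
    unfolding transpose_def by simp
qed

lemma dual_frame_inner:
  assumes "frame v"
  shows "dual_frame v l \<bullet> v j = (if l = j then 1 else 0)"
proof -
  have "dual_frame v l \<bullet> v j = (\<Sum>k\<in>UNIV. gram v $ j $ k * matrix_inv (gram v) $ k $ l)"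
    by (simp add: dual_frame_def inner_sum_left gram_def inner_commute[of "v j"] mult.commute)
  also have "\<dots> = (gram v ** matrix_inv (gram v)) $ j $ l"
    by (simp add: matrix_matrix_mult_def)
  finally show ?thesis
    by (simp add: matrix_inv_gram[OF assms] mat_def)
qed

lemma dual_frame_inner_dual:
  assumes "frame v"
  shows "dual_frame v i \<bullet> dual_frame v j = matrix_inv (gram v) $ i $ j"
proof -
  have "dual_frame v i \<bullet> dual_frame v j
      = (\<Sum>k\<in>UNIV. matrix_inv (gram v) $ k $ j * (dual_frame v i \<bullet> v k))"
    by (subst (2) dual_frame_def) (simp add: inner_sum_right)
  also have "\<dots> = (\<Sum>k\<in>UNIV. if i = k then matrix_inv (gram v) $ k $ j else 0)"
    by (intro sum.cong) (simp_all add: dual_frame_inner[OF assms])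
  finally show ?thesis by simp
qed

text \<open>The difference lies in the span of \<open>v\<close> and is orthogonal to every
  \<open>v k\<close>, hence to itself.\<close>

lemma frame_eqI:
  assumes "frame v" "z = (\<Sum>k\<in>UNIV. c k *\<^sub>R v k)" "w = (\<Sum>k\<in>UNIV. d k *\<^sub>R v k)"
    and "\<And>k. z \<bullet> v k = w \<bullet> v k"
  shows "z = w"
proof -
  have "z - w = (\<Sum>k\<in>UNIV. (c k - d k) *\<^sub>R v k)"
    unfolding assms(2,3) by (simp add: sum_subtractf scaleR_left_diff_distrib)
  then have "(z - w) \<bullet> (z - w) = (\<Sum>k\<in>UNIV. (c k - d k) * ((z - w) \<bullet> v k))"
    by (metis (no_types, lifting) inner_scaleR_right inner_sum_right sum.cong)
  also have "\<dots> = 0"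
    by (simp add: inner_diff_left assms(4))
  finally show ?thesis by simp
qed

text \<open>Dual bases transform in the opposite direction: the matrix \<open>T\<close> that writes
  \<open>v\<close> in terms of \<open>w\<close> writes the dual of \<open>w\<close> in terms of the
  dual of \<open>v\<close>. Both sides lie in the span of \<open>v\<close> (the left one by means of
  \<open>S\<close>) and have the same product with each \<open>v k\<close>.\<close>

lemma dual_frame_change:
  assumes v: "frame v" and w: "frame w"
    and vw: "\<And>i. v i = (\<Sum>a\<in>UNIV. T i a *\<^sub>R w a)"
    and wv: "\<And>a. w a = (\<Sum>i\<in>UNIV. S a i *\<^sub>R v i)"
  shows "dual_frame w a = (\<Sum>i\<in>UNIV. T i a *\<^sub>R dual_frame v i)"
proof (rule frame_eqI[OF v])
  show "dual_frame w a = (\<Sum>i\<in>UNIV. (\<Sum>b\<in>UNIV. matrix_inv (gram w) $ b $ a * S b i) *\<^sub>R v i)"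
    unfolding dual_frame_def
    by (subst wv) (simp add: scaleR_sum_right scaleR_sum_left, rule sum.swap)
  show "(\<Sum>i\<in>UNIV. T i a *\<^sub>R dual_frame v i)
      = (\<Sum>k\<in>UNIV. (\<Sum>i\<in>UNIV. T i a * matrix_inv (gram v) $ k $ i) *\<^sub>R v k)"
    unfolding dual_frame_def
    by (simp add: scaleR_sum_right scaleR_sum_left) (rule sum.swap)
  fix k
  have "dual_frame w a \<bullet> v k = T k a"
    by (subst vw) (simp add: inner_sum_right dual_frame_inner[OF w] if_distrib cong: if_cong)
  also have "\<dots> = (\<Sum>i\<in>UNIV. T i a *\<^sub>R dual_frame v i) \<bullet> v k"
    by (simp add: inner_sum_left dual_frame_inner[OF v] if_distrib cong: if_cong)
  finally show "dual_frame w a \<bullet> v k = (\<Sum>i\<in>UNIV. T i a *\<^sub>R dual_frame v i) \<bullet> v k" .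
qed

text \<open>Invariance of a contraction of lower with upper indices: coefficients that change with
  \<open>T\<close> compensate the change of the dual frame. Gradients and tangential projections are
  of this form.\<close>

lemma sum_dual_frame_change:
  fixes L :: "'e::real_inner \<Rightarrow> 'd::real_vector"
  assumes dual: "\<And>a. dual_frame w a = (\<Sum>i\<in>UNIV. T i a *\<^sub>R dual_frame v i)"
  shows "(\<Sum>i\<in>UNIV. (\<Sum>a\<in>UNIV. T i a * f a) *\<^sub>R dual_frame v i) = (\<Sum>a\<in>UNIV. f a *\<^sub>R dual_frame w a)"
  by (simp add: dual scaleR_sum_left scaleR_sum_right mult.commute) (rule sum.swap)

text \<open>The sum is the inner product of \<open>z\<close> with its orthogonal projection
  \<open>t\<close> to the span of \<open>v\<close>, and projecting does not increase the norm.
  Equivalently, it is the trace over the span of the tangential part of the rank-one map sending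
  \<open>y\<close> to \<open>(y \<bullet> z) *\<^sub>R z\<close>.\<close>

lemma sum_dual_frame_comp:
  assumes "frame v"
  shows "(\<Sum>l\<in>UNIV. (v l \<bullet> z) * (dual_frame v l \<bullet> z)) \<le> (norm z)\<^sup>2"
proof -
  define t where "t = (\<Sum>l\<in>UNIV. (v l \<bullet> z) *\<^sub>R dual_frame v l)"
  have dt: "dual_frame v i \<bullet> t = dual_frame v i \<bullet> z" for i
    by (simp add: t_def inner_sum_right dual_frame_inner_dual[OF assms])
       (simp add: dual_frame_def inner_sum_left matrix_inv_gram_sym[OF assms, of i] mult.commute)
  have tz: "t \<bullet> z = (\<Sum>l\<in>UNIV. (v l \<bullet> z) * (dual_frame v l \<bullet> z))"
    by (simp add: t_def inner_sum_left)
  have "t \<bullet> t = (\<Sum>l\<in>UNIV. (v l \<bullet> z) * (dual_frame v l \<bullet> t))"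
    by (subst t_def) (simp add: inner_sum_left)
  then have "t \<bullet> t = t \<bullet> z"
    by (simp add: tz dt)
  then have "(norm t)\<^sup>2 \<le> norm t * norm z"
    using norm_cauchy_schwarz[of t z] by (simp add: power2_norm_eq_inner)
  then have "norm t \<le> norm z"
    by (cases "t = 0") (auto simp: power2_eq_square)
  then have "t \<bullet> z \<le> norm z * norm z"
    using norm_cauchy_schwarz[of t z] mult_right_mono[of "norm t" "norm z" "norm z"] by simp
  then show ?thesis
    by (simp add: tz power2_eq_square)
qed

section \<open>Metric contractions as sums over an orthonormal basis\<close>

lemma sum_inner_expand:
  fixes e :: "'m::finite \<Rightarrow> 'e::euclidean_space"
  shows "(\<Sum>i\<in>UNIV. \<Sum>k\<in>UNIV. (e i \<bullet> e k) *\<^sub>R h i k)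
    = (\<Sum>b\<in>Basis. \<Sum>i\<in>UNIV. \<Sum>k\<in>UNIV. ((e i \<bullet> b) * (e k \<bullet> b)) *\<^sub>R (h i k :: 'd::real_vector))"
proof -
  have "(\<Sum>i\<in>UNIV. \<Sum>k\<in>UNIV. (e i \<bullet> e k) *\<^sub>R h i k)
    = (\<Sum>i\<in>UNIV. \<Sum>k\<in>UNIV. \<Sum>b\<in>Basis. ((e i \<bullet> b) * (e k \<bullet> b)) *\<^sub>R h i k)"
    by (subst euclidean_inner) (simp add: scaleR_sum_left)
  also have "\<dots> = (\<Sum>i\<in>UNIV. \<Sum>b\<in>Basis. \<Sum>k\<in>UNIV. ((e i \<bullet> b) * (e k \<bullet> b)) *\<^sub>R h i k)"
    by (intro sum.cong refl) (rule sum.swap)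
  also have "\<dots> = (\<Sum>b\<in>Basis. \<Sum>i\<in>UNIV. \<Sum>k\<in>UNIV. ((e i \<bullet> b) * (e k \<bullet> b)) *\<^sub>R h i k)"
    by (rule sum.swap)
  finally show ?thesis .
qed

text \<open>With a coframe for \<open>e\<close> the left side contracts both slots of
  \<open>A\<close> with the inverse metric, as the Hilbert-Schmidt norm does. The right side is a
  sum of squares of ambient components of the same tensor, from which nonnegativity and independence
  of the chart can be read off.\<close>

lemma sum_inner_expand2:
  fixes e :: "'m::finite \<Rightarrow> 'e::euclidean_space" and A :: "'m \<Rightarrow> 'm \<Rightarrow> 'd::real_inner"
  shows "(\<Sum>i\<in>UNIV. \<Sum>j\<in>UNIV. \<Sum>k\<in>UNIV. \<Sum>l\<in>UNIV. (e i \<bullet> e k) * (e j \<bullet> e l) * (A i j \<bullet> A k l))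
    = (\<Sum>b\<in>Basis. \<Sum>c\<in>Basis. (norm (\<Sum>i\<in>UNIV. \<Sum>j\<in>UNIV. ((e i \<bullet> b) * (e j \<bullet> c)) *\<^sub>R A i j))\<^sup>2)"
proof -
  have "(\<Sum>i\<in>UNIV. \<Sum>j\<in>UNIV. \<Sum>k\<in>UNIV. \<Sum>l\<in>UNIV. (e i \<bullet> e k) * (e j \<bullet> e l) * (A i j \<bullet> A k l))
     = (\<Sum>i\<in>UNIV. \<Sum>k\<in>UNIV. (e i \<bullet> e k) *\<^sub>R (\<Sum>j\<in>UNIV. \<Sum>l\<in>UNIV. (e j \<bullet> e l) *\<^sub>R (A i j \<bullet> A k l)))"
    by (rule sum.cong[OF refl], subst sum.swap) (simp add: sum_distrib_left mult.assoc)
  also have "\<dots> = (\<Sum>b\<in>Basis. \<Sum>i\<in>UNIV. \<Sum>k\<in>UNIV. ((e i \<bullet> b) * (e k \<bullet> b)) *\<^sub>R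
      (\<Sum>c\<in>Basis. \<Sum>j\<in>UNIV. \<Sum>l\<in>UNIV. ((e j \<bullet> c) * (e l \<bullet> c)) *\<^sub>R (A i j \<bullet> A k l)))"
    unfolding sum_inner_expand ..
  also have "\<dots> = (\<Sum>b\<in>Basis. \<Sum>c\<in>Basis. \<Sum>i\<in>UNIV. \<Sum>k\<in>UNIV. ((e i \<bullet> b) * (e k \<bullet> b)) *\<^sub>R
      (\<Sum>j\<in>UNIV. \<Sum>l\<in>UNIV. ((e j \<bullet> c) * (e l \<bullet> c)) *\<^sub>R (A i j \<bullet> A k l)))"
  proof (rule sum.cong[OF refl])
    fix b :: 'e
    show "(\<Sum>i\<in>UNIV. \<Sum>k\<in>UNIV. ((e i \<bullet> b) * (e k \<bullet> b)) *\<^sub>R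
      (\<Sum>c\<in>Basis. \<Sum>j\<in>UNIV. \<Sum>l\<in>UNIV. ((e j \<bullet> c) * (e l \<bullet> c)) *\<^sub>R (A i j \<bullet> A k l)))
     = (\<Sum>c\<in>Basis. \<Sum>i\<in>UNIV. \<Sum>k\<in>UNIV. ((e i \<bullet> b) * (e k \<bullet> b)) *\<^sub>R
      (\<Sum>j\<in>UNIV. \<Sum>l\<in>UNIV. ((e j \<bullet> c) * (e l \<bullet> c)) *\<^sub>R (A i j \<bullet> A k l)))"
    proof -
      have "(\<Sum>i\<in>UNIV. \<Sum>k\<in>UNIV. \<Sum>c\<in>Basis. f i k c) = (\<Sum>c\<in>Basis. \<Sum>i\<in>UNIV. \<Sum>k\<in>UNIV. f i k c)"
        for f :: "'m \<Rightarrow> 'm \<Rightarrow> 'e \<Rightarrow> real"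
        by (simp add: sum.swap[of _ Basis])
      then show ?thesis
        unfolding scaleR_sum_right[where A = Basis] .
    qed
  qed
  also have "\<dots> = (\<Sum>b\<in>Basis. \<Sum>c\<in>Basis. (norm (\<Sum>i\<in>UNIV. \<Sum>j\<in>UNIV. ((e i \<bullet> b) * (e j \<bullet> c)) *\<^sub>R A i j))\<^sup>2)"
  proof (intro sum.cong refl)
    fix b c :: 'e
    show "(\<Sum>i\<in>UNIV. \<Sum>k\<in>UNIV. ((e i \<bullet> b) * (e k \<bullet> b)) *\<^sub>R
        (\<Sum>j\<in>UNIV. \<Sum>l\<in>UNIV. ((e j \<bullet> c) * (e l \<bullet> c)) *\<^sub>R (A i j \<bullet> A k l)))
      = (norm (\<Sum>i\<in>UNIV. \<Sum>j\<in>UNIV. ((e i \<bullet> b) * (e j \<bullet> c)) *\<^sub>R A i j))\<^sup>2"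
    proof -
      have II: "(\<Sum>i\<in>UNIV. x i) \<bullet> (\<Sum>i\<in>UNIV. y i) = (\<Sum>i\<in>UNIV. \<Sum>k\<in>UNIV. x i \<bullet> y k)"
        for x y :: "'m \<Rightarrow> 'd"
        by (subst inner_sum_left) (simp only: inner_sum_right)
      define Y where "Y i = (\<Sum>j\<in>UNIV. (e j \<bullet> c) *\<^sub>R A i j)" for i
      have "(\<Sum>i\<in>UNIV. \<Sum>j\<in>UNIV. ((e i \<bullet> b) * (e j \<bullet> c)) *\<^sub>R A i j) = (\<Sum>i\<in>UNIV. (e i \<bullet> b) *\<^sub>R Y i)"
        by (simp add: Y_def scaleR_sum_right)
      moreover have "Y i \<bullet> Y k = (\<Sum>j\<in>UNIV. \<Sum>l\<in>UNIV. ((e j \<bullet> c) * (e l \<bullet> c)) *\<^sub>R (A i j \<bullet> A k l))" for i k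
        unfolding Y_def II by (simp add: mult.assoc mult.left_commute)
      ultimately show ?thesis
        by (simp add: power2_norm_eq_inner II mult.assoc mult.left_commute)
    qed
  qed
  finally show ?thesis .
qed

lemma metric_eq_gram: "metric F x = gram (\<lambda>i. pd F i x)"
  by (simp add: metric_def gram_def)

section \<open>Calculus in coordinates\<close>

text \<open>Class C1 in coordinates. This is the regularity of |u|^p, which for p < 2 need not have
  second derivatives.\<close>

definition C1_on :: "(real^'m::finite) set \<Rightarrow> (real^'m \<Rightarrow> 'c::real_normed_vector) \<Rightarrow> bool" where
  "C1_on S f \<longleftrightarrow> (\<forall>x\<in>S. f differentiable (at x)) \<and> (\<forall>i. continuous_on S (pd f i))"

lemma pd_eqI: "(f has_derivative f') (at x) \<Longrightarrow> pd f i x = f' (axis i 1)"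
  unfolding pd_def by (simp add: frechet_derivative_at[symmetric])

lemma has_derivative_pd:
  fixes f :: "real^'m::finite \<Rightarrow> 'c::real_normed_vector"
  assumes "f differentiable (at x)"
  shows "(f has_derivative (\<lambda>h. \<Sum>i\<in>UNIV. h $ i *\<^sub>R pd f i x)) (at x)"
proof -
  let ?D = "frechet_derivative f (at x)"
  have D: "(f has_derivative ?D) (at x)"
    using assms by (simp add: frechet_derivative_works)
  have lin: "linear ?D"
    using D has_derivative_linear by blast
  have "?D h = (\<Sum>i\<in>UNIV. h $ i *\<^sub>R pd f i x)" for h
  proof -
    have "h = (\<Sum>i\<in>UNIV. h $ i *\<^sub>R axis i 1)"
      by (simp add: vec_eq_iff axis_def if_distrib cong: if_cong)
    then have "?D h = ?D (\<Sum>i\<in>UNIV. h $ i *\<^sub>R axis i 1)"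
      by simp
    then show ?thesis
      by (simp add: linear_sum[OF lin] linear_cmul[OF lin] pd_def)
  qed
  then have "?D = (\<lambda>h. \<Sum>i\<in>UNIV. h $ i *\<^sub>R pd f i x)"
    by (rule ext)
  with D show ?thesis
    by simp
qed

lemma pd_cong:
  assumes "open S" "x \<in> S" "\<And>y. y \<in> S \<Longrightarrow> f y = g y"
  shows "pd f i x = pd g i x"
proof -
  have "(f has_derivative F) (at x) \<longleftrightarrow> (g has_derivative F) (at x)" for F
    using assms has_derivative_transform_within_open[of _ F x UNIV S] by metis
  then show ?thesis
    by (simp add: pd_def frechet_derivative_def)
qed

lemma differentiable_cong_open:
  assumes "open S" "x \<in> S" "\<And>y. y \<in> S \<Longrightarrow> f y = g y"
  shows "f differentiable (at x) \<longleftrightarrow> g differentiable (at x)"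
  using assms has_derivative_transform_within_open[of _ _ x UNIV S]
  unfolding differentiable_def by metis

lemma C1_on_cong:
  assumes "open S" "\<And>y. y \<in> S \<Longrightarrow> f y = g y"
  shows "C1_on S f \<longleftrightarrow> C1_on S g"
proof -
  have "continuous_on S (pd f i) \<longleftrightarrow> continuous_on S (pd g i)" for i
    by (intro continuous_on_cong refl pd_cong[of S]) (use assms in auto)
  then show ?thesis
    using differentiable_cong_open[of S _ f g] assms by (auto simp: C1_on_def)
qed

lemma C1_on_eq:
  assumes "open S" "C1_on S g" "\<And>y. y \<in> S \<Longrightarrow> f y = g y"
  shows "C1_on S f"
  using C1_on_cong[OF assms(1,3)] assms(2) by simp

lemma C1_on_subset: "C1_on S f \<Longrightarrow> T \<subseteq> S \<Longrightarrow> C1_on T f"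
  unfolding C1_on_def by (meson continuous_on_subset subsetD)

lemma C1_on_Un:
  assumes "open S" "open T" "C1_on S f" "C1_on T f"
  shows "C1_on (S \<union> T) f"
  using assms by (auto simp: C1_on_def intro: continuous_on_open_Un)

lemma C1_on_differentiable: "C1_on S f \<Longrightarrow> x \<in> S \<Longrightarrow> f differentiable (at x)"
  by (simp add: C1_on_def)

lemma C1_on_pd: "C1_on S f \<Longrightarrow> continuous_on S (pd f i)"
  by (simp add: C1_on_def)

lemma C1_on_continuous: "C1_on S f \<Longrightarrow> continuous_on S f"
  unfolding C1_on_def continuous_on_eq_continuous_within
  by (meson continuous_at_imp_continuous_at_within differentiable_imp_continuous_within)

lemma C1_onI:
  assumes "\<And>x. x \<in> S \<Longrightarrow> (f has_derivative D x) (at x)"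
    and "\<And>i. continuous_on S (\<lambda>x. D x (axis i 1))"
  shows "C1_on S f"
proof -
  have "continuous_on S (pd f i) \<longleftrightarrow> continuous_on S (\<lambda>x. D x (axis i 1))" for i
    by (intro continuous_on_cong refl pd_eqI assms)
  then show ?thesis
    using assms by (auto simp: C1_on_def differentiable_def)
qed

lemma C1_on_const [intro, simp]: "C1_on S (\<lambda>x. c)"
  by (rule C1_onI[where D = "\<lambda>x h. 0"]) auto

lemma has_derivative_bilinear_pd:
  assumes "bounded_bilinear b" "f differentiable (at x)" "g differentiable (at x)"
  shows "((\<lambda>x. b (f x) (g x)) has_derivative
    (\<lambda>h. b (f x) (\<Sum>i\<in>UNIV. h $ i *\<^sub>R pd g i x) + b (\<Sum>i\<in>UNIV. h $ i *\<^sub>R pd f i x) (g x))) (at x)"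
  by (rule bounded_bilinear.FDERIV[OF assms(1)]) (use assms has_derivative_pd in auto)

lemma sum_axis_scaleR [simp]: "(\<Sum>i\<in>UNIV. axis j 1 $ i *\<^sub>R f i) = (f j :: 'c::real_vector)"
  for j :: "'m::finite"
  by (simp add: axis_def if_distribR if_distrib[of "\<lambda>c. c *\<^sub>R _"] cong: if_cong)

lemma pd_bilinear:
  assumes "bounded_bilinear b" "f differentiable (at x)" "g differentiable (at x)"
  shows "pd (\<lambda>x. b (f x) (g x)) i x = b (f x) (pd g i x) + b (pd f i x) (g x)"
  using pd_eqI[OF has_derivative_bilinear_pd[OF assms]] by simp

lemma C1_on_bilinear:
  assumes "bounded_bilinear b" "C1_on S f" "C1_on S g"
  shows "C1_on S (\<lambda>x. b (f x) (g x))"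
proof (rule C1_onI)
  show "((\<lambda>x. b (f x) (g x)) has_derivative
    (\<lambda>h. b (f x) (\<Sum>i\<in>UNIV. h $ i *\<^sub>R pd g i x) + b (\<Sum>i\<in>UNIV. h $ i *\<^sub>R pd f i x) (g x))) (at x)"
    if "x \<in> S" for x
    by (rule has_derivative_bilinear_pd) (use assms that in \<open>auto simp: C1_on_def\<close>)
  show "continuous_on S (\<lambda>x. b (f x) (\<Sum>j\<in>UNIV. axis i 1 $ j *\<^sub>R pd g j x)
      + b (\<Sum>j\<in>UNIV. axis i 1 $ j *\<^sub>R pd f j x) (g x))" for i
    unfolding sum_axis_scaleR
    by (intro continuous_on_add bounded_bilinear.continuous_on[OF assms(1)])
      (use assms in \<open>auto intro: C1_on_pd C1_on_continuous\<close>)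
qed

lemmas C1_on_mult = C1_on_bilinear[OF bounded_bilinear_mult]
lemmas C1_on_scaleR = C1_on_bilinear[OF bounded_bilinear_scaleR]
lemmas C1_on_inner = C1_on_bilinear[OF bounded_bilinear_inner]

lemma C1_on_linear:
  assumes "bounded_linear L" "C1_on S f"
  shows "C1_on S (\<lambda>x. L (f x))"
proof (rule C1_onI)
  show "((\<lambda>x. L (f x)) has_derivative (\<lambda>h. L (\<Sum>i\<in>UNIV. h $ i *\<^sub>R pd f i x))) (at x)" if "x \<in> S" for x
    by (rule bounded_linear.has_derivative[OF assms(1)])
      (use assms that has_derivative_pd in \<open>auto simp: C1_on_def\<close>)
  show "continuous_on S (\<lambda>x. L (\<Sum>j\<in>UNIV. axis i 1 $ j *\<^sub>R pd f j x))" for i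
    unfolding sum_axis_scaleR
    by (intro bounded_linear.continuous_on[OF assms(1)] C1_on_pd[OF assms(2)])
qed

lemma pd_linear:
  assumes "bounded_linear L" "f differentiable (at x)"
  shows "pd (\<lambda>x. L (f x)) i x = L (pd f i x)"
  using pd_eqI[OF bounded_linear.has_derivative[OF assms(1) has_derivative_pd[OF assms(2)]]] by simp

lemma C1_on_add:
  assumes "C1_on S f" "C1_on S g"
  shows "C1_on S (\<lambda>x. f x + g x)"
proof (rule C1_onI)
  show "((\<lambda>x. f x + g x) has_derivative
    (\<lambda>h. (\<Sum>i\<in>UNIV. h $ i *\<^sub>R pd f i x) + (\<Sum>i\<in>UNIV. h $ i *\<^sub>R pd g i x))) (at x)" if "x \<in> S" for x
    by (intro has_derivative_add has_derivative_pd) (use assms that in \<open>auto simp: C1_on_def\<close>)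
  show "continuous_on S (\<lambda>x. (\<Sum>j\<in>UNIV. axis i 1 $ j *\<^sub>R pd f j x) + (\<Sum>j\<in>UNIV. axis i 1 $ j *\<^sub>R pd g j x))" for i
    unfolding sum_axis_scaleR using assms by (intro continuous_intros C1_on_pd)
qed

lemma C1_on_sum:
  assumes "\<And>i. i \<in> I \<Longrightarrow> C1_on S (f i)"
  shows "C1_on S (\<lambda>x. \<Sum>i\<in>I. f i x)"
  using assms by (induction I rule: infinite_finite_induct) (auto intro!: C1_on_add)

lemma C1_on_diff:
  assumes "C1_on S f" "C1_on S g"
  shows "C1_on S (\<lambda>x. f x - g x)"
  using C1_on_add[OF assms(1) C1_on_linear[OF bounded_linear_minus[OF bounded_linear_ident] assms(2)]] by simp

lemma C1_on_prod:
  fixes f :: "'i \<Rightarrow> real^'m::finite \<Rightarrow> real"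
  assumes "\<And>i. i \<in> I \<Longrightarrow> C1_on S (f i)"
  shows "C1_on S (\<lambda>x. \<Prod>i\<in>I. f i x)"
  using assms by (induction I rule: infinite_finite_induct) (auto intro!: C1_on_mult)

lemma pd_sum:
  assumes "\<And>j. j \<in> I \<Longrightarrow> f j differentiable (at x)"
  shows "pd (\<lambda>x. \<Sum>j\<in>I. f j x) i x = (\<Sum>j\<in>I. pd (f j) i x)"
proof -
  have "((\<lambda>x. \<Sum>j\<in>I. f j x) has_derivative (\<lambda>h. \<Sum>j\<in>I. \<Sum>i\<in>UNIV. h $ i *\<^sub>R pd (f j) i x)) (at x)"
    by (intro has_derivative_sum has_derivative_pd assms)
  from pd_eqI[OF this] show ?thesis by simp
qed

lemma pd_real_compose:
  fixes f :: "real^'m::finite \<Rightarrow> real" and h :: "real \<Rightarrow> real"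
  assumes "f differentiable (at x)" "(h has_field_derivative h') (at (f x))"
  shows "(\<lambda>x. h (f x)) differentiable (at x)" "pd (\<lambda>x. h (f x)) i x = h' * pd f i x"
proof -
  have "((\<lambda>x. h (f x)) has_derivative (\<lambda>y. h' * (\<Sum>i\<in>UNIV. y $ i *\<^sub>R pd f i x))) (at x)"
    using has_derivative_compose[OF has_derivative_pd[OF assms(1)] assms(2)[unfolded has_field_derivative_def]] .
  then show "(\<lambda>x. h (f x)) differentiable (at x)" "pd (\<lambda>x. h (f x)) i x = h' * pd f i x"
    using pd_eqI[of "\<lambda>x. h (f x)" _ x i] sum_axis_scaleR[of i "\<lambda>i. pd f i x"]
    by (auto simp: differentiable_def)
qed

lemma C1_on_real_compose:
  fixes f :: "real^'m::finite \<Rightarrow> real" and h :: "real \<Rightarrow> real"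
  assumes f: "C1_on S f" and h: "\<And>x. x \<in> S \<Longrightarrow> (h has_field_derivative h' (f x)) (at (f x))"
    and h': "continuous_on T h'" and T: "f ` S \<subseteq> T"
  shows "C1_on S (\<lambda>x. h (f x))"
proof -
  have "continuous_on S (pd (\<lambda>x. h (f x)) i) \<longleftrightarrow> continuous_on S (\<lambda>x. h' (f x) * pd f i x)" for i
    by (intro continuous_on_cong refl pd_real_compose(2)) (use f h in \<open>auto simp: C1_on_def\<close>)
  moreover have "continuous_on S (\<lambda>x. h' (f x) * pd f i x)" for i
    by (intro continuous_on_mult continuous_on_compose2[OF h' C1_on_continuous[OF f] T] C1_on_pd[OF f])
  ultimately show ?thesis
    using f h pd_real_compose(1) by (fastforce simp: C1_on_def)
qed

lemma C1_on_divide: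
  fixes f g :: "real^'m::finite \<Rightarrow> real"
  assumes "C1_on S f" "C1_on S g" "\<And>x. x \<in> S \<Longrightarrow> g x \<noteq> 0"
  shows "C1_on S (\<lambda>x. f x / g x)"
proof -
  have "C1_on S (\<lambda>x. inverse (g x))"
  proof (rule C1_on_real_compose[OF assms(2), where T = "- {0}"])
    show "(inverse has_field_derivative (- (inverse (g x) ^ 2))) (at (g x))" if "x \<in> S" for x
      using DERIV_inverse[OF assms(3)[OF that]] by (simp add: numeral_2_eq_2)
    show "continuous_on (- {0}) (\<lambda>x. - (inverse x ^ 2 :: real))"
      by (intro continuous_intros) auto
  qed (use assms(3) in auto)
  then show ?thesis
    using C1_on_mult[OF assms(1)] by (simp add: divide_inverse)
qed

lemma C1_on_sqrt:
  fixes f :: "real^'m::finite \<Rightarrow> real"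
  assumes "C1_on S f" "\<And>x. x \<in> S \<Longrightarrow> f x > 0"
  shows "C1_on S (\<lambda>x. sqrt (f x))"
proof (rule C1_on_real_compose[OF assms(1), where T = "{0<..}"])
  show "(sqrt has_field_derivative (inverse (sqrt (f x)) / 2)) (at (f x))" if "x \<in> S" for x
    using DERIV_real_sqrt[OF assms(2)[OF that]] .
  show "continuous_on {0<..} (\<lambda>x::real. inverse (sqrt x) / 2)"
    by (intro continuous_intros) auto
qed (use assms(2) in auto)

lemma has_derivative_compose_pd:
  fixes g :: "real^'n::finite \<Rightarrow> 'c::real_normed_vector" and \<tau> :: "real^'m::finite \<Rightarrow> real^'n"
  assumes "\<tau> differentiable (at x)" "g differentiable (at (\<tau> x))"
  shows "((\<lambda>x. g (\<tau> x)) has_derivative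
    (\<lambda>h. \<Sum>a\<in>UNIV. (\<Sum>i\<in>UNIV. h $ i *\<^sub>R pd \<tau> i x) $ a *\<^sub>R pd g a (\<tau> x))) (at x)"
  by (rule has_derivative_compose) (use assms has_derivative_pd in auto)

lemma pd_compose:
  fixes g :: "real^'n::finite \<Rightarrow> 'c::real_normed_vector" and \<tau> :: "real^'m::finite \<Rightarrow> real^'n"
  assumes "\<tau> differentiable (at x)" "g differentiable (at (\<tau> x))"
  shows "pd (\<lambda>x. g (\<tau> x)) i x = (\<Sum>a\<in>UNIV. pd \<tau> i x $ a *\<^sub>R pd g a (\<tau> x))"
  using pd_eqI[OF has_derivative_compose_pd[OF assms]] by simp

lemma C1_on_compose:
  fixes g :: "real^'n::finite \<Rightarrow> 'c::real_normed_vector" and \<tau> :: "real^'m::finite \<Rightarrow> real^'n"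
  assumes \<tau>: "C1_on S \<tau>" and g: "C1_on T g" and ST: "\<tau> ` S \<subseteq> T"
  shows "C1_on S (\<lambda>x. g (\<tau> x))"
proof (rule C1_onI)
  show "((\<lambda>x. g (\<tau> x)) has_derivative
    (\<lambda>h. \<Sum>a\<in>UNIV. (\<Sum>i\<in>UNIV. h $ i *\<^sub>R pd \<tau> i x) $ a *\<^sub>R pd g a (\<tau> x))) (at x)" if "x \<in> S" for x
    by (rule has_derivative_compose_pd) (use assms that in \<open>auto simp: C1_on_def\<close>)
  show "continuous_on S (\<lambda>x. \<Sum>a\<in>UNIV. (\<Sum>j\<in>UNIV. axis i 1 $ j *\<^sub>R pd \<tau> j x) $ a *\<^sub>R pd g a (\<tau> x))" for i
    unfolding sum_axis_scaleR
    by (intro continuous_intros continuous_on_compose2[OF C1_on_pd[OF g] C1_on_continuous[OF \<tau>] ST]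
        C1_on_pd[OF \<tau>])
qed

lemma smooth_on_imp_C1_on: "smooth_on S f \<Longrightarrow> C1_on S f"
proof -
  assume "smooth_on S f"
  then have "Ck_on (Suc 0) S f"
    unfolding smooth_on_def by blast
  then show "C1_on S f"
    by (simp add: C1_on_def pd_def[abs_def])
qed

lemma smooth_on_pd: "smooth_on S f \<Longrightarrow> smooth_on S (pd f i)"
  unfolding smooth_on_def
proof
  fix k
  assume "\<forall>k. Ck_on k S f"
  then have "Ck_on (Suc k) S f"
    by blast
  then show "Ck_on k S (pd f i)"
    by (simp add: pd_def[abs_def])
qed

section \<open>Derivatives of determinants and of inverse matrices\<close>

lemma C1_on_det:
  fixes A :: "real^'m::finite \<Rightarrow> real^'n::finite^'n"
  assumes "\<And>i j. C1_on S (\<lambda>x. A x $ i $ j)"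
  shows "C1_on S (\<lambda>x. det (A x))"
  unfolding det_def by (intro C1_on_sum C1_on_mult C1_on_prod C1_on_const assms)

lemma pd_prod:
  fixes f :: "'i \<Rightarrow> real^'m::finite \<Rightarrow> real"
  assumes "\<And>i. i \<in> I \<Longrightarrow> f i differentiable (at x)"
  shows "pd (\<lambda>x. \<Prod>i\<in>I. f i x) k x = (\<Sum>i\<in>I. pd (f i) k x * (\<Prod>j\<in>I - {i}. f j x))"
proof -
  have "((\<lambda>x. \<Prod>i\<in>I. f i x) has_derivative
     (\<lambda>h. \<Sum>i\<in>I. (\<Sum>k\<in>UNIV. h $ k *\<^sub>R pd (f i) k x) * (\<Prod>j\<in>I - {i}. f j x))) (at x)"
    by (intro has_derivative_prod has_derivative_pd assms)
  from pd_eqI[OF this] show ?thesis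
    by (simp only: sum_axis_scaleR)
qed

text \<open>Jacobi's formula. The product rule on the Leibniz sum gives determinants with one row of
  \<open>A\<close> replaced by its derivative. Since \<open>A' = (A' ** B) ** A\<close>, that row is
  a combination of the rows of \<open>A\<close>, of which only the \<open>i\<close>-th survives in
  the determinant.\<close>

lemma pd_det:
  fixes A :: "real^'m::finite \<Rightarrow> real^'n::finite^'n"
  assumes A: "\<And>i j. (\<lambda>x. A x $ i $ j) differentiable (at x)"
    and B: "B ** A x = mat 1"
  shows "pd (\<lambda>x. det (A x)) k x = det (A x) * (\<Sum>i\<in>UNIV. \<Sum>j\<in>UNIV. pd (\<lambda>x. A x $ i $ j) k x * B $ j $ i)"
proof -
  define A' where "A' = (\<chi> i j. pd (\<lambda>x. A x $ i $ j) k x)"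
  have diff_prod: "(\<lambda>x. \<Prod>i\<in>UNIV. A x $ i $ p i) differentiable (at x)" for p
    unfolding differentiable_def by (rule exI, rule has_derivative_prod, rule has_derivative_pd[OF A])
  have mult: "pd (\<lambda>x. c * f x) k x = c * pd f k x" if "f differentiable (at x)" for c and f :: "real^'m \<Rightarrow> real"
    using pd_linear[OF bounded_linear_mult_right that] .
  have "pd (\<lambda>x. det (A x)) k x
    = (\<Sum>p | p permutes UNIV. of_int (sign p) * (\<Sum>i\<in>UNIV. A' $ i $ p i * (\<Prod>j\<in>UNIV - {i}. A x $ j $ p j)))"
    unfolding det_def
    by (subst pd_sum) (auto simp: mult diff_prod pd_prod A A'_def intro!: derivative_intros)
  also have "\<dots> = (\<Sum>i\<in>UNIV. \<Sum>p | p permutes UNIV. of_int (sign p) * (A' $ i $ p i * (\<Prod>j\<in>UNIV - {i}. A x $ j $ p j)))"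
    by (simp add: sum_distrib_left) (rule sum.swap)
  also have "\<dots> = (\<Sum>i\<in>UNIV. det (\<chi> j. if j = i then A' $ j else A x $ j))"
  proof (intro sum.cong refl)
    fix i
    have "(\<Prod>j\<in>UNIV. (\<chi> j. if j = i then A' $ j else A x $ j) $ j $ p j)
      = A' $ i $ p i * (\<Prod>j\<in>UNIV - {i}. A x $ j $ p j)" for p
      by (subst prod.remove[of _ i]) (auto intro!: prod.cong)
    then show "(\<Sum>p | p permutes UNIV. of_int (sign p) * (A' $ i $ p i * (\<Prod>j\<in>UNIV - {i}. A x $ j $ p j)))
      = det (\<chi> j. if j = i then A' $ j else A x $ j)"
      by (simp add: det_def)
  qed
  also have "\<dots> = (\<Sum>i\<in>UNIV. (A' ** B) $ i $ i * det (A x))"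
  proof (intro sum.cong refl)
    fix i
    have "A' = (A' ** B) ** A x"
      by (simp add: matrix_mul_assoc[symmetric] B)
    then have "A' $ i = ((A' ** B) ** A x) $ i"
      by simp
    also have "\<dots> = (\<Sum>l\<in>UNIV. (A' ** B) $ i $ l *s row l (A x))"
      by (simp add: vec_eq_iff matrix_matrix_mult_def[of "A' ** B"] row_def)
    finally have "(\<chi> j. if j = i then A' $ j else A x $ j)
      = (\<chi> j. if j = i then \<Sum>l\<in>UNIV. (A' ** B) $ i $ l *s row l (A x) else row j (A x))"
      by (simp add: vec_eq_iff row_def)
    then show "det (\<chi> j. if j = i then A' $ j else A x $ j) = (A' ** B) $ i $ i * det (A x)"
      by (simp add: cramer_lemma_transpose)
  qed
  also have "\<dots> = det (A x) * (\<Sum>i\<in>UNIV. \<Sum>j\<in>UNIV. pd (\<lambda>x. A x $ i $ j) k x * B $ j $ i)"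
    by (simp add: matrix_matrix_mult_def A'_def sum_distrib_left mult.commute)
  finally show ?thesis .
qed

text \<open>Column \<open>l\<close> of the inverse solves \<open>A *v x = axis l 1\<close>. The
  quotient of determinants shows that the entries of an inverse are as regular as those of the
  matrix.\<close>

lemma inverse_cramer:
  fixes A :: "real^'n::finite^'n"
  assumes "A ** B = mat 1"
  shows "B $ k $ l = det (\<chi> i j. if j = k then axis l 1 $ i else A $ i $ j) / det A"
proof -
  have "det A * det B = 1"
    using assms by (metis det_I det_mul)
  then have "det A \<noteq> 0" by auto
  moreover have "A *v (B *v axis l 1) = axis l 1"
    by (simp add: matrix_vector_mul_assoc assms)
  ultimately have "B *v axis l 1 = (\<chi> k. det (\<chi> i j. if j = k then axis l 1 $ i else A $ i $ j) / det A)"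
    by (subst (asm) cramer)
  from arg_cong[OF this, of "\<lambda>v. v $ k"] show ?thesis
    by (simp add: matrix_vector_mult_basis column_def)
qed

lemma C1_on_inverse:
  fixes A B :: "real^'m::finite \<Rightarrow> real^'n::finite^'n"
  assumes S: "open S" and A: "\<And>i j. C1_on S (\<lambda>x. A x $ i $ j)"
    and AB: "\<And>x. x \<in> S \<Longrightarrow> A x ** B x = mat 1"
  shows "C1_on S (\<lambda>x. B x $ k $ l)"
proof -
  have nz: "det (A x) \<noteq> 0" if "x \<in> S" for x
    using AB[OF that] by (metis det_I det_mul mult_zero_left zero_neq_one)
  have "C1_on S (\<lambda>x. det (\<chi> i j. if j = k then axis l 1 $ i else A x $ i $ j) / det (A x))"
  proof (intro C1_on_divide C1_on_det A nz)
    show "C1_on S (\<lambda>x. (\<chi> i j. if j = k then axis l 1 $ i else A x $ i $ j) $ i $ j)" for i j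
      by (cases "j = k") (auto simp: A)
  qed auto
  then show ?thesis
    using C1_on_cong[OF S, of "\<lambda>x. B x $ k $ l"] inverse_cramer[OF AB] by (metis (no_types, lifting))
qed

section \<open>Symmetry of second partial derivatives\<close>

lemma DERIV_along_axis:
  fixes f :: "real^'m::finite \<Rightarrow> real"
  assumes "f differentiable (at (y + s *\<^sub>R axis i 1))"
  shows "((\<lambda>s. f (y + s *\<^sub>R axis i 1)) has_real_derivative pd f i (y + s *\<^sub>R axis i 1)) (at s)"
proof -
  have "((\<lambda>s. y + s *\<^sub>R axis i 1) has_derivative (\<lambda>t. t *\<^sub>R axis i (1::real))) (at s)"
    by (auto intro!: derivative_eq_intros)
  from has_derivative_compose[OF this has_derivative_pd[OF assms]]
  have "((\<lambda>s. f (y + s *\<^sub>R axis i 1)) has_derivative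
     (\<lambda>t. \<Sum>j\<in>UNIV. (t *\<^sub>R axis i 1) $ j *\<^sub>R pd f j (y + s *\<^sub>R axis i 1))) (at s)" .
  moreover have "(\<Sum>j\<in>UNIV. (t *\<^sub>R axis i 1) $ j *\<^sub>R pd f j z) = pd f i z * t" for t z
  proof -
    have "(\<Sum>j\<in>UNIV. (t *\<^sub>R axis i 1) $ j *\<^sub>R pd f j z) = t * (\<Sum>j\<in>UNIV. axis i 1 $ j *\<^sub>R pd f j z)"
      by (simp add: sum_distrib_left mult.assoc)
    then show ?thesis
      by (simp only: sum_axis_scaleR mult.commute)
  qed
  ultimately show ?thesis
    by (simp add: has_field_derivative_def)
qed

text \<open>Mean value theorem twice: in direction \<open>i\<close> for the increment of
  \<open>f\<close> along \<open>j\<close>, then in direction \<open>j\<close> for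
  \<open>pd f i\<close>.\<close>

lemma double_difference:
  fixes f :: "real^'m::finite \<Rightarrow> real"
  assumes f: "C1_on S f" "C1_on S (pd f i)" and h: "h > 0"
    and S: "\<And>s t. 0 \<le> s \<Longrightarrow> s \<le> h \<Longrightarrow> 0 \<le> t \<Longrightarrow> t \<le> h \<Longrightarrow> x + s *\<^sub>R axis i 1 + t *\<^sub>R axis j 1 \<in> S"
  shows "\<exists>\<xi> \<eta>. 0 < \<xi> \<and> \<xi> < h \<and> 0 < \<eta> \<and> \<eta> < h
    \<and> f (x + h *\<^sub>R axis i 1 + h *\<^sub>R axis j 1) - f (x + h *\<^sub>R axis i 1) - f (x + h *\<^sub>R axis j 1) + f x
      = h * h * pd (pd f i) j (x + \<xi> *\<^sub>R axis i 1 + \<eta> *\<^sub>R axis j 1)"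
proof -
  let ?a = "axis i (1::real)" and ?b = "axis j (1::real)"
  have "\<exists>\<xi>>0. \<xi> < h \<and> (f ((x + h *\<^sub>R ?b) + h *\<^sub>R ?a) - f (x + h *\<^sub>R ?a))
      - (f ((x + h *\<^sub>R ?b) + 0 *\<^sub>R ?a) - f (x + 0 *\<^sub>R ?a))
      = (h - 0) * (pd f i ((x + h *\<^sub>R ?b) + \<xi> *\<^sub>R ?a) - pd f i (x + \<xi> *\<^sub>R ?a))"
  proof (rule MVT2[OF h])
    fix s assume s: "0 \<le> s" "s \<le> h"
    have "(x + h *\<^sub>R ?b) + s *\<^sub>R ?a \<in> S" "x + s *\<^sub>R ?a \<in> S"
      using S[of s h] S[of s 0] s h by (simp_all add: add_ac)
    then show "((\<lambda>s. f ((x + h *\<^sub>R ?b) + s *\<^sub>R ?a) - f (x + s *\<^sub>R ?a)) has_real_derivative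
        pd f i ((x + h *\<^sub>R ?b) + s *\<^sub>R ?a) - pd f i (x + s *\<^sub>R ?a)) (at s)"
      by (intro DERIV_diff DERIV_along_axis C1_on_differentiable[OF f(1)])
  qed
  then obtain \<xi> where \<xi>: "0 < \<xi>" "\<xi> < h"
    and 1: "f ((x + h *\<^sub>R ?b) + h *\<^sub>R ?a) - f (x + h *\<^sub>R ?a) - (f (x + h *\<^sub>R ?b) - f x)
      = h * (pd f i ((x + h *\<^sub>R ?b) + \<xi> *\<^sub>R ?a) - pd f i (x + \<xi> *\<^sub>R ?a))"
    by auto
  have "\<exists>\<eta>>0. \<eta> < h \<and> pd f i ((x + \<xi> *\<^sub>R ?a) + h *\<^sub>R ?b) - pd f i ((x + \<xi> *\<^sub>R ?a) + 0 *\<^sub>R ?b)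
      = (h - 0) * pd (pd f i) j ((x + \<xi> *\<^sub>R ?a) + \<eta> *\<^sub>R ?b)"
    by (rule MVT2[OF h], rule DERIV_along_axis, rule C1_on_differentiable[OF f(2)])
      (use S \<xi> in auto)
  then obtain \<eta> where "0 < \<eta>" "\<eta> < h"
    "pd f i ((x + h *\<^sub>R ?b) + \<xi> *\<^sub>R ?a) - pd f i (x + \<xi> *\<^sub>R ?a) = h * pd (pd f i) j ((x + \<xi> *\<^sub>R ?a) + \<eta> *\<^sub>R ?b)"
    by (auto simp: add_ac)
  with \<xi> 1 show ?thesis
    by (intro exI[of _ \<xi>] exI[of _ \<eta>]) (simp add: add_ac)
qed

text \<open>The second difference is symmetric in \<open>i\<close> and \<open>j\<close>. Divided by
  \<open>h * h\<close> it equals each mixed derivative at some point close to \<open>x\<close>, and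
  these derivatives are continuous at \<open>x\<close>.\<close>

lemma pd_commute_real:
  fixes f :: "real^'m::finite \<Rightarrow> real"
  assumes S: "open S" "x \<in> S" and f: "C1_on S f" "\<And>i. C1_on S (pd f i)"
  shows "pd (pd f j) i x = pd (pd f i) j x"
proof -
  have "dist (pd (pd f j) i x) (pd (pd f i) j x) \<le> e" if "e > 0" for e
  proof -
    have "isCont (pd (pd f a) b) x" for a b
      using C1_on_pd[OF f(2)] S continuous_on_eq_continuous_at by blast
    then have "\<exists>d>0. \<forall>y. dist y x < d \<longrightarrow> dist (pd (pd f a) b y) (pd (pd f a) b x) < e / 2" for a b
      using \<open>e > 0\<close> half_gt_zero unfolding continuous_at_eps_delta by blast
    then obtain d1 d2 where d1: "d1 > 0" "\<And>y. dist y x < d1 \<Longrightarrow> dist (pd (pd f j) i y) (pd (pd f j) i x) < e / 2"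
      and d2: "d2 > 0" "\<And>y. dist y x < d2 \<Longrightarrow> dist (pd (pd f i) j y) (pd (pd f i) j x) < e / 2"
      by meson
    obtain d3 where d3: "d3 > 0" "ball x d3 \<subseteq> S"
      using S openE by blast
    \<comment> \<open>Points of the square with side \<open>h\<close> are within
      \<open>2 * h\<close> of \<open>x\<close>; a third of the smallest radius keeps them inside all
      three balls.\<close>
    define h where "h = min d1 (min d2 d3) / 3"
    have h: "h > 0" "2 * h < d1" "2 * h < d2" "2 * h < d3"
      using d1 d2 d3 by (auto simp: h_def)
    have near: "dist (x + s *\<^sub>R axis a 1 + t *\<^sub>R axis b 1) x \<le> 2 * h"
      if "0 \<le> s" "s \<le> h" "0 \<le> t" "t \<le> h" for s t and a b :: 'm
      using norm_triangle_ineq[of "s *\<^sub>R axis a (1::real)" "t *\<^sub>R axis b (1::real)"] that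
      by (simp add: dist_norm algebra_simps)
    have inS: "x + s *\<^sub>R axis a 1 + t *\<^sub>R axis b 1 \<in> S"
      if "0 \<le> s" "s \<le> h" "0 \<le> t" "t \<le> h" for s t and a b :: 'm
      using near[OF that, of a b] h d3 by (auto simp: dist_commute subset_iff)
    let ?\<Delta> = "f (x + h *\<^sub>R axis i 1 + h *\<^sub>R axis j 1) - f (x + h *\<^sub>R axis i 1) - f (x + h *\<^sub>R axis j 1) + f x"
    obtain \<xi> \<eta> where 1: "0 < \<xi>" "\<xi> < h" "0 < \<eta>" "\<eta> < h"
      "?\<Delta> = h * h * pd (pd f i) j (x + \<xi> *\<^sub>R axis i 1 + \<eta> *\<^sub>R axis j 1)"
      using double_difference[OF f(1) f(2)[of i] h(1) inS] by blast
    obtain \<xi>' \<eta>' where 2: "0 < \<xi>'" "\<xi>' < h" "0 < \<eta>'" "\<eta>' < h"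
      "f (x + h *\<^sub>R axis j 1 + h *\<^sub>R axis i 1) - f (x + h *\<^sub>R axis j 1) - f (x + h *\<^sub>R axis i 1) + f x
        = h * h * pd (pd f j) i (x + \<xi>' *\<^sub>R axis j 1 + \<eta>' *\<^sub>R axis i 1)"
      using double_difference[OF f(1) f(2)[of j] h(1) inS] by blast
    have "f (x + h *\<^sub>R axis j 1 + h *\<^sub>R axis i 1) = f (x + h *\<^sub>R axis i 1 + h *\<^sub>R axis j 1)"
      by (simp add: add_ac)
    with 1(5) 2(5) have "h * h * pd (pd f i) j (x + \<xi> *\<^sub>R axis i 1 + \<eta> *\<^sub>R axis j 1)
        = h * h * pd (pd f j) i (x + \<xi>' *\<^sub>R axis j 1 + \<eta>' *\<^sub>R axis i 1)"
      by linarith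
    then have eq: "pd (pd f i) j (x + \<xi> *\<^sub>R axis i 1 + \<eta> *\<^sub>R axis j 1)
        = pd (pd f j) i (x + \<xi>' *\<^sub>R axis j 1 + \<eta>' *\<^sub>R axis i 1)"
      using h by simp
    have "dist (pd (pd f i) j (x + \<xi> *\<^sub>R axis i 1 + \<eta> *\<^sub>R axis j 1)) (pd (pd f i) j x) < e / 2"
      by (rule d2) (use near[of \<xi> \<eta> i j] 1 h in auto)
    moreover have "dist (pd (pd f j) i (x + \<xi>' *\<^sub>R axis j 1 + \<eta>' *\<^sub>R axis i 1)) (pd (pd f j) i x) < e / 2"
      by (rule d1) (use near[of \<xi>' \<eta>' j i] 2 h in auto)
    ultimately show ?thesis
      unfolding eq dist_real_def by linarith
  qed
  then show ?thesis
    using field_le_epsilon[of "dist (pd (pd f j) i x) (pd (pd f i) j x)" 0] by simp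
qed

lemma pd_commute:
  fixes f :: "real^'m::finite \<Rightarrow> 'c::euclidean_space"
  assumes S: "open S" "x \<in> S" and f: "C1_on S f" "\<And>i. C1_on S (pd f i)"
  shows "pd (pd f j) i x = pd (pd f i) j x"
proof (rule euclidean_eqI)
  fix b :: 'c
  note bl = bounded_linear_inner_left[of b]
  have 1: "pd (\<lambda>x. f x \<bullet> b) a y = pd f a y \<bullet> b" if "y \<in> S" for a y
    using f(1) that by (intro pd_linear[OF bl]) (auto simp: C1_on_def)
  have 2: "pd (pd (\<lambda>x. f x \<bullet> b) a) c x = pd (pd f a) c x \<bullet> b" for a c
  proof -
    have "pd (pd (\<lambda>x. f x \<bullet> b) a) c x = pd (\<lambda>y. pd f a y \<bullet> b) c x"
      using S 1 by (intro pd_cong) auto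
    also have "\<dots> = pd (pd f a) c x \<bullet> b"
      using f(2) S by (intro pd_linear[OF bl]) (auto simp: C1_on_def)
    finally show ?thesis .
  qed
  have "C1_on S (pd (\<lambda>x. f x \<bullet> b) a)" for a
    by (rule C1_on_cong[OF S(1), THEN iffD2, OF _ C1_on_linear[OF bl f(2)[of a]]]) (rule 1)
  then have "pd (pd (\<lambda>x. f x \<bullet> b) j) i x = pd (pd (\<lambda>x. f x \<bullet> b) i) j x"
    using C1_on_linear[OF bl f(1)] by (intro pd_commute_real[OF S])
  then show "pd (pd f j) i x \<bullet> b = pd (pd f i) j x \<bullet> b"
    by (simp add: 2)
qed

section \<open>Integrals of derivatives of compactly supported functions\<close>

lemma pd_eq_0:
  assumes "open S" "x \<in> S" "\<And>y. y \<in> S \<Longrightarrow> f y = 0"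
  shows "pd f i x = 0"
  using pd_cong[OF assms(1,2), of f "\<lambda>_. 0"] assms(3) pd_eqI[of "\<lambda>_. 0" "\<lambda>_. 0"] by simp

lemma integrable_continuous_compact_support:
  fixes f :: "'b::euclidean_space \<Rightarrow> real"
  assumes "continuous_on UNIV f" "compact K" "\<And>x. x \<notin> K \<Longrightarrow> f x = 0"
  shows "integrable lborel f"
proof -
  have "integrable lborel (\<lambda>x. indicator K x *\<^sub>R f x)"
    using assms by (intro borel_integrable_compact continuous_on_subset[of UNIV f K]) auto
  moreover have "(\<lambda>x. indicator K x *\<^sub>R f x) = f"
  proof
    fix x
    show "indicator K x *\<^sub>R f x = f x"
      using assms(3)[of x] by (cases "x \<in> K") auto
  qed
  ultimately show ?thesis by simp
qed

text \<open>The difference quotients of \<open>f\<close> have integral 0 by translation invariance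
  of Lebesgue measure. They converge to the derivative, and dominated convergence carries this to
  the limit.\<close>

lemma integral_pd_eq_0:
  fixes f :: "real^'m::finite \<Rightarrow> real"
  assumes f: "C1_on UNIV f" and K: "compact K" "\<And>x. x \<notin> K \<Longrightarrow> f x = 0"
  shows "integrable lborel (pd f i)" "integral\<^sup>L lborel (pd f i) = 0"
proof -
  have cont: "continuous_on UNIV (pd f i)" and contf: "continuous_on UNIV f"
    using f by (auto intro: C1_on_pd C1_on_continuous)
  have pd0: "pd f i x = 0" if "x \<notin> K" for x
    by (rule pd_eq_0[of "- K"]) (use that K compact_imp_closed in auto)
  show "integrable lborel (pd f i)"
    using cont K(1) pd0 by (rule integrable_continuous_compact_support)
  have intf: "integrable lborel f"
    using contf K by (rule integrable_continuous_compact_support)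
  obtain R where R: "\<And>x. x \<in> K \<Longrightarrow> norm x \<le> R"
    using compact_imp_bounded[OF K(1)] bounded_iff by blast
  have "bounded (pd f i ` K)"
    using cont K(1) by (meson compact_continuous_image compact_imp_bounded continuous_on_subset subset_UNIV)
  then obtain B where B: "\<And>x. x \<in> K \<Longrightarrow> \<bar>pd f i x\<bar> \<le> B" "B > 0"
    unfolding bounded_pos by auto
  then have B': "\<bar>pd f i x\<bar> \<le> B" for x
    using pd0[of x] by (cases "x \<in> K") auto
  let ?e = "axis i (1::real) :: real^'m"
  define s where "s n x = (f (inverse (real (Suc n)) *\<^sub>R ?e + x) - f x) * real (Suc n)" for n x
  have trans: "integrable lborel (\<lambda>x. f (c + x))" "integral\<^sup>L lborel (\<lambda>x. f (c + x)) = integral\<^sup>L lborel f" for c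
  proof -
    have mf: "f \<in> borel_measurable borel"
      using contf by (rule borel_measurable_continuous_onI)
    have "integrable (distr lborel borel ((+) c)) f"
      using intf by (simp add: lborel_distr_plus)
    then show "integrable lborel (\<lambda>x. f (c + x))"
      using mf by (subst (asm) integrable_distr_eq) auto
    have "integral\<^sup>L (distr lborel borel ((+) c)) f = integral\<^sup>L lborel (\<lambda>x. f (c + x))"
      using mf by (intro integral_distr) auto
    then show "integral\<^sup>L lborel (\<lambda>x. f (c + x)) = integral\<^sup>L lborel f"
      by (simp add: lborel_distr_plus)
  qed
  have s_int: "integral\<^sup>L lborel (s n) = 0" for n
    unfolding s_def using trans intf by simp
  have "(\<lambda>n. integral\<^sup>L lborel (s n)) \<longlonglongrightarrow> integral\<^sup>L lborel (pd f i)"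
  \<comment> \<open>The shifts have length at most 1, so all quotients vanish outside the ball of
    radius \<open>R + 1\<close>; the mean value theorem bounds them by \<open>B\<close>
    inside.\<close>
  proof (rule integral_dominated_convergence[where w = "\<lambda>x. indicator (cball 0 (R + 1)) x *\<^sub>R B"])
    show "pd f i \<in> borel_measurable lborel"
      using cont borel_measurable_continuous_onI by simp blast
    show "s n \<in> borel_measurable lborel" for n
      unfolding s_def using intf trans(1) by (auto intro!: borel_measurable_times borel_measurable_diff)
    show "integrable lborel (\<lambda>x. indicator (cball 0 (R + 1)) x *\<^sub>R B :: real)"
      by (intro borel_integrable_compact) auto
    show "AE x in lborel. (\<lambda>n. s n x) \<longlonglongrightarrow> pd f i x"
    proof (rule AE_I2)
      fix x
      have "((\<lambda>s. f (x + s *\<^sub>R ?e)) has_real_derivative pd f i (x + 0 *\<^sub>R ?e)) (at 0)"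
        using f by (intro DERIV_along_axis) (simp add: C1_on_def)
      then have "((\<lambda>h. (f (x + h *\<^sub>R ?e) - f x) / h) \<longlongrightarrow> pd f i x) (at 0)"
        by (simp add: DERIV_def)
      moreover have "filterlim (\<lambda>n. inverse (real (Suc n))) (at 0) sequentially"
        unfolding filterlim_at using LIMSEQ_inverse_real_of_nat by (auto intro: always_eventually)
      ultimately have "(\<lambda>n. (f (x + inverse (real (Suc n)) *\<^sub>R ?e) - f x) / inverse (real (Suc n))) \<longlonglongrightarrow> pd f i x"
        by (rule filterlim_compose)
      then show "(\<lambda>n. s n x) \<longlonglongrightarrow> pd f i x"
        by (simp add: s_def add.commute divide_inverse)
    qed
    show "AE x in lborel. norm (s n x) \<le> indicator (cball 0 (R + 1)) x *\<^sub>R B" for n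
    proof (rule AE_I2)
      fix x
      define h where "h = inverse (real (Suc n))"
      have h: "0 < h" "h \<le> 1"
        by (auto simp: h_def inverse_le_1_iff)
      have "\<exists>\<xi>>0. \<xi> < h \<and> f (x + h *\<^sub>R ?e) - f (x + 0 *\<^sub>R ?e) = (h - 0) * pd f i (x + \<xi> *\<^sub>R ?e)"
        using f by (intro MVT2[OF h(1)] DERIV_along_axis) (simp add: C1_on_def)
      then obtain \<xi> where "f (x + h *\<^sub>R ?e) - f x = h * pd f i (x + \<xi> *\<^sub>R ?e)"
        by auto
      then have s: "s n x = pd f i (x + \<xi> *\<^sub>R ?e)"
        unfolding s_def h_def[symmetric] by (simp add: h_def add.commute)
      show "norm (s n x) \<le> indicator (cball 0 (R + 1)) x *\<^sub>R B"
      proof (cases "x \<in> cball 0 (R + 1)")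
        case True
        then show ?thesis using s B' by simp
      next
        case False
        then have "norm x > R + 1" by simp
        moreover have "norm x \<le> norm (h *\<^sub>R ?e + x) + norm (h *\<^sub>R ?e)"
          using norm_triangle_ineq4[of "h *\<^sub>R ?e + x" "h *\<^sub>R ?e"] by simp
        ultimately have "norm (h *\<^sub>R ?e + x) > R" "norm x > R"
          using h by auto
        then have "f (h *\<^sub>R ?e + x) = 0" "f x = 0"
          using R K(2) by (meson not_less)+
        then show ?thesis
          using False by (simp add: s_def h_def)
      qed
    qed
  qed
  then show "integral\<^sup>L lborel (pd f i) = 0"
    unfolding s_int using LIMSEQ_unique tendsto_const by blast
qed

section \<open>The divergence theorem in a chart\<close>

text \<open>An immersed patch of class C2: enough for \<open>coframe\<close> and \<open>vol\<close>
  to be C1 and for second derivatives to commute.\<close>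

definition regular :: "(real^'m::finite) set \<Rightarrow> (real^'m \<Rightarrow> 'e::euclidean_space) \<Rightarrow> bool" where
  "regular U F \<longleftrightarrow> open U \<and> C1_on U F \<and> (\<forall>i. C1_on U (pd F i)) \<and> (\<forall>x\<in>U. frame (\<lambda>i. pd F i x))"

text \<open>As an ambient vector this is the image under the derivative of \<open>F\<close> of the
  gradient of the \<open>i\<close>-th coordinate function.\<close>

definition coframe :: "(real^'m::finite \<Rightarrow> 'e::euclidean_space) \<Rightarrow> 'm \<Rightarrow> real^'m \<Rightarrow> 'e" where
  "coframe F i x = dual_frame (\<lambda>i. pd F i x) i"

definition vol :: "(real^'m::finite \<Rightarrow> 'e::euclidean_space) \<Rightarrow> real^'m \<Rightarrow> real" where
  "vol F x = sqrt (det (metric F x))"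

lemma coframe_eq: "coframe F i x = (\<Sum>k\<in>UNIV. metric_inv F x $ k $ i *\<^sub>R pd F k x)"
  by (simp add: coframe_def dual_frame_def metric_inv_def metric_eq_gram)

lemma sum_delta_scaleR:
  fixes f :: "'i::finite \<Rightarrow> 'c::real_vector"
  shows "(\<Sum>k\<in>UNIV. (if k = i then 1 else 0 :: real) *\<^sub>R f k) = f i"
    and "(\<Sum>k\<in>UNIV. (if i = k then 1 else 0 :: real) *\<^sub>R f k) = f i"
proof -
  have "(if P then 1 else 0 :: real) *\<^sub>R y = (if P then y else 0)" for P and y :: 'c
    by simp
  then show "(\<Sum>k\<in>UNIV. (if k = i then 1 else 0 :: real) *\<^sub>R f k) = f i"
    "(\<Sum>k\<in>UNIV. (if i = k then 1 else 0 :: real) *\<^sub>R f k) = f i"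
    by simp_all
qed

context
  fixes F :: "real^'m::finite \<Rightarrow> 'e::euclidean_space" and U
  assumes reg: "regular U F"
begin

lemma U_open: "open U"
  and C1_F: "C1_on U F"
  and C1_pd: "C1_on U (pd F i)"
  and frame_pd: "x \<in> U \<Longrightarrow> frame (\<lambda>i. pd F i x)"
  using reg by (auto simp: regular_def)

lemma pd_differentiable: "x \<in> U \<Longrightarrow> pd F i differentiable (at x)"
  using C1_pd C1_on_differentiable by blast

lemma C1_metric: "C1_on U (\<lambda>x. metric F x $ i $ j)"
  by (simp add: metric_def) (intro C1_on_inner C1_pd)

lemma metric_inverse: "x \<in> U \<Longrightarrow> metric F x ** metric_inv F x = mat 1"
  "x \<in> U \<Longrightarrow> metric_inv F x ** metric F x = mat 1"
  using matrix_inv_gram[OF frame_pd] by (auto simp: metric_inv_def metric_eq_gram)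

lemma metric_inv_sym: "x \<in> U \<Longrightarrow> metric_inv F x $ i $ j = metric_inv F x $ j $ i"
  using matrix_inv_gram_sym[OF frame_pd] by (auto simp: metric_inv_def metric_eq_gram)

lemma C1_metric_inv: "C1_on U (\<lambda>x. metric_inv F x $ i $ j)"
  by (rule C1_on_inverse[OF U_open C1_metric metric_inverse(1)])

lemma C1_coframe: "C1_on U (coframe F l)"
  unfolding coframe_eq[abs_def] by (intro C1_on_sum C1_on_scaleR C1_metric_inv C1_pd)

lemma det_metric_pos: "x \<in> U \<Longrightarrow> det (metric F x) > 0"
  using det_gram_pos[OF frame_pd] by (simp add: metric_eq_gram)

lemma C1_vol: "C1_on U (vol F)"
  unfolding vol_def[abs_def] by (intro C1_on_sqrt C1_on_det C1_metric det_metric_pos)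

lemma coframe_inner: "x \<in> U \<Longrightarrow> coframe F l x \<bullet> pd F j x = (if l = j then 1 else 0)"
  unfolding coframe_def by (rule dual_frame_inner[OF frame_pd])

lemma coframe_inner_coframe: "x \<in> U \<Longrightarrow> coframe F i x \<bullet> coframe F j x = metric_inv F x $ i $ j"
  unfolding coframe_def metric_inv_def metric_eq_gram by (rule dual_frame_inner_dual[OF frame_pd])

lemma normal_part_coframe:
  "normal_part F x z = z - (\<Sum>l\<in>UNIV. (z \<bullet> pd F l x) *\<^sub>R coframe F l x)"
  unfolding normal_part_def coframe_eq
  by (subst sum.swap) (simp add: scaleR_sum_right mult.commute)

lemma normal_part_linear: "linear (normal_part F x)"
  by (rule linearI) (simp_all add: normal_part_coframe inner_add_left scaleR_left_distrib sum.distrib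
      scaleR_sum_right scaleR_diff_right)

lemma normal_part_coframe_eq_0: "x \<in> U \<Longrightarrow> normal_part F x (coframe F i x) = 0"
  by (simp add: normal_part_coframe coframe_inner sum_delta_scaleR)

text \<open>A tangent vector is its own tangential projection: both are combinations of the frame
  and have the same products with it.\<close>

lemma normal_part_tangent:
  assumes x: "x \<in> U"
  shows "normal_part F x (pd F i x) = 0"
proof -
  have "pd F i x = (\<Sum>l\<in>UNIV. (pd F i x \<bullet> pd F l x) *\<^sub>R coframe F l x)"
  proof (rule frame_eqI[OF frame_pd[OF x]])
    show "pd F i x = (\<Sum>k\<in>UNIV. (if k = i then 1 else 0) *\<^sub>R pd F k x)"
      by (simp add: sum_delta_scaleR)
    show "(\<Sum>l\<in>UNIV. (pd F i x \<bullet> pd F l x) *\<^sub>R coframe F l x)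
      = (\<Sum>k\<in>UNIV. (\<Sum>l\<in>UNIV. (pd F i x \<bullet> pd F l x) * metric_inv F x $ k $ l) *\<^sub>R pd F k x)"
      unfolding coframe_eq by (simp add: scaleR_sum_right scaleR_sum_left) (rule sum.swap)
    show "pd F i x \<bullet> pd F k x = (\<Sum>l\<in>UNIV. (pd F i x \<bullet> pd F l x) *\<^sub>R coframe F l x) \<bullet> pd F k x" for k
      by (simp add: inner_sum_left coframe_inner x if_distrib cong: if_cong)
  qed
  then show ?thesis
    by (simp add: normal_part_coframe)
qed

text \<open>Jacobi's formula gives the trace of the inverse metric against the derivative of the
  metric. The product rule on the metric yields two traces, equal by symmetry of the inverse, and
  their sum cancels the 1/2 from the square root.\<close>

lemma pd_vol:
  assumes x: "x \<in> U"
  shows "pd (vol F) j x = vol F x * (\<Sum>i\<in>UNIV. coframe F i x \<bullet> pd (pd F i) j x)"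
proof -
  let ?d = "det (metric F x)"
  have dG: "(\<lambda>x. metric F x $ i $ l) differentiable (at x)" for i l
    using C1_metric x C1_on_differentiable by blast
  have pG: "pd (\<lambda>x. metric F x $ i $ l) j x = pd F i x \<bullet> pd (pd F l) j x + pd (pd F i) j x \<bullet> pd F l x" for i l
    using pd_bilinear[OF bounded_bilinear_inner pd_differentiable[OF x] pd_differentiable[OF x], of i l j]
    by (simp add: metric_def)
  have 1: "(\<Sum>i\<in>UNIV. \<Sum>l\<in>UNIV. (pd (pd F i) j x \<bullet> pd F l x) * metric_inv F x $ l $ i)
    = (\<Sum>i\<in>UNIV. coframe F i x \<bullet> pd (pd F i) j x)"
    by (simp add: coframe_eq inner_sum_left inner_commute[of _ "pd F _ x"] mult.commute)
  have 2: "(\<Sum>i\<in>UNIV. \<Sum>l\<in>UNIV. (pd F i x \<bullet> pd (pd F l) j x) * metric_inv F x $ l $ i)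
    = (\<Sum>i\<in>UNIV. coframe F i x \<bullet> pd (pd F i) j x)"
    by (subst sum.swap)
      (simp add: coframe_eq inner_sum_left mult.commute metric_inv_sym[OF x, of _ i for i])
  have "pd (\<lambda>x. det (metric F x)) j x = ?d * (2 * (\<Sum>i\<in>UNIV. coframe F i x \<bullet> pd (pd F i) j x))"
    by (subst pd_det[OF dG metric_inverse(2)[OF x]]) (simp add: pG distrib_right sum.distrib 1 2)
  moreover have "pd (vol F) j x = (inverse (sqrt ?d) / 2) * pd (\<lambda>x. det (metric F x)) j x"
    unfolding vol_def[abs_def]
    using C1_on_det[of U "metric F", OF C1_metric] x
    by (intro pd_real_compose(2)[where h = sqrt] DERIV_real_sqrt det_metric_pos) (auto simp: C1_on_def)
  moreover have "inverse (sqrt ?d) * ?d = sqrt ?d"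
    using det_metric_pos[OF x] real_div_sqrt[of ?d] by (simp add: divide_inverse mult.commute)
  ultimately show ?thesis
    by (simp add: vol_def mult.assoc[symmetric])
qed

text \<open>The divergence of the coframe has no tangential part because the second derivatives of
  \<open>F\<close> are symmetric; its normal part is the trace of the second fundamental form.\<close>

lemma divergence_coframe:
  assumes x: "x \<in> U"
  shows "(\<Sum>i\<in>UNIV. pd (\<lambda>x. vol F x *\<^sub>R coframe F i x) i x) = vol F x *\<^sub>R mean_curvature F x"
    (is "?Z = _")
proof -
  have dvol: "vol F differentiable (at x)" and dco: "coframe F i differentiable (at x)" for i
    using C1_vol C1_coframe x C1_on_differentiable by blast+
  have pdW: "pd (\<lambda>x. vol F x *\<^sub>R coframe F i x) i x
      = vol F x *\<^sub>R pd (coframe F i) i x + pd (vol F) i x *\<^sub>R coframe F i x" for i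
    by (rule pd_bilinear[OF bounded_bilinear_scaleR dvol dco])
  \<comment> \<open>The products of coframe and frame are constant, so their derivatives vanish;
    this trades derivatives of the coframe for second derivatives of \<open>F\<close>.\<close>
  have co_pd: "pd (coframe F i) k x \<bullet> pd F j x = - (coframe F i x \<bullet> pd (pd F j) k x)" for i j k
  proof -
    have "pd (\<lambda>y. coframe F i y \<bullet> pd F j y) k x = pd (\<lambda>y. if i = j then 1 else 0 :: real) k x"
      by (rule pd_cong[OF U_open x coframe_inner])
    then have "pd (\<lambda>y. coframe F i y \<bullet> pd F j y) k x = 0"
      using pd_eqI[of "\<lambda>_. if i = j then 1 else 0 :: real" "\<lambda>_. 0" x k] by (metis has_derivative_const)
    then show ?thesis
      using pd_bilinear[OF bounded_bilinear_inner dco pd_differentiable[OF x], of i j k] by simp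
  qed
  have tang: "?Z \<bullet> pd F j x = 0" for j
  proof -
    have "?Z \<bullet> pd F j x = (\<Sum>i\<in>UNIV. - vol F x * (coframe F i x \<bullet> pd (pd F j) i x)
        + (if i = j then pd (vol F) i x else 0))"
      by (simp add: inner_sum_left pdW inner_add_left co_pd coframe_inner[OF x] if_distrib cong: if_cong)
    also have "\<dots> = pd (vol F) j x - vol F x * (\<Sum>i\<in>UNIV. coframe F i x \<bullet> pd (pd F j) i x)"
      by (simp add: sum_subtractf sum_distrib_left)
    also have "\<dots> = 0"
      using pd_commute[OF U_open x C1_F C1_pd, of j] by (simp add: pd_vol[OF x])
    finally show ?thesis .
  qed
  \<comment> \<open>Derivatives of the inverse metric multiply tangent vectors, so the normal part
    removes them and they never have to be computed.\<close>
  have N_co: "normal_part F x (pd (coframe F i) i x) = (\<Sum>k\<in>UNIV. metric_inv F x $ k $ i *\<^sub>R second_ff F x i k)" for i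
  proof -
    have dB: "(\<lambda>x. metric_inv F x $ k $ i) differentiable (at x)" for k
      using C1_metric_inv x C1_on_differentiable by blast
    have "pd (coframe F i) i x = (\<Sum>k\<in>UNIV. pd (\<lambda>x. metric_inv F x $ k $ i *\<^sub>R pd F k x) i x)"
      unfolding coframe_eq[abs_def]
      by (intro pd_sum differentiable_scaleR dB pd_differentiable[OF x])
    also have "\<dots> = (\<Sum>k\<in>UNIV. metric_inv F x $ k $ i *\<^sub>R pd (pd F k) i x
        + pd (\<lambda>x. metric_inv F x $ k $ i) i x *\<^sub>R pd F k x)"
      by (intro sum.cong refl pd_bilinear[OF bounded_bilinear_scaleR] dB pd_differentiable[OF x])
    finally show ?thesis
      by (simp add: linear_sum[OF normal_part_linear] linear_add[OF normal_part_linear]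
          linear_cmul[OF normal_part_linear] normal_part_tangent[OF x] second_ff_def)
  qed
  have "?Z = normal_part F x ?Z"
    by (simp add: normal_part_coframe tang)
  also have "\<dots> = (\<Sum>i\<in>UNIV. vol F x *\<^sub>R (\<Sum>k\<in>UNIV. metric_inv F x $ k $ i *\<^sub>R second_ff F x i k))"
    by (simp add: linear_sum[OF normal_part_linear] pdW linear_add[OF normal_part_linear]
          linear_cmul[OF normal_part_linear] normal_part_coframe_eq_0[OF x] N_co)
  also have "\<dots> = vol F x *\<^sub>R mean_curvature F x"
    unfolding mean_curvature_def scaleR_sum_right
    by (intro sum.cong refl) (simp add: metric_inv_sym[OF x])
  finally show ?thesis .
qed

text \<open>The integrand is the sum over \<open>i\<close> of the partial derivatives of
  \<open>vol F x * f x * (coframe F i x \<bullet> X x)\<close> with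
  \<open>X x = P (F x) - z\<close>. The product rule produces the two displayed terms and a third
  one, which by \<open>divergence_coframe\<close> contains the mean curvature and so
  vanishes.\<close>

lemma first_variation_chart:
  fixes P :: "'e \<Rightarrow> 'e"
  assumes min: "\<And>x. x \<in> U \<Longrightarrow> mean_curvature F x = 0"
    and P: "bounded_linear P"
    and f: "C1_on U f" and K: "compact K" "K \<subseteq> U" "\<And>x. x \<in> U - K \<Longrightarrow> f x = 0"
  shows "(LINT x:U|lborel. vol F x * (f x * (\<Sum>i\<in>UNIV. coframe F i x \<bullet> P (pd F i x))
      + (\<Sum>i\<in>UNIV. pd f i x *\<^sub>R coframe F i x) \<bullet> (P (F x) - z))) = 0"
proof -
  define X where "X = (\<lambda>x. P (F x) - z)"
  have C1X: "C1_on U X"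
    unfolding X_def by (intro C1_on_diff C1_on_const C1_on_linear[OF P C1_F])
  have pdX: "pd X i x = P (pd F i x)" if x: "x \<in> U" for i x
  proof -
    have "((\<lambda>x. P (F x) - z) has_derivative (\<lambda>h. P (\<Sum>i\<in>UNIV. h $ i *\<^sub>R pd F i x) - 0)) (at x)"
      by (intro has_derivative_diff has_derivative_const bounded_linear.has_derivative[OF P]
          has_derivative_pd C1_on_differentiable[OF C1_F x])
    from pd_eqI[OF this] show ?thesis
      by (simp add: X_def)
  qed
  define W where "W i x = vol F x *\<^sub>R coframe F i x" for i x
  have C1W: "C1_on U (W i)" for i
    unfolding W_def by (intro C1_on_scaleR C1_vol C1_coframe)
  \<comment> \<open>Extension by zero. It is C1 on the whole space because it is C1 on the open sets
    \<open>U\<close> and \<open>- K\<close>, which cover everything.\<close>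
  define Y where "Y i x = (if x \<in> U then f x * (W i x \<bullet> X x) else 0)" for i x
  have Y0: "Y i x = 0" if "x \<notin> K" for i x
    using K(3) that by (simp add: Y_def)
  have "C1_on U (Y i)" for i
    by (rule C1_on_cong[OF U_open, THEN iffD2, OF _ C1_on_mult[OF f C1_on_inner[OF C1W[of i] C1X]]])
      (simp add: Y_def)
  have "C1_on (- K) (Y i)" for i
    using C1_on_cong[of "- K" "Y i" "\<lambda>_. 0"] compact_imp_closed[OF K(1)] Y0 by (simp add: open_Compl)
  have C1Y: "C1_on UNIV (Y i)" for i
  proof -
    have "U \<union> - K = UNIV"
      using K(2) by auto
    then show ?thesis
      using C1_on_Un[OF U_open _ \<open>C1_on U (Y i)\<close> \<open>C1_on (- K) (Y i)\<close>] compact_imp_closed[OF K(1)]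
      by (simp add: open_Compl)
  qed
  note int = integral_pd_eq_0[OF C1Y K(1) Y0]
  have "(\<Sum>i\<in>UNIV. pd (Y i) i x) = indicator U x *\<^sub>R (vol F x * (f x * (\<Sum>i\<in>UNIV. coframe F i x \<bullet> P (pd F i x))
      + (\<Sum>i\<in>UNIV. pd f i x *\<^sub>R coframe F i x) \<bullet> X x))" for x
  proof (cases "x \<in> U")
    case x: True
    have "pd (Y i) i x = f x * (W i x \<bullet> P (pd F i x) + pd (W i) i x \<bullet> X x) + pd f i x * (W i x \<bullet> X x)" for i
    proof -
      have d: "f differentiable (at x)" "W i differentiable (at x)" "X differentiable (at x)"
        using f C1W C1X x C1_on_differentiable by blast+
      have "pd (Y i) i x = pd (\<lambda>x. f x * (W i x \<bullet> X x)) i x"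
        by (rule pd_cong[OF U_open x]) (simp add: Y_def)
      also have "\<dots> = f x * pd (\<lambda>x. W i x \<bullet> X x) i x + pd f i x * (W i x \<bullet> X x)"
        by (rule pd_bilinear[OF bounded_bilinear_mult d(1)])
          (use C1_on_inner[OF C1W C1X] x C1_on_differentiable in blast)
      also have "pd (\<lambda>x. W i x \<bullet> X x) i x = W i x \<bullet> P (pd F i x) + pd (W i) i x \<bullet> X x"
        using pd_bilinear[OF bounded_bilinear_inner d(2,3)] by (simp add: pdX[OF x])
      finally show ?thesis .
    qed
    moreover have "(\<Sum>i\<in>UNIV. pd (W i) i x \<bullet> X x) = 0"
      using divergence_coframe[OF x] min[OF x] unfolding W_def by (simp flip: inner_sum_left)
    ultimately show ?thesis
      using x by (simp add: W_def sum.distrib inner_sum_left sum_distrib_left[symmetric] distrib_left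
          mult.left_commute[of _ "vol F x"])
  next
    case False
    then have "x \<in> - K"
      using K by auto
    then have "pd (Y i) i x = 0" for i
      by (intro pd_eq_0[of "- K"]) (use Y0 open_Compl[OF compact_imp_closed[OF K(1)]] in auto)
    then show ?thesis
      using False by simp
  qed
  moreover have "integral\<^sup>L lborel (\<lambda>x. \<Sum>i\<in>UNIV. pd (Y i) i x) = 0"
    using int by (subst Bochner_Integration.integral_sum) auto
  ultimately show ?thesis
    by (simp add: set_lebesgue_integral_def X_def)
qed

end

section \<open>The Riemannian measure\<close>

abbreviation crng :: "('a, 'm::finite) chart \<Rightarrow> (real^'m) set" where
  "crng c \<equiv> snd c ` fst c"

lemma is_chartD:
  assumes "is_chart c"
  shows "open (fst c)" "open (crng c)" "continuous_on (fst c) (snd c)" "continuous_on (crng c) (chart_inv c)"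
    and "\<And>q. q \<in> fst c \<Longrightarrow> chart_inv c (snd c q) = q"
    and "\<And>x. x \<in> crng c \<Longrightarrow> chart_inv c x \<in> fst c" "\<And>x. x \<in> crng c \<Longrightarrow> snd c (chart_inv c x) = x"
    and "inj_on (snd c) (fst c)"
proof -
  have h: "homeomorphism (fst c) (crng c) (snd c) (chart_inv c)"
    using assms by (simp add: is_chart_def)
  then show inv: "\<And>q. q \<in> fst c \<Longrightarrow> chart_inv c (snd c q) = q"
    by (auto simp: homeomorphism_def)
  then show "inj_on (snd c) (fst c)"
    by (rule inj_on_inverseI)
  show "open (fst c)" "open (crng c)" "continuous_on (fst c) (snd c)" "continuous_on (crng c) (chart_inv c)"
    "\<And>x. x \<in> crng c \<Longrightarrow> chart_inv c x \<in> fst c" "\<And>x. x \<in> crng c \<Longrightarrow> snd c (chart_inv c x) = x"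
    using assms h by (auto simp: is_chart_def homeomorphism_def)
qed

lemma chart_image_eq:
  assumes "is_chart c" "B \<subseteq> fst c"
  shows "snd c ` B = {x \<in> crng c. chart_inv c x \<in> B}"
  using assms is_chartD(5)[OF assms(1)] is_chartD(7)[OF assms(1)] by (force simp: image_iff)

lemma open_chart_image:
  assumes "is_chart c" "open B" "B \<subseteq> fst c"
  shows "open (snd c ` B)"
  unfolding chart_image_eq[OF assms(1,3)]
  using continuous_on_open_vimage[OF is_chartD(2)[OF assms(1)], of "chart_inv c"] is_chartD(4)[OF assms(1)] assms(2)
  by (auto simp: vimage_def Int_def conj_commute)

lemma chart_inv_measurable:
  assumes "is_chart c"
  shows "chart_inv c \<in> borel_measurable (restrict_space borel (crng c))"
  by (rule borel_measurable_continuous_on_restrict[OF is_chartD(4)[OF assms]])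

lemma chart_image_borel:
  assumes c: "is_chart c" and B: "B \<in> sets borel" "B \<subseteq> fst c"
  shows "snd c ` B \<in> sets borel"
proof -
  have "chart_inv c -` B \<inter> crng c \<in> sets (restrict_space borel (crng c))"
    using measurable_sets[OF chart_inv_measurable[OF c] B(1)] by (simp add: space_restrict_space)
  then have "chart_inv c -` B \<inter> crng c \<in> sets borel"
    using is_chartD(2)[OF c] by (subst (asm) sets_restrict_space_iff) auto
  then show ?thesis
    unfolding chart_image_eq[OF c B(2)] by (simp add: vimage_def Int_def conj_commute)
qed

text \<open>A weighted Lebesgue measure on the coordinate range, carried to the manifold. With
  \<open>w\<close> the volume density it is the Riemannian measure restricted to the domain of the
  chart.\<close>

definition chart_measure :: "('a::topological_space, 'm::finite) chart \<Rightarrow> (real^'m \<Rightarrow> real) \<Rightarrow> 'a measure" where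
  "chart_measure c w = distr (density (restrict_space lborel (crng c)) (\<lambda>x. ennreal (w x))) borel (chart_inv c)"

lemma sets_chart_measure [simp]: "sets (chart_measure c w) = sets borel"
  by (simp add: chart_measure_def)

context
  fixes c :: "('a::topological_space, 'm::finite) chart" and w :: "real^'m \<Rightarrow> real"
  assumes c: "is_chart c" and w: "continuous_on (crng c) w" "\<And>x. x \<in> crng c \<Longrightarrow> 0 \<le> w x"
begin

lemma chart_density_measurable: "w \<in> borel_measurable (restrict_space lborel (crng c))"
proof -
  have "sets (restrict_space lborel (crng c)) = sets (restrict_space borel (crng c))"
    by (rule sets_restrict_space_cong) simp
  from measurable_cong_sets[OF this refl] show ?thesis
    using borel_measurable_continuous_on_restrict[OF w(1)] by blast
qed

lemma chart_inv_measurable_lborel: "chart_inv c \<in> borel_measurable (restrict_space lborel (crng c))"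
proof -
  have "sets (restrict_space lborel (crng c)) = sets (restrict_space borel (crng c))"
    by (rule sets_restrict_space_cong) simp
  from measurable_cong_sets[OF this refl] show ?thesis
    using chart_inv_measurable[OF c] by blast
qed

lemma crng_lborel: "crng c \<inter> space lborel \<in> sets lborel"
  using is_chartD(2)[OF c] by simp

lemma emeasure_chart_measure:
  assumes B: "B \<in> sets borel"
  shows "emeasure (chart_measure c w) B = (\<integral>\<^sup>+x\<in>snd c ` (B \<inter> fst c). ennreal (w x) \<partial>lborel)"
proof -
  let ?R = "restrict_space lborel (crng c)"
  have sB: "chart_inv c -` B \<inter> space ?R \<in> sets ?R"
    using measurable_sets[OF chart_inv_measurable_lborel B] .
  have img: "snd c ` (B \<inter> fst c) = chart_inv c -` B \<inter> crng c"
    using chart_image_eq[OF c, of "B \<inter> fst c"] is_chartD(6)[OF c] by auto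
  have "emeasure (chart_measure c w) B = emeasure (density ?R (\<lambda>x. ennreal (w x))) (chart_inv c -` B \<inter> space ?R)"
    unfolding chart_measure_def
    by (subst emeasure_distr) (use chart_inv_measurable_lborel B in auto)
  also have "\<dots> = (\<integral>\<^sup>+x. ennreal (w x) * indicator (chart_inv c -` B \<inter> space ?R) x \<partial>?R)"
    using chart_density_measurable sB by (intro emeasure_density) auto
  also have "\<dots> = (\<integral>\<^sup>+x. ennreal (w x) * indicator (chart_inv c -` B \<inter> space ?R) x * indicator (crng c) x \<partial>lborel)"
    by (rule nn_integral_restrict_space[OF crng_lborel])
  also have "\<dots> = (\<integral>\<^sup>+x\<in>snd c ` (B \<inter> fst c). ennreal (w x) \<partial>lborel)"
    unfolding img by (intro nn_integral_cong) (auto simp: indicator_def space_restrict_space)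
  finally show ?thesis .
qed

lemma integral_chart_measure:
  fixes f :: "'a \<Rightarrow> real"
  assumes f: "f \<in> borel_measurable borel"
  shows "integral\<^sup>L (chart_measure c w) f = (LINT x:crng c|lborel. w x * f (chart_inv c x))"
proof -
  let ?R = "restrict_space lborel (crng c)"
  have "integral\<^sup>L (chart_measure c w) f = integral\<^sup>L (density ?R (\<lambda>x. ennreal (w x))) (\<lambda>x. f (chart_inv c x))"
    unfolding chart_measure_def using chart_inv_measurable_lborel f by (intro integral_distr) auto
  also have "\<dots> = integral\<^sup>L ?R (\<lambda>x. w x *\<^sub>R f (chart_inv c x))"
    using chart_density_measurable measurable_compose[OF chart_inv_measurable_lborel f] w(2)
    by (intro integral_density) (auto intro!: AE_I2 simp: space_restrict_space)
  also have "\<dots> = (LINT x:crng c|lborel. w x * f (chart_inv c x))"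
    by (subst integral_restrict_space[OF crng_lborel]) (simp add: set_lebesgue_integral_def)
  finally show ?thesis .
qed

end

section \<open>Coordinate changes, the metric in overlapping charts and the global measure\<close>

definition patch :: "('a, 'm::finite) chart \<Rightarrow> ('a \<Rightarrow> 'e) \<Rightarrow> real^'m \<Rightarrow> 'e" where
  "patch c f = f \<circ> chart_inv c"

definition transition :: "('a, 'm::finite) chart \<Rightarrow> ('a, 'm) chart \<Rightarrow> real^'m \<Rightarrow> real^'m" where
  "transition c d = snd d \<circ> chart_inv c"

text \<open>\<open>jac c d q\<close> has the entries \<open>\<partial>y\<^sub>a/\<partial>x\<^sub>i\<close> (row \<open>i\<close>, column \<open>a\<close>) of the coordinate change
  from \<open>x\<close> in \<open>c\<close> to \<open>y\<close> in \<open>d\<close>.\<close>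

definition jac :: "('a, 'm::finite) chart \<Rightarrow> ('a, 'm) chart \<Rightarrow> 'a \<Rightarrow> 'm \<Rightarrow> 'm \<Rightarrow> real" where
  "jac c d q i a = pd (transition c d) i (snd c q) $ a"

lemma snd_in_crng: "q \<in> fst c \<Longrightarrow> snd c q \<in> crng c"
  by blast

context
  fixes \<A> :: "('a::{t2_space,second_countable_topology}, 'm::finite) chart set"
  assumes atlas: "smooth_atlas \<A>"
begin

lemma atlas_chart: "c \<in> \<A> \<Longrightarrow> is_chart c"
  using atlas by (simp add: smooth_atlas_def)

lemmas chartD = is_chartD[OF atlas_chart]

lemma atlas_cover: "\<exists>c\<in>\<A>. q \<in> fst c"
  using atlas by (auto simp: smooth_atlas_def)

lemma chart_at: "chart_at \<A> q \<in> \<A>" "q \<in> fst (chart_at \<A> q)"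
proof -
  have "\<exists>c. c \<in> \<A> \<and> q \<in> fst c"
    using atlas_cover[of q] unfolding Bex_def .
  from someI_ex[OF this] show "chart_at \<A> q \<in> \<A>" "q \<in> fst (chart_at \<A> q)"
    by (auto simp: chart_at_def)
qed

lemma open_overlap: "c \<in> \<A> \<Longrightarrow> d \<in> \<A> \<Longrightarrow> open (snd c ` (fst c \<inter> fst d))"
  by (intro open_chart_image atlas_chart open_Int is_chartD(1)) auto

lemma smooth_transition:
  assumes "c \<in> \<A>" "d \<in> \<A>"
  shows "smooth_on (snd c ` (fst c \<inter> fst d)) (transition c d)"
  using atlas assms by (auto simp: smooth_atlas_def transition_def)

lemma transition_chart:
  assumes "c \<in> \<A>" "d \<in> \<A>" "q \<in> fst c" "q \<in> fst d"
  shows "transition c d (snd c q) = snd d q"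
  using is_chartD(5)[OF atlas_chart] assms by (simp add: transition_def)

lemma patch_chart: "c \<in> \<A> \<Longrightarrow> q \<in> fst c \<Longrightarrow> patch c f (snd c q) = f q"
  using is_chartD(5)[OF atlas_chart] by (simp add: patch_def)

lemma patch_transition:
  assumes "c \<in> \<A>" "d \<in> \<A>" "x \<in> snd c ` (fst c \<inter> fst d)"
  shows "patch c f x = patch d f (transition c d x)"
  using assms by (auto simp: transition_chart patch_chart)

lemma pd_patch_transition:
  fixes f :: "'a \<Rightarrow> 'd::real_normed_vector"
  assumes c: "c \<in> \<A>" "q \<in> fst c" and d: "d \<in> \<A>" "q \<in> fst d"
    and f: "patch d f differentiable (at (snd d q))"
  shows "pd (patch c f) i (snd c q) = (\<Sum>a\<in>UNIV. jac c d q i a *\<^sub>R pd (patch d f) a (snd d q))"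
proof -
  let ?W = "snd c ` (fst c \<inter> fst d)"
  have q: "snd c q \<in> ?W"
    using c d by auto
  have "pd (patch c f) i (snd c q) = pd (\<lambda>x. patch d f (transition c d x)) i (snd c q)"
    using open_overlap[OF c(1) d(1)] q patch_transition[OF c(1) d(1)] by (intro pd_cong) auto
  also have "\<dots> = (\<Sum>a\<in>UNIV. jac c d q i a *\<^sub>R pd (patch d f) a (snd d q))"
    using pd_compose[of "transition c d" "snd c q" "patch d f" i] f
      C1_on_differentiable[OF smooth_on_imp_C1_on[OF smooth_transition[OF c(1) d(1)]] q]
      transition_chart[OF c(1) d(1) c(2) d(2)] by (simp add: jac_def)
  finally show ?thesis .
qed

text \<open>Second countability enters through the Lindelof property. Repetitions in the enumeration
  are harmless, as the domains are made disjoint later.\<close>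

lemma countable_atlas:
  obtains e :: "nat \<Rightarrow> ('a, 'm) chart" where "\<And>n. e n \<in> \<A>" "(\<Union>n. fst (e n)) = UNIV"
proof -
  obtain \<F> where F: "\<F> \<subseteq> fst ` \<A>" "countable \<F>" "\<Union>\<F> = \<Union>(fst ` \<A>)"
    using Lindelof[of "fst ` \<A>"] is_chartD(1)[OF atlas_chart] by (metis imageE)
  have U: "\<Union>(fst ` \<A>) = UNIV"
    using atlas_cover by auto
  then have "\<F> \<noteq> {}"
    using F(3) by auto
  have "\<forall>n. \<exists>c. c \<in> \<A> \<and> fst c = from_nat_into \<F> n"
    using from_nat_into[OF \<open>\<F> \<noteq> {}\<close>] F(1) by (metis imageE subsetD)
  then obtain e where e: "\<And>n. e n \<in> \<A>" "\<And>n. fst (e n) = from_nat_into \<F> n"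
    by metis
  have "(\<Union>n. fst (e n)) = \<Union>\<F>"
    using e(2) range_from_nat_into[OF \<open>\<F> \<noteq> {}\<close> F(2)] by auto
  then show thesis
    using F(3) U by (intro that[OF e(1)]) simp
qed

context
  fixes \<phi> :: "'a \<Rightarrow> 'e::euclidean_space"
  assumes imm: "immersion \<A> \<phi>"
begin

lemma regular_patch:
  assumes c: "c \<in> \<A>"
  shows "regular (crng c) (patch c \<phi>)"
proof -
  have s: "smooth_on (crng c) (patch c \<phi>)"
    using imm c by (auto simp: immersion_def smooth_map_def patch_def)
  have "frame (\<lambda>i. pd (patch c \<phi>) i x)" if x: "x \<in> crng c" for x
    unfolding frame_def
  proof safe
    fix v :: "real^'m"
    assume 0: "(\<Sum>i\<in>UNIV. v $ i *\<^sub>R pd (patch c \<phi>) i x) = 0"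
    let ?D = "frechet_derivative (patch c \<phi>) (at x)"
    have "?D = (\<lambda>h. \<Sum>i\<in>UNIV. h $ i *\<^sub>R pd (patch c \<phi>) i x)"
      by (rule frechet_derivative_at[symmetric])
        (use smooth_on_imp_C1_on[OF s] x C1_on_differentiable has_derivative_pd in blast)
    then have "?D v = ?D 0"
      using 0 by simp
    moreover have "inj ?D"
      using imm c x by (auto simp: immersion_def patch_def)
    ultimately show "v = 0"
      by (simp add: inj_eq)
  qed
  then show ?thesis
    unfolding regular_def using is_chartD(2)[OF atlas_chart[OF c]] s
    by (auto intro: smooth_on_imp_C1_on smooth_on_pd)
qed

lemma pd_param_transition:
  assumes "c \<in> \<A>" "q \<in> fst c" "d \<in> \<A>" "q \<in> fst d"
  shows "pd (patch c \<phi>) i (snd c q) = (\<Sum>a\<in>UNIV. jac c d q i a *\<^sub>R pd (patch d \<phi>) a (snd d q))"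
  by (intro pd_patch_transition assms C1_on_differentiable[OF C1_F[OF regular_patch]] snd_in_crng)

text \<open>The transformation law of a covariant 2-tensor, written as a matrix congruence so that
  determinants can be taken.\<close>

lemma metric_transition:
  assumes "c \<in> \<A>" "q \<in> fst c" "d \<in> \<A>" "q \<in> fst d"
  shows "metric (patch c \<phi>) (snd c q)
    = (\<chi> i a. jac c d q i a) ** metric (patch d \<phi>) (snd d q) ** transpose (\<chi> i a. jac c d q i a)"
proof -
  have "metric (patch c \<phi>) (snd c q) $ i $ j = (\<Sum>a\<in>UNIV. \<Sum>b\<in>UNIV. jac c d q i a * (jac c d q j b *
      (metric (patch d \<phi>) (snd d q) $ a $ b)))" for i j
    unfolding metric_def by (simp add: pd_param_transition[OF assms] inner_sum_left)
      (simp add: inner_sum_right sum_distrib_left)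
  also have "(\<Sum>a\<in>UNIV. \<Sum>b\<in>UNIV. jac c d q i a * (jac c d q j b * (metric (patch d \<phi>) (snd d q) $ a $ b)))
    = ((\<chi> i a. jac c d q i a) ** metric (patch d \<phi>) (snd d q) ** transpose (\<chi> i a. jac c d q i a)) $ i $ j" for i j
    by (subst sum.swap)
      (simp add: matrix_matrix_mult_def transpose_def sum_distrib_right sum_distrib_left mult_ac)
  finally show ?thesis
    by (simp add: vec_eq_iff)
qed

lemma vol_transition:
  assumes "c \<in> \<A>" "q \<in> fst c" "d \<in> \<A>" "q \<in> fst d"
  shows "vol (patch c \<phi>) (snd c q)
    = \<bar>det (matrix (frechet_derivative (transition c d) (at (snd c q))))\<bar> * vol (patch d \<phi>) (snd d q)"
proof -
  let ?J = "\<chi> i a. jac c d q i a"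
  have "matrix (frechet_derivative (transition c d) (at (snd c q))) = transpose ?J"
    by (simp add: matrix_def transpose_def jac_def pd_def)
  moreover have "vol (patch c \<phi>) (snd c q) = \<bar>det ?J\<bar> * vol (patch d \<phi>) (snd d q)"
  proof -
    have "det (metric (patch c \<phi>) (snd c q)) = (det ?J)\<^sup>2 * det (metric (patch d \<phi>) (snd d q))"
      unfolding metric_transition[OF assms] det_mul det_transpose by (simp add: power2_eq_square)
    then show ?thesis
      by (simp only: vol_def real_sqrt_mult real_sqrt_abs)
  qed
  ultimately show ?thesis by simp
qed

lemma vol_continuous: "c \<in> \<A> \<Longrightarrow> continuous_on (crng c) (vol (patch c \<phi>))"
  by (intro C1_on_continuous C1_vol regular_patch)

lemma vol_pos: "c \<in> \<A> \<Longrightarrow> x \<in> crng c \<Longrightarrow> vol (patch c \<phi>) x > 0"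
  using det_metric_pos[OF regular_patch] by (simp add: vol_def)

text \<open>The Jacobian factor of the change of variables is exactly the one by which the two
  densities differ. This agreement on overlaps is what makes a global measure possible.\<close>

lemma nn_integral_vol_transition:
  assumes c: "c \<in> \<A>" and d: "d \<in> \<A>" and B: "B \<in> sets borel" "B \<subseteq> fst c" "B \<subseteq> fst d"
  shows "(\<integral>\<^sup>+x\<in>snd d ` B. ennreal (vol (patch d \<phi>) x) \<partial>lborel)
    = (\<integral>\<^sup>+x\<in>snd c ` B. ennreal (vol (patch c \<phi>) x) \<partial>lborel)"
proof -
  let ?\<tau> = "transition c d"
  let ?\<tau>' = "\<lambda>x. frechet_derivative ?\<tau> (at x)"
  have img: "?\<tau> ` (snd c ` B) = snd d ` B"
    unfolding image_image by (intro image_cong refl transition_chart c d) (use B in auto)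
  have meas: "(\<lambda>x. indicator (snd e ` B) x * vol (patch e \<phi>) x) \<in> borel_measurable borel"
    if "e \<in> \<A>" "B \<subseteq> fst e" for e
  proof -
    have "continuous_on (snd e ` B) (vol (patch e \<phi>))"
      by (rule continuous_on_subset[OF vol_continuous]) (use that in auto)
    from borel_measurable_continuous_on_indicator[OF chart_image_borel[OF atlas_chart[OF that(1)] B(1) that(2)] this]
    show ?thesis
      by (simp only: real_scaleR_def)
  qed
  have eq: "indicator (snd c ` B) x * (\<bar>det (matrix (?\<tau>' x))\<bar> * vol (patch d \<phi>) (?\<tau> x))
      = indicator (snd c ` B) x * vol (patch c \<phi>) x" for x
  proof (cases "x \<in> snd c ` B")
    case True
    then obtain q where q: "q \<in> B" "x = snd c q" by auto
    then have "q \<in> fst c" "q \<in> fst d"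
      using B by auto
    then show ?thesis
      using vol_transition[OF c _ d] transition_chart[OF c d] q by simp
  qed simp
  have "(\<integral>\<^sup>+y. ennreal (indicator (?\<tau> ` (snd c ` B)) y * vol (patch d \<phi>) y) \<partial>lborel)
    = (\<integral>\<^sup>+x. ennreal (indicator (snd c ` B) x * (\<bar>det (matrix (?\<tau>' x))\<bar> * vol (patch d \<phi>) (?\<tau> x))) \<partial>lborel)"
  proof (rule nn_integral_change_of_variables)
    show "snd c ` B \<in> sets borel"
      by (rule chart_image_borel[OF atlas_chart[OF c] B(1,2)])
    show "(?\<tau> has_derivative ?\<tau>' x) (at x within snd c ` B)" if "x \<in> snd c ` B" for x
    proof -
      have "x \<in> snd c ` (fst c \<inter> fst d)"
        using that B by auto
      then show ?thesis
        using C1_on_differentiable[OF smooth_on_imp_C1_on[OF smooth_transition[OF c d]]]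
        by (simp add: frechet_derivative_works has_derivative_at_withinI)
    qed
    show "inj_on ?\<tau> (snd c ` B)"
    proof (rule inj_on_imageI)
      have "inj_on (snd d) B"
        using is_chartD(8)[OF atlas_chart[OF d]] B inj_on_subset by blast
      then show "inj_on (?\<tau> \<circ> snd c) B"
        using B transition_chart[OF c d] by (auto simp: inj_on_def subset_iff)
    qed
    show "0 \<le> vol (patch d \<phi>) (?\<tau> x)" if "x \<in> snd c ` B" for x
    proof -
      have "?\<tau> x \<in> snd d ` B"
        using that img by blast
      then show ?thesis
        using vol_pos[OF d, of "?\<tau> x"] B by auto
    qed
    show "(\<lambda>y. indicator (?\<tau> ` (snd c ` B)) y * vol (patch d \<phi>) y) \<in> borel_measurable borel"
      unfolding img by (rule meas[OF d B(3)])
    show "(\<lambda>x. indicator (snd c ` B) x * (\<bar>det (matrix (?\<tau>' x))\<bar> * vol (patch d \<phi>) (?\<tau> x))) \<in> borel_measurable borel"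
      unfolding eq by (rule meas[OF c B(2)])
  qed
  then show ?thesis
    unfolding img eq by (simp add: nn_integral_set_ennreal mult.commute)
qed

abbreviation is_riemannian_measure :: "'a measure \<Rightarrow> bool" where
  "is_riemannian_measure \<mu> \<equiv> sets \<mu> = sets borel
     \<and> (\<forall>c\<in>\<A>. \<forall>B\<in>sets borel. B \<subseteq> fst c \<longrightarrow>
          emeasure \<mu> B = (\<integral>\<^sup>+x\<in>snd c ` B. ennreal (vol (patch c \<phi>) x) \<partial>lborel))"

text \<open>A definite description says nothing before existence and uniqueness are known. Countably
  many disjoint Borel pieces, each inside one chart domain, give both: the chart measures on the
  pieces can be added up, and a measure is determined by its restrictions to the pieces.\<close>

lemma is_riemannian_measure_riemannian_measure:
  "is_riemannian_measure (riemannian_measure \<A> \<phi>)"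
proof -
  obtain e :: "nat \<Rightarrow> ('a, 'm) chart" where e: "\<And>n. e n \<in> \<A>" "(\<Union>n. fst (e n)) = UNIV"
    using countable_atlas by blast
  define D where "D = disjointed (\<lambda>n. fst (e n))"
  have D_sub: "D n \<subseteq> fst (e n)" for n
    unfolding D_def by (rule disjointed_subset)
  have D_disj: "disjoint_family D" and D_UN: "(\<Union>n. D n) = UNIV"
    using e(2) by (simp_all add: D_def disjoint_family_disjointed UN_disjointed_eq)
  have op: "fst c \<in> sets borel" if "c \<in> \<A>" for c
    using is_chartD(1)[OF atlas_chart[OF that]] by simp
  have D_sets [measurable]: "D n \<in> sets borel" for n
  proof -
    have "range (\<lambda>n. fst (e n)) \<subseteq> sets borel"
      using op[OF e(1)] by blast
    then show ?thesis
      using sets.range_disjointed_sets unfolding D_def by blast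
  qed
  define \<nu> where "\<nu> c = chart_measure c (vol (patch c \<phi>))" for c :: "('a, 'm) chart"
  have \<nu>: "emeasure (\<nu> c) B = (\<integral>\<^sup>+x\<in>snd c ` B. ennreal (vol (patch c \<phi>) x) \<partial>lborel)"
    if "c \<in> \<A>" "B \<in> sets borel" "B \<subseteq> fst c" for c B
    using emeasure_chart_measure[OF atlas_chart[OF that(1)] vol_continuous[OF that(1)] _ that(2)]
      vol_pos[OF that(1)] that(3) by (simp add: \<nu>_def less_imp_le Int_absorb2)
  have s\<nu> [simp]: "sets (\<nu> c) = sets borel" for c
    by (simp add: \<nu>_def)
  define m where "m B = (\<Sum>n. emeasure (\<nu> (e n)) (B \<inter> D n))" for B
  define \<mu> where "\<mu> = measure_of UNIV (sets borel) m"
  have sets_\<mu>: "sets \<mu> = sets borel"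
    unfolding \<mu>_def using sets.sigma_sets_eq[of borel] by simp
  have em_\<mu>: "emeasure \<mu> B = m B" if B: "B \<in> sets borel" for B
    unfolding \<mu>_def
  proof (rule emeasure_measure_of_sigma[OF _ _ _ B])
    show "sigma_algebra UNIV (sets (borel :: 'a measure))"
      using sets.sigma_algebra_axioms[of borel] by simp
    show "positive (sets borel) m"
      by (simp add: positive_def m_def)
    show "countably_additive (sets borel) m"
    proof (rule countably_additiveI)
      fix A :: "nat \<Rightarrow> 'a set"
      assume A: "range A \<subseteq> sets borel" "disjoint_family A"
      have "m (\<Union>i. A i) = (\<Sum>n. \<Sum>i. emeasure (\<nu> (e n)) (A i \<inter> D n))"
        unfolding m_def
      proof (rule suminf_cong)
        fix n
        have "(\<Sum>i. emeasure (\<nu> (e n)) (A i \<inter> D n)) = emeasure (\<nu> (e n)) (\<Union>i. A i \<inter> D n)"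
          by (rule suminf_emeasure) (use A in \<open>auto simp: disjoint_family_on_def\<close>)
        then show "emeasure (\<nu> (e n)) ((\<Union>i. A i) \<inter> D n) = (\<Sum>i. emeasure (\<nu> (e n)) (A i \<inter> D n))"
          by simp
      qed
      \<comment> \<open>The outer series is read as an integral over counting measure, so that
        monotone convergence exchanges the two sums.\<close>
      also have "\<dots> = (\<integral>\<^sup>+n. (\<Sum>i. emeasure (\<nu> (e n)) (A i \<inter> D n)) \<partial>count_space UNIV)"
        by (rule nn_integral_count_space_nat[symmetric])
      also have "\<dots> = (\<Sum>i. \<integral>\<^sup>+n. emeasure (\<nu> (e n)) (A i \<inter> D n) \<partial>count_space UNIV)"
        by (rule nn_integral_suminf) simp
      also have "\<dots> = (\<Sum>i. m (A i))"
        unfolding m_def by (rule suminf_cong, rule nn_integral_count_space_nat)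
      finally show "(\<Sum>i. m (A i)) = m (\<Union>i. A i)" ..
    qed
  qed
  have is_\<mu>: "is_riemannian_measure \<mu>"
  proof (intro conjI sets_\<mu> ballI impI)
    fix c and B :: "'a set" assume c: "c \<in> \<A>" and B: "B \<in> sets borel" "B \<subseteq> fst c"
    \<comment> \<open>On a piece that lies in both domains, the chart \<open>e n\<close> of the
      construction may be replaced by \<open>c\<close>.\<close>
    have eq: "emeasure (\<nu> (e n)) (B \<inter> D n) = emeasure (\<nu> c) (B \<inter> D n)" for n
    proof -
      have BD: "B \<inter> D n \<in> sets borel" "B \<inter> D n \<subseteq> fst (e n)" "B \<inter> D n \<subseteq> fst c"
        using B D_sub by auto
      show ?thesis
        using nn_integral_vol_transition[OF c e(1) BD(1,3,2)] \<nu>[OF c BD(1,3)] \<nu>[OF e(1) BD(1,2)] by simp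
    qed
    have "emeasure \<mu> B = (\<Sum>n. emeasure (\<nu> c) (B \<inter> D n))"
      by (simp add: em_\<mu>[OF B(1)] m_def eq)
    also have "\<dots> = emeasure (\<nu> c) (\<Union>n. B \<inter> D n)"
      by (rule suminf_emeasure) (use B D_disj in \<open>auto simp: disjoint_family_on_def\<close>)
    also have "(\<Union>n. B \<inter> D n) = B"
      using D_UN by auto
    finally show "emeasure \<mu> B = (\<integral>\<^sup>+x\<in>snd c ` B. ennreal (vol (patch c \<phi>) x) \<partial>lborel)"
      using \<nu>[OF c B] by simp
  qed
  have unique: "\<mu>' = \<mu>" if \<mu>': "is_riemannian_measure \<mu>'" for \<mu>'
  proof (rule measure_eqI)
    show "sets \<mu>' = sets \<mu>"
      using \<mu>' sets_\<mu> by simp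
    fix B assume "B \<in> sets \<mu>'"
    then have B: "B \<in> sets borel"
      using \<mu>' by simp
    have sum: "emeasure \<rho> B = (\<Sum>n. emeasure \<rho> (B \<inter> D n))" if "sets \<rho> = sets borel" for \<rho>
    proof -
      have "(\<Sum>n. emeasure \<rho> (B \<inter> D n)) = emeasure \<rho> (\<Union>n. B \<inter> D n)"
        by (rule suminf_emeasure) (use B D_disj that in \<open>auto simp: disjoint_family_on_def\<close>)
      also have "(\<Union>n. B \<inter> D n) = B"
        using D_UN by auto
      finally show ?thesis ..
    qed
    have "emeasure \<mu>' (B \<inter> D n) = emeasure \<mu> (B \<inter> D n)" for n
    proof -
      have "B \<inter> D n \<in> sets borel" "B \<inter> D n \<subseteq> fst (e n)"
        using B D_sub by auto
      then have "emeasure \<rho> (B \<inter> D n)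
          = (\<integral>\<^sup>+x\<in>snd (e n) ` (B \<inter> D n). ennreal (vol (patch (e n) \<phi>) x) \<partial>lborel)"
        if "is_riemannian_measure \<rho>" for \<rho>
        using that e(1) by blast
      from this[OF \<mu>'] this[OF is_\<mu>] show ?thesis
        by (rule trans[OF _ sym])
    qed
    then show "emeasure \<mu>' B = emeasure \<mu> B"
      using sum[of \<mu>'] sum[of \<mu>] \<mu>' sets_\<mu> by simp
  qed
  have "riemannian_measure \<A> \<phi> = (THE \<mu>. is_riemannian_measure \<mu>)"
    by (simp add: riemannian_measure_def vol_def patch_def)
  also have "is_riemannian_measure \<dots>"
    by (rule theI[of is_riemannian_measure \<mu>]) (use is_\<mu> unique in blast)+
  finally show ?thesis .
qed

end

end

section \<open>Independence of the chart\<close>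

text \<open>The gradient as an ambient tangent vector, so that values from different charts can be
  compared by plain equality and paired with an ambient field.\<close>

definition chart_grad ::
  "('a, 'm::finite) chart \<Rightarrow> ('a \<Rightarrow> 'e::euclidean_space) \<Rightarrow> ('a \<Rightarrow> real) \<Rightarrow> 'a \<Rightarrow> 'e" where
  "chart_grad c \<phi> f q = (\<Sum>i\<in>UNIV. pd (patch c f) i (snd c q) *\<^sub>R coframe (patch c \<phi>) i (snd c q))"

definition grad ::
  "('a, 'm::finite) chart set \<Rightarrow> ('a \<Rightarrow> 'e::euclidean_space) \<Rightarrow> ('a \<Rightarrow> real) \<Rightarrow> 'a \<Rightarrow> 'e" where
  "grad \<A> \<phi> f q = chart_grad (chart_at \<A> q) \<phi> f q"

text \<open>Trace over the tangent space of \<open>P\<close> followed by the tangential projection.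
  For a minimal immersion it is the divergence of the tangential part of
  \<open>P \<circ> \<phi>\<close>.\<close>

definition chart_trace ::
  "('a, 'm::finite) chart \<Rightarrow> ('a \<Rightarrow> 'e::euclidean_space) \<Rightarrow> ('e \<Rightarrow> 'e) \<Rightarrow> 'a \<Rightarrow> real" where
  "chart_trace c \<phi> P q = (\<Sum>i\<in>UNIV. coframe (patch c \<phi>) i (snd c q) \<bullet> P (pd (patch c \<phi>) i (snd c q)))"

definition tangent_trace ::
  "('a, 'm::finite) chart set \<Rightarrow> ('a \<Rightarrow> 'e::euclidean_space) \<Rightarrow> ('e \<Rightarrow> 'e) \<Rightarrow> 'a \<Rightarrow> real" where
  "tangent_trace \<A> \<phi> P q = chart_trace (chart_at \<A> q) \<phi> P q"

text \<open>The integrand of the first variation formula: the tangential divergence of \<open>f\<close> times the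
  ambient field \<open>v \<mapsto> P v - z\<close>, up to a term that the mean curvature annihilates.\<close>

definition variation ::
  "('a, 'm::finite) chart set \<Rightarrow> ('a \<Rightarrow> 'e::euclidean_space) \<Rightarrow> ('e \<Rightarrow> 'e) \<Rightarrow> 'e \<Rightarrow> ('a \<Rightarrow> real) \<Rightarrow> 'a \<Rightarrow> real" where
  "variation \<A> \<phi> P z f q = f q * tangent_trace \<A> \<phi> P q + grad \<A> \<phi> f q \<bullet> (P (\<phi> q) - z)"

definition C1_map :: "('a, 'm::finite) chart set \<Rightarrow> ('a \<Rightarrow> real) \<Rightarrow> bool" where
  "C1_map \<A> f \<longleftrightarrow> (\<forall>c\<in>\<A>. C1_on (crng c) (patch c f))"

lemma continuous_on_second_ff_norm_local:
  assumes reg: "regular U F"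
  shows "continuous_on U (second_ff_norm_local F)"
proof -
  note [continuous_intros] = C1_on_continuous[OF C1_metric_inv[OF reg]] C1_on_continuous[OF C1_pd[OF reg]]
    C1_on_pd[OF C1_pd[OF reg]]
  have "continuous_on U (\<lambda>x. second_ff F x i j)" for i j
    unfolding second_ff_def normal_part_def by (intro continuous_intros)
  then show ?thesis
    unfolding second_ff_norm_local_def[abs_def] by (intro continuous_intros)
qed

lemma second_ff_norm_local_eq:
  assumes reg: "regular U F" and x: "x \<in> U"
  shows "second_ff_norm_local F x = sqrt (\<Sum>b\<in>Basis. \<Sum>b'\<in>Basis.
    (norm (\<Sum>i\<in>UNIV. \<Sum>j\<in>UNIV. ((coframe F i x \<bullet> b) * (coframe F j x \<bullet> b')) *\<^sub>R second_ff F x i j))\<^sup>2)"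
  unfolding second_ff_norm_local_def sum_inner_expand2[symmetric] coframe_inner_coframe[OF reg x] ..

text \<open>The inverse metric is the Gram matrix of the coframe, so the contraction is the squared
  norm of the gradient vector.\<close>

lemma grad_norm_local_eq:
  assumes reg: "regular U F" and x: "x \<in> U"
  shows "grad_norm_local F w x = norm (\<Sum>i\<in>UNIV. pd w i x *\<^sub>R coframe F i x)"
proof -
  have "(norm (\<Sum>i\<in>UNIV. pd w i x *\<^sub>R coframe F i x))\<^sup>2
    = (\<Sum>i\<in>UNIV. \<Sum>j\<in>UNIV. (coframe F i x \<bullet> coframe F j x) * pd w i x * pd w j x)"
    unfolding power2_norm_eq_inner
    by (subst inner_sum_left) (simp add: inner_sum_right sum_distrib_left mult_ac)
  from this[symmetric] show ?thesis
    unfolding grad_norm_local_def coframe_inner_coframe[OF reg x, symmetric] by simp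
qed

lemma chart_grad_at:
  "is_chart c \<Longrightarrow> x \<in> crng c \<Longrightarrow>
    chart_grad c \<phi> f (chart_inv c x) = (\<Sum>i\<in>UNIV. pd (patch c f) i x *\<^sub>R coframe (patch c \<phi>) i x)"
  by (simp add: chart_grad_def is_chartD(7))

lemma chart_trace_at:
  "is_chart c \<Longrightarrow> x \<in> crng c \<Longrightarrow>
    chart_trace c \<phi> P (chart_inv c x) = (\<Sum>i\<in>UNIV. coframe (patch c \<phi>) i x \<bullet> P (pd (patch c \<phi>) i x))"
  by (simp add: chart_trace_def is_chartD(7))

lemma C1_map_differentiable: "C1_map \<A> f \<Longrightarrow> c \<in> \<A> \<Longrightarrow> q \<in> fst c \<Longrightarrow> patch c f differentiable (at (snd c q))"
  by (auto simp: C1_map_def C1_on_def)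

context
  fixes \<A> :: "('a::{t2_space,second_countable_topology}, 'm::finite) chart set"
  assumes atlas: "smooth_atlas \<A>"
begin

lemma continuous_patches:
  fixes g :: "'a \<Rightarrow> 'd::topological_space"
  assumes "\<And>c. c \<in> \<A> \<Longrightarrow> continuous_on (crng c) (patch c g)"
  shows "continuous_on UNIV g"
proof -
  have "continuous_on (\<Union>c\<in>\<A>. fst c) g"
  proof (rule continuous_on_open_UN)
    fix c assume c: "c \<in> \<A>"
    show "open (fst c)" by (rule chartD(1)[OF atlas c])
    have "continuous_on (fst c) (\<lambda>q. patch c g (snd c q))"
      by (rule continuous_on_compose2[OF assms[OF c] chartD(3)[OF atlas c]]) auto
    then show "continuous_on (fst c) g"
      by (rule continuous_on_eq) (rule patch_chart[OF atlas c])
  qed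
  then show ?thesis
    using atlas by (simp add: smooth_atlas_def)
qed

lemma C1_map_continuous: "C1_map \<A> f \<Longrightarrow> continuous_on UNIV f"
  by (rule continuous_patches, rule C1_on_continuous) (simp add: C1_map_def)

end

context
  fixes \<A> :: "('a::{t2_space,second_countable_topology}, 'm::finite) chart set"
    and \<phi> :: "'a \<Rightarrow> 'e::euclidean_space"
  assumes atlas: "smooth_atlas \<A>" and imm: "immersion \<A> \<phi>"
begin

text \<open>Frames and coframes transform with the same matrix in opposite directions; the
  independence statements below rest on this cancellation.\<close>

lemma coframe_transition:
  assumes "c \<in> \<A>" "q \<in> fst c" "d \<in> \<A>" "q \<in> fst d"
  shows "coframe (patch d \<phi>) a (snd d q) = (\<Sum>i\<in>UNIV. jac c d q i a *\<^sub>R coframe (patch c \<phi>) i (snd c q))"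
  unfolding coframe_def
  by (rule dual_frame_change[where S = "jac d c q"])
    (use assms in \<open>auto intro!: frame_pd[OF regular_patch[OF atlas imm]] pd_param_transition[OF atlas imm]\<close>)

lemma chart_grad_eq:
  assumes c: "c \<in> \<A>" "q \<in> fst c" and f: "C1_map \<A> f"
  shows "grad \<A> \<phi> f q = chart_grad c \<phi> f q"
proof -
  let ?d = "chart_at \<A> q"
  note d = chart_at[OF atlas, of q]
  have "chart_grad c \<phi> f q = (\<Sum>i\<in>UNIV. (\<Sum>a\<in>UNIV. jac c ?d q i a * pd (patch ?d f) a (snd ?d q)) *\<^sub>R coframe (patch c \<phi>) i (snd c q))"
    using pd_patch_transition[OF atlas c d C1_map_differentiable[OF f d]] by (simp add: chart_grad_def)
  also have "\<dots> = chart_grad ?d \<phi> f q"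
    unfolding chart_grad_def coframe_def
    by (rule sum_dual_frame_change[OF coframe_transition[OF c d, unfolded coframe_def]])
  finally show ?thesis
    by (simp add: grad_def)
qed

lemma grad_norm_eq: "grad_norm \<A> \<phi> f q = norm (grad \<A> \<phi> f q)"
  unfolding grad_norm_def Let_def grad_def chart_grad_def
  using grad_norm_local_eq[OF regular_patch[OF atlas imm] snd_in_crng] chart_at[OF atlas]
  by (simp add: patch_def)

lemma tangent_trace_eq:
  assumes c: "c \<in> \<A>" "q \<in> fst c" and P: "bounded_linear P"
  shows "tangent_trace \<A> \<phi> P q = chart_trace c \<phi> P q"
proof -
  let ?d = "chart_at \<A> q"
  note d = chart_at[OF atlas, of q]
  have lin: "linear P"
    using P by (simp add: bounded_linear.linear)
  have "chart_trace c \<phi> P q = (\<Sum>i\<in>UNIV. \<Sum>a\<in>UNIV. jac c ?d q i a * (coframe (patch c \<phi>) i (snd c q) \<bullet> P (pd (patch ?d \<phi>) a (snd ?d q))))"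
    by (simp add: chart_trace_def pd_param_transition[OF atlas imm c d] linear_sum[OF lin] linear_cmul[OF lin] inner_sum_right)
  also have "\<dots> = chart_trace ?d \<phi> P q"
    unfolding chart_trace_def coframe_transition[OF c d]
    by (subst sum.swap) (simp add: inner_sum_left)
  finally show ?thesis
    by (simp add: tangent_trace_def)
qed

lemma normal_part_transition:
  assumes "c \<in> \<A>" "q \<in> fst c" "d \<in> \<A>" "q \<in> fst d"
  shows "normal_part (patch c \<phi>) (snd c q) z = normal_part (patch d \<phi>) (snd d q) z"
proof -
  have "(\<Sum>l\<in>UNIV. (z \<bullet> pd (patch c \<phi>) l (snd c q)) *\<^sub>R coframe (patch c \<phi>) l (snd c q))
     = (\<Sum>l\<in>UNIV. (\<Sum>a\<in>UNIV. jac c d q l a * (z \<bullet> pd (patch d \<phi>) a (snd d q))) *\<^sub>R coframe (patch c \<phi>) l (snd c q))"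
    by (simp add: pd_param_transition[OF atlas imm assms] inner_sum_right)
  also have "\<dots> = (\<Sum>l\<in>UNIV. (z \<bullet> pd (patch d \<phi>) l (snd d q)) *\<^sub>R coframe (patch d \<phi>) l (snd d q))"
    unfolding coframe_def
    by (rule sum_dual_frame_change[OF coframe_transition[OF assms, unfolded coframe_def]])
  finally show ?thesis
    unfolding normal_part_coframe[OF regular_patch[OF atlas imm assms(1)]] normal_part_coframe[OF regular_patch[OF atlas imm assms(3)]] by (rule arg_cong)
qed

text \<open>Second derivatives of the coordinate change occur only as coefficients of tangent
  vectors, which the normal part removes. What remains is the law of a tensor.\<close>

lemma second_ff_transition:
  assumes c: "c \<in> \<A>" "q \<in> fst c" and d: "d \<in> \<A>" "q \<in> fst d"
  shows "second_ff (patch c \<phi>) (snd c q) i j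
    = (\<Sum>b\<in>UNIV. \<Sum>a\<in>UNIV. (jac c d q i a * jac c d q j b) *\<^sub>R second_ff (patch d \<phi>) (snd d q) a b)"
proof -
  let ?W = "snd c ` (fst c \<inter> fst d)" and ?\<tau> = "transition c d" and ?F = "patch c \<phi>" and ?G = "patch d \<phi>"
  let ?x = "snd c q" and ?y = "snd d q"
  let ?N = "normal_part ?G ?y"
  note lin = normal_part_linear[OF regular_patch[OF atlas imm d(1)]]
  note W = open_overlap[OF atlas c(1) d(1)]
  note sm = smooth_transition[OF atlas c(1) d(1)]
  have x: "?x \<in> ?W" and y: "?y \<in> crng d" and \<tau>x: "?\<tau> ?x = ?y"
    using c d transition_chart[OF atlas c(1) d(1) c(2) d(2)] by auto
  have d\<tau>: "?\<tau> differentiable (at ?x)"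
    by (rule C1_on_differentiable[OF smooth_on_imp_C1_on[OF sm] x])
  have dd\<tau>: "(\<lambda>x. pd ?\<tau> j x $ b) differentiable (at ?x)" for b
    using C1_on_differentiable[OF C1_on_linear[OF bounded_linear_vec_nth smooth_on_imp_C1_on[OF smooth_on_pd[OF sm]]] x] .
  have dG: "pd ?G b differentiable (at ?y)" for b
    by (rule pd_differentiable[OF regular_patch[OF atlas imm d(1)] y])
  have dG\<tau>: "(\<lambda>x. pd ?G b (?\<tau> x)) differentiable (at ?x)" for b
    using has_derivative_compose_pd[OF d\<tau>, of "pd ?G b"] dG \<tau>x by (auto simp: differentiable_def)
  have "pd (pd ?F j) i ?x = pd (\<lambda>x. \<Sum>b\<in>UNIV. pd ?\<tau> j x $ b *\<^sub>R pd ?G b (?\<tau> x)) i ?x"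
  proof (rule pd_cong[OF W x])
    fix x assume "x \<in> ?W"
    then obtain q' where "q' \<in> fst c" "q' \<in> fst d" "x = snd c q'" by auto
    then show "pd ?F j x = (\<Sum>b\<in>UNIV. pd ?\<tau> j x $ b *\<^sub>R pd ?G b (?\<tau> x))"
      using pd_param_transition[OF atlas imm c(1) _ d(1)] transition_chart[OF atlas c(1) d(1)]
      by (simp add: jac_def)
  qed
  also have "\<dots> = (\<Sum>b\<in>UNIV. pd (\<lambda>x. pd ?\<tau> j x $ b *\<^sub>R pd ?G b (?\<tau> x)) i ?x)"
    by (intro pd_sum differentiable_scaleR dd\<tau> dG\<tau>)
  also have "\<dots> = (\<Sum>b\<in>UNIV. pd ?\<tau> j ?x $ b *\<^sub>R pd (\<lambda>x. pd ?G b (?\<tau> x)) i ?x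
      + pd (\<lambda>x. pd ?\<tau> j x $ b) i ?x *\<^sub>R pd ?G b (?\<tau> ?x))"
    by (intro sum.cong refl pd_bilinear[OF bounded_bilinear_scaleR dd\<tau> dG\<tau>])
  also have "\<dots> = (\<Sum>b\<in>UNIV. jac c d q j b *\<^sub>R (\<Sum>a\<in>UNIV. jac c d q i a *\<^sub>R pd (pd ?G b) a ?y)
      + pd (\<lambda>x. pd ?\<tau> j x $ b) i ?x *\<^sub>R pd ?G b ?y)"
    using pd_compose[OF d\<tau>, of "pd ?G _" i] dG by (simp add: \<tau>x jac_def)
  finally have "?N (pd (pd ?F j) i ?x) = (\<Sum>b\<in>UNIV. jac c d q j b *\<^sub>R (\<Sum>a\<in>UNIV. jac c d q i a *\<^sub>R second_ff ?G ?y a b))"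
    by (simp add: second_ff_def linear_sum[OF lin] linear_add[OF lin] linear_cmul[OF lin]
        normal_part_tangent[OF regular_patch[OF atlas imm d(1)] y])
  then show ?thesis
    unfolding second_ff_def[of ?F] normal_part_transition[OF c d]
    by (simp add: scaleR_sum_right mult.commute)
qed

text \<open>In the sum-of-squares form it suffices to compare ambient components: the Jacobian
  factors coming from the second fundamental form are absorbed by the coframe. This frees
  \<open>second_ff_norm\<close> from the chart picked by \<open>SOME\<close>.\<close>

lemma second_ff_norm_eq:
  assumes c: "c \<in> \<A>" "q \<in> fst c"
  shows "second_ff_norm \<A> \<phi> q = second_ff_norm_local (patch c \<phi>) (snd c q)"
proof -
  let ?d = "chart_at \<A> q"
  note d = chart_at[OF atlas, of q]
  define J where "J = jac c ?d q"
  define e where "e i = coframe (patch c \<phi>) i (snd c q)" for i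
  define e' where "e' i = coframe (patch ?d \<phi>) i (snd ?d q)" for i
  define A where "A i j = second_ff (patch c \<phi>) (snd c q) i j" for i j
  define A' where "A' i j = second_ff (patch ?d \<phi>) (snd ?d q) i j" for i j
  have e': "e' a \<bullet> v = (\<Sum>i\<in>UNIV. J i a * (e i \<bullet> v))" for a v
    using coframe_transition[OF c d] by (simp add: e'_def e_def J_def inner_sum_left)
  have A: "A i j = (\<Sum>a\<in>UNIV. \<Sum>b\<in>UNIV. (J i a * J j b) *\<^sub>R A' a b)" for i j
    using second_ff_transition[OF c d] by (subst sum.swap) (simp add: A_def A'_def J_def)
  have eq: "(\<Sum>i\<in>UNIV. \<Sum>j\<in>UNIV. ((e i \<bullet> v) * (e j \<bullet> w)) *\<^sub>R A i j)
    = (\<Sum>a\<in>UNIV. \<Sum>b\<in>UNIV. ((e' a \<bullet> v) * (e' b \<bullet> w)) *\<^sub>R A' a b)" for v w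
  proof -
    have "(\<Sum>i\<in>UNIV. \<Sum>j\<in>UNIV. ((e i \<bullet> v) * (e j \<bullet> w)) *\<^sub>R A i j)
      = (\<Sum>i\<in>UNIV. \<Sum>j\<in>UNIV. \<Sum>a\<in>UNIV. \<Sum>b\<in>UNIV. ((e i \<bullet> v) * (e j \<bullet> w) * (J i a * J j b)) *\<^sub>R A' a b)"
      by (simp add: A scaleR_sum_right)
    also have "\<dots> = (\<Sum>i\<in>UNIV. \<Sum>a\<in>UNIV. \<Sum>j\<in>UNIV. \<Sum>b\<in>UNIV. ((e i \<bullet> v) * (e j \<bullet> w) * (J i a * J j b)) *\<^sub>R A' a b)"
      by (rule sum.cong[OF refl], rule sum.swap)
    also have "\<dots> = (\<Sum>a\<in>UNIV. \<Sum>i\<in>UNIV. \<Sum>j\<in>UNIV. \<Sum>b\<in>UNIV. ((e i \<bullet> v) * (e j \<bullet> w) * (J i a * J j b)) *\<^sub>R A' a b)"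
      by (rule sum.swap)
    also have "\<dots> = (\<Sum>a\<in>UNIV. \<Sum>i\<in>UNIV. \<Sum>b\<in>UNIV. \<Sum>j\<in>UNIV. ((e i \<bullet> v) * (e j \<bullet> w) * (J i a * J j b)) *\<^sub>R A' a b)"
      by (rule sum.cong[OF refl], rule sum.cong[OF refl], rule sum.swap)
    also have "\<dots> = (\<Sum>a\<in>UNIV. \<Sum>b\<in>UNIV. \<Sum>i\<in>UNIV. \<Sum>j\<in>UNIV. ((e i \<bullet> v) * (e j \<bullet> w) * (J i a * J j b)) *\<^sub>R A' a b)"
      by (rule sum.cong[OF refl], rule sum.swap)
    also have "\<dots> = (\<Sum>a\<in>UNIV. \<Sum>b\<in>UNIV. ((e' a \<bullet> v) * (e' b \<bullet> w)) *\<^sub>R A' a b)"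
      unfolding e' sum_product scaleR_sum_left by (simp add: mult_ac)
    finally show ?thesis .
  qed
  have "second_ff_norm \<A> \<phi> q = second_ff_norm_local (patch ?d \<phi>) (snd ?d q)"
    by (simp add: second_ff_norm_def patch_def Let_def)
  also have "\<dots> = second_ff_norm_local (patch c \<phi>) (snd c q)"
    unfolding second_ff_norm_local_eq[OF regular_patch[OF atlas imm c(1)] snd_in_crng[OF c(2)]]
      second_ff_norm_local_eq[OF regular_patch[OF atlas imm d(1)] snd_in_crng[OF d(2)]]
    unfolding e_def[symmetric] e'_def[symmetric] A_def[symmetric] A'_def[symmetric] eq ..
  finally show ?thesis .
qed

lemma second_ff_norm_nonneg: "second_ff_norm \<A> \<phi> q \<ge> 0"
proof -
  note d = chart_at[OF atlas, of q]
  show ?thesis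
    unfolding second_ff_norm_eq[OF d] second_ff_norm_local_eq[OF regular_patch[OF atlas imm d(1)] snd_in_crng[OF d(2)]]
    by (intro real_sqrt_ge_zero sum_nonneg) simp
qed

lemma continuous_param: "continuous_on UNIV \<phi>"
  by (intro continuous_patches[OF atlas] C1_on_continuous[OF C1_F[OF regular_patch[OF atlas imm]]])

text \<open>The chart picked by \<open>chart_at\<close> may jump from point to point, so continuity
  is checked in one fixed chart, which may replace the chosen one. It provides the measurability of
  the potential.\<close>

lemma continuous_second_ff_norm: "continuous_on UNIV (second_ff_norm \<A> \<phi>)"
proof (rule continuous_patches[OF atlas])
  fix c assume c: "c \<in> \<A>"
  show "continuous_on (crng c) (patch c (second_ff_norm \<A> \<phi>))"
  proof (rule continuous_on_eq[OF continuous_on_second_ff_norm_local[OF regular_patch[OF atlas imm c]]])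
    fix x assume x: "x \<in> crng c"
    show "second_ff_norm_local (patch c \<phi>) x = patch c (second_ff_norm \<A> \<phi>) x"
      using second_ff_norm_eq[OF c chartD(6)[OF atlas c x]] chartD(7)[OF atlas c x] by (simp add: patch_def)
  qed
qed

text \<open>Brings the intrinsic integrand into the form whose integral
  \<open>first_variation_chart\<close> computes.\<close>

lemma variation_patch:
  assumes c: "c \<in> \<A>" and P: "bounded_linear P" and f: "C1_map \<A> f" and x: "x \<in> crng c"
  shows "patch c (variation \<A> \<phi> P z f) x
    = patch c f x * (\<Sum>i\<in>UNIV. coframe (patch c \<phi>) i x \<bullet> P (pd (patch c \<phi>) i x))
      + (\<Sum>i\<in>UNIV. pd (patch c f) i x *\<^sub>R coframe (patch c \<phi>) i x) \<bullet> (P (patch c \<phi> x) - z)"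
proof -
  note q = chartD(6)[OF atlas c x] and ch = atlas_chart[OF atlas c]
  have p: "patch c (variation \<A> \<phi> P z f) x = variation \<A> \<phi> P z f (chart_inv c x)"
    "f (chart_inv c x) = patch c f x" "\<phi> (chart_inv c x) = patch c \<phi> x"
    by (simp_all add: patch_def)
  show ?thesis
    by (simp only: p variation_def chart_grad_eq[OF c q f] tangent_trace_eq[OF c q P]
        chart_grad_at[OF ch x] chart_trace_at[OF ch x])
qed

lemma continuous_variation:
  assumes P: "bounded_linear P" and f: "C1_map \<A> f"
  shows "continuous_on UNIV (variation \<A> \<phi> P z f)"
proof (rule continuous_patches[OF atlas])
  fix c assume c: "c \<in> \<A>"
  note [continuous_intros] = C1_on_continuous[OF C1_coframe[OF regular_patch[OF atlas imm c]]] C1_on_continuous[OF C1_pd[OF regular_patch[OF atlas imm c]]]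
    bounded_linear.continuous_on[OF P] C1_on_continuous[OF C1_F[OF regular_patch[OF atlas imm c]]]
  have fc: "C1_on (crng c) (patch c f)"
    using f c by (simp add: C1_map_def)
  note [continuous_intros] = C1_on_continuous[OF fc] C1_on_pd[OF fc]
  have "continuous_on (crng c) (\<lambda>x. patch c f x * (\<Sum>i\<in>UNIV. coframe (patch c \<phi>) i x \<bullet> P (pd (patch c \<phi>) i x))
      + (\<Sum>i\<in>UNIV. pd (patch c f) i x *\<^sub>R coframe (patch c \<phi>) i x) \<bullet> (P (patch c \<phi> x) - z))"
    by (intro continuous_intros)
  then show "continuous_on (crng c) (patch c (variation \<A> \<phi> P z f))"
    by (rule continuous_on_eq) (simp add: variation_patch[OF c P f])
qed

end

section \<open>The first variation formula\<close>

lemma DERIV_abs_powr: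
  fixes p :: real
  assumes p: "p > 1"
  shows "((\<lambda>t. \<bar>t\<bar> powr p) has_real_derivative p * \<bar>t\<bar> powr (p - 1) * sgn t) (at t)"
proof (cases t "0 :: real" rule: linorder_cases)
  case greater
  have "((\<lambda>t. t powr p) has_real_derivative p * t powr (p - 1)) (at t)"
    using greater by (rule has_real_derivative_powr)
  then have "((\<lambda>t. \<bar>t\<bar> powr p) has_real_derivative p * t powr (p - 1)) (at t)"
    by (rule has_field_derivative_transform_within_open[where S = "{0<..}"]) (use greater in auto)
  then show ?thesis
    using greater by simp
next
  case less
  have "((\<lambda>t. t powr p) has_real_derivative p * (- t) powr (p - 1)) (at (- t))"
    using less by (intro has_real_derivative_powr) simp
  then have "((\<lambda>t. (- t) powr p) has_real_derivative p * (- t) powr (p - 1) * - 1) (at t)"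
    by (rule DERIV_chain2) (auto intro!: derivative_eq_intros)
  then have "((\<lambda>t. \<bar>t\<bar> powr p) has_real_derivative p * (- t) powr (p - 1) * - 1) (at t)"
    by (rule has_field_derivative_transform_within_open[where S = "{..<0}"]) (use less in auto)
  then show ?thesis
    using less by simp
next
  case equal
  \<comment> \<open>At the origin the difference quotient has absolute value
    \<open>\<bar>h\<bar> powr (p - 1)\<close>, which tends to 0 because
    \<open>p > 1\<close>.\<close>
  have "((\<lambda>h. (\<bar>0 + h\<bar> powr p - \<bar>0\<bar> powr p) / h) \<longlongrightarrow> 0) (at 0)"
  proof (rule Lim_null_comparison)
    have "norm ((\<bar>0 + h\<bar> powr p - \<bar>0\<bar> powr p) / h) \<le> \<bar>h\<bar> powr (p - 1)" if "h \<noteq> 0" for h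
      using that by (simp add: powr_diff)
    then show "\<forall>\<^sub>F h in at 0. norm ((\<bar>0 + h\<bar> powr p - \<bar>0\<bar> powr p) / h) \<le> \<bar>h\<bar> powr (p - 1)"
      by (auto simp: eventually_at_filter)
    show "((\<lambda>h. \<bar>h\<bar> powr (p - 1)) \<longlongrightarrow> 0) (at 0)"
      using p by (intro tendsto_zero_powrI tendsto_rabs_zero) auto
  qed
  then show ?thesis
    using equal by (simp add: DERIV_def)
qed

lemma continuous_abs_powr_deriv:
  fixes p :: real
  assumes p: "p > 1"
  shows "continuous_on UNIV (\<lambda>t. p * \<bar>t\<bar> powr (p - 1) * sgn t)"
proof -
  have "isCont (\<lambda>t. p * \<bar>t\<bar> powr (p - 1) * sgn t) t" for t
  proof (cases "t = 0")
    case False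
    then show ?thesis
      by (intro continuous_intros) auto
  next
    case True
    have "((\<lambda>t. p * \<bar>t\<bar> powr (p - 1) * sgn t) \<longlongrightarrow> 0) (at 0)"
    proof (rule Lim_null_comparison)
      show "\<forall>\<^sub>F t in at 0. norm (p * \<bar>t\<bar> powr (p - 1) * sgn t) \<le> p * \<bar>t\<bar> powr (p - 1)"
        using p by (auto simp: abs_mult sgn_if)
      show "((\<lambda>t. p * \<bar>t\<bar> powr (p - 1)) \<longlongrightarrow> 0) (at 0)"
        using p by (intro tendsto_mult_right_zero tendsto_zero_powrI tendsto_rabs_zero) auto
    qed
    then show ?thesis
      using True by (simp add: isCont_def)
  qed
  then show ?thesis
    by (simp add: continuous_at_imp_continuous_on)
qed

text \<open>Twice the cube of the positive part, in a form whose C1 regularity follows from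
  \<open>DERIV_abs_powr\<close> at exponent 3. For the gluing of C1 functions this replaces smooth
  cut-offs.\<close>

lemma abs_cube_bump:
  fixes t :: real
  shows "\<bar>t\<bar> powr 3 + t ^ 3 = (if t > 0 then 2 * t ^ 3 else 0)"
  by (cases t "0 :: real" rule: linorder_cases) (auto simp: powr_numeral)

lemma C1_on_bump:
  fixes y :: "real^'m::finite"
  shows "C1_on UNIV (\<lambda>x. \<bar>\<rho> - (x - y) \<bullet> (x - y)\<bar> powr 3 + (\<rho> - (x - y) \<bullet> (x - y)) ^ 3)"
proof -
  have id: "C1_on UNIV (\<lambda>x :: real^'m. x)"
    by (rule C1_onI[where D = "\<lambda>x h. h"]) auto
  have *: "C1_on UNIV (\<lambda>x. \<rho> - (x - y) \<bullet> (x - y))"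
    by (intro C1_on_diff C1_on_const C1_on_inner id)
  show ?thesis
  proof (rule C1_on_real_compose[OF *, where T = UNIV and h = "\<lambda>t. \<bar>t\<bar> powr 3 + t ^ 3"])
    show "((\<lambda>t::real. \<bar>t\<bar> powr 3 + t ^ 3) has_field_derivative 3 * \<bar>t\<bar> powr (3 - 1) * sgn t + 3 * t ^ 2) (at t)" for t
      by (intro DERIV_add DERIV_abs_powr) (auto intro!: derivative_eq_intros)
    show "continuous_on UNIV (\<lambda>t::real. 3 * \<bar>t\<bar> powr (3 - 1) * sgn t + 3 * t ^ 2)"
      by (intro continuous_on_add continuous_abs_powr_deriv continuous_intros) auto
  qed auto
qed

lemma C1_map_Int: "C1_map \<A> f \<Longrightarrow> c \<in> \<A> \<Longrightarrow> C1_on (snd c ` (fst c \<inter> V)) (patch c f)"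
  unfolding C1_map_def by (rule C1_on_subset[of "crng c"]) auto

lemma C1_map_mult: "C1_map \<A> f \<Longrightarrow> C1_map \<A> g \<Longrightarrow> C1_map \<A> (\<lambda>q. f q * g q)"
  unfolding C1_map_def patch_def o_def by (intro ballI C1_on_mult) auto

lemma C1_map_sum: "(\<And>i. i \<in> I \<Longrightarrow> C1_map \<A> (f i)) \<Longrightarrow> C1_map \<A> (\<lambda>q. \<Sum>i\<in>I. f i q)"
  unfolding C1_map_def patch_def o_def by (intro ballI C1_on_sum) auto

context
  fixes \<A> :: "('a::{t2_space,second_countable_topology}, 'm::finite) chart set"
  assumes atlas: "smooth_atlas \<A>"
begin

text \<open>Continuous differentiability is local, so functions defined by cases can be treated
  separately on the open sets of a cover.\<close>

lemma C1_map_local: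
  assumes "\<And>q. \<exists>V. open V \<and> q \<in> V \<and> (\<forall>c\<in>\<A>. C1_on (snd c ` (fst c \<inter> V)) (patch c f))"
  shows "C1_map \<A> f"
  unfolding C1_map_def
proof
  fix c assume c: "c \<in> \<A>"
  have "\<exists>W. open W \<and> x \<in> W \<and> C1_on W (patch c f)" if x: "x \<in> crng c" for x
  proof -
    obtain q where q: "q \<in> fst c" "x = snd c q"
      using x by auto
    obtain V where "open V" "q \<in> V" "C1_on (snd c ` (fst c \<inter> V)) (patch c f)"
      using assms c by blast
    then show ?thesis
      using q by (intro exI[of _ "snd c ` (fst c \<inter> V)"] conjI open_chart_image[OF atlas_chart[OF atlas c]]
          open_Int chartD(1)[OF atlas c]) auto
  qed
  then obtain W where W: "\<And>x. x \<in> crng c \<Longrightarrow> open (W x) \<and> x \<in> W x \<and> C1_on (W x) (patch c f)"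
    by metis
  have "continuous_on (\<Union>x\<in>crng c. W x) (pd (patch c f) i)" for i
    by (rule continuous_on_open_UN) (use W C1_on_pd in blast)+
  moreover have "crng c \<subseteq> (\<Union>x\<in>crng c. W x)"
    using W by auto
  ultimately have "continuous_on (crng c) (pd (patch c f) i)" for i
    by (rule continuous_on_subset)
  then show "C1_on (crng c) (patch c f)"
    using W unfolding C1_on_def by blast
qed

lemma C1_on_patch_cong:
  assumes "c \<in> \<A>" "open V" "\<And>q. q \<in> V \<Longrightarrow> f q = g q" "C1_on (snd c ` (fst c \<inter> V)) (patch c g)"
  shows "C1_on (snd c ` (fst c \<inter> V)) (patch c f)"
proof -
  have "open (snd c ` (fst c \<inter> V))"
    by (intro open_chart_image[OF atlas_chart[OF atlas assms(1)]] open_Int chartD(1)[OF atlas assms(1)] assms(2)) auto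
  moreover have "patch c f x = patch c g x" if "x \<in> snd c ` (fst c \<inter> V)" for x
    using that by (auto simp: patch_chart[OF atlas assms(1)] assms(3))
  ultimately show ?thesis
    by (rule C1_on_eq[OF _ assms(4)])
qed

text \<open>Up to a factor 2 this is the cubed positive part of r^2 minus the squared distance, read
  in a chart around \<open>q\<close> and extended by zero. The set \<open>K\<close> is compact in a
  Hausdorff space, hence closed, so \<open>- K\<close> and the chart domain form an open cover on
  which the extension is C1.\<close>

lemma exists_bump:
  obtains c b K where "c \<in> \<A>" "C1_map \<A> b" "\<And>q. 0 \<le> b q" "b q > (0::real)" "compact K" "K \<subseteq> fst c"
    "\<And>q. q \<notin> K \<Longrightarrow> b q = 0"
proof -
  obtain c where c: "c \<in> \<A>" "q \<in> fst c"
    using atlas_cover[OF atlas] by blast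
  let ?y = "snd c q"
  obtain r where r: "r > 0" "cball ?y r \<subseteq> crng c"
    using chartD(2)[OF atlas c(1)] c(2) open_contains_cball by blast
  define \<beta> where "\<beta> x = \<bar>r\<^sup>2 - (x - ?y) \<bullet> (x - ?y)\<bar> powr 3 + (r\<^sup>2 - (x - ?y) \<bullet> (x - ?y)) ^ 3" for x
  have C1\<beta>: "C1_on UNIV \<beta>"
    unfolding \<beta>_def by (rule C1_on_bump)
  have \<beta>0: "0 \<le> \<beta> x" for x
    unfolding \<beta>_def abs_cube_bump by simp
  have \<beta>y: "\<beta> ?y > 0"
    unfolding \<beta>_def abs_cube_bump using r by simp
  have \<beta>_out: "\<beta> x = 0" if "x \<notin> cball ?y r" for x
  proof -
    have "r < norm (x - ?y)"
      using that by (simp add: dist_norm norm_minus_commute)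
    then have "r\<^sup>2 \<le> (x - ?y) \<bullet> (x - ?y)"
      using r by (simp add: power2_norm_eq_inner[symmetric] power_mono)
    then show ?thesis
      unfolding \<beta>_def abs_cube_bump by simp
  qed
  define K where "K = chart_inv c ` cball ?y r"
  have K: "compact K" "K \<subseteq> fst c"
    using compact_continuous_image[OF continuous_on_subset[OF chartD(4)[OF atlas c(1)] r(2)] compact_cball]
      r(2) chartD(6)[OF atlas c(1)] by (auto simp: K_def)
  have K_iff: "snd c q' \<in> cball ?y r \<longleftrightarrow> q' \<in> K" if "q' \<in> fst c" for q'
  proof
    assume "snd c q' \<in> cball ?y r"
    from imageI[OF this, of "chart_inv c"] show "q' \<in> K"
      by (simp add: K_def chartD(5)[OF atlas c(1) that])
  next
    assume "q' \<in> K"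
    then obtain x where x: "x \<in> cball ?y r" "q' = chart_inv c x"
      by (auto simp: K_def)
    then show "snd c q' \<in> cball ?y r"
      using chartD(7)[OF atlas c(1), of x] r(2) by auto
  qed
  define b where "b q' = (if q' \<in> fst c then \<beta> (snd c q') else 0)" for q'
  have b_out: "b q' = 0" if "q' \<notin> K" for q'
    using \<beta>_out K_iff that by (auto simp: b_def)
  have "C1_map \<A> b"
  proof (rule C1_map_local)
    fix q'
    show "\<exists>V. open V \<and> q' \<in> V \<and> (\<forall>d\<in>\<A>. C1_on (snd d ` (fst d \<inter> V)) (patch d b))"
    proof (cases "q' \<in> K")
      case True
      have "C1_on (snd d ` (fst d \<inter> fst c)) (patch d b)" if d: "d \<in> \<A>" for d
      proof -
        have "C1_on (snd d ` (fst d \<inter> fst c)) (\<lambda>x. \<beta> (transition d c x))"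
          by (rule C1_on_compose[OF smooth_on_imp_C1_on[OF smooth_transition[OF atlas d c(1)]] C1\<beta>]) auto
        then show ?thesis
        proof (rule C1_on_eq[OF open_overlap[OF atlas d c(1)]])
          show "patch d b x = \<beta> (transition d c x)" if "x \<in> snd d ` (fst d \<inter> fst c)" for x
            using that by (auto simp: patch_chart[OF atlas d] transition_chart[OF atlas d c(1)] b_def)
        qed
      qed
      then show ?thesis
        using True K chartD(1)[OF atlas c(1)] by (intro exI[of _ "fst c"]) auto
    next
      case False
      have op: "open (- K)"
        using compact_imp_closed[OF K(1)] by (simp add: open_Compl)
      have "C1_on (snd d ` (fst d \<inter> - K)) (patch d b)" if d: "d \<in> \<A>" for d
        by (rule C1_on_patch_cong[OF d op, where g = "\<lambda>_. 0"]) (auto simp: b_out patch_def o_def)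
      then show ?thesis
        using False op by (intro exI[of _ "- K"]) auto
    qed
  qed
  moreover have "b q > 0" "\<And>q. 0 \<le> b q"
    using c(2) \<beta>y \<beta>0 by (auto simp: b_def)
  ultimately show thesis
    using K b_out by (intro that[of c b K] c(1))
qed

end

section \<open>Integration over the manifold\<close>

context
  fixes \<A> :: "('a::{t2_space,second_countable_topology}, 'm::finite) chart set"
    and \<phi> :: "'a \<Rightarrow> 'e::euclidean_space"
  assumes atlas: "smooth_atlas \<A>" and imm: "immersion \<A> \<phi>"
begin

lemma sets_riemannian: "sets (riemannian_measure \<A> \<phi>) = sets borel"
  and emeasure_riemannian: "c \<in> \<A> \<Longrightarrow> B \<in> sets borel \<Longrightarrow> B \<subseteq> fst c \<Longrightarrow>
    emeasure (riemannian_measure \<A> \<phi>) B = (\<integral>\<^sup>+x\<in>snd c ` B. ennreal (vol (patch c \<phi>) x) \<partial>lborel)"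
  using is_riemannian_measure_riemannian_measure[OF atlas imm] by blast+

lemma borel_measurable_riemannian: "borel_measurable (riemannian_measure \<A> \<phi>) = borel_measurable borel"
  by (rule measurable_cong_sets[OF sets_riemannian refl])

text \<open>This is where integrals on the manifold become integrals in coordinates: both measures
  have the same value on every Borel set, by the defining property applied to its part in the chart
  domain.\<close>

lemma riemannian_measure_chart:
  assumes c: "c \<in> \<A>"
  shows "density (riemannian_measure \<A> \<phi>) (\<lambda>q. ennreal (indicator (fst c) q)) = chart_measure c (vol (patch c \<phi>))"
proof (rule measure_eqI)
  let ?\<mu> = "riemannian_measure \<A> \<phi>"
  show "sets (density ?\<mu> (\<lambda>q. ennreal (indicator (fst c) q))) = sets (chart_measure c (vol (patch c \<phi>)))"
    by (simp add: sets_riemannian)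
  fix B assume "B \<in> sets (density ?\<mu> (\<lambda>q. ennreal (indicator (fst c) q)))"
  then have B: "B \<in> sets borel"
    by (simp add: sets_riemannian)
  have op: "fst c \<in> sets borel"
    using chartD(1)[OF atlas c] by simp
  have "emeasure (density ?\<mu> (\<lambda>q. ennreal (indicator (fst c) q))) B = emeasure ?\<mu> (fst c \<inter> B)"
    using emeasure_restricted[of "fst c" ?\<mu> B] B op by (simp add: sets_riemannian ennreal_indicator)
  also have "\<dots> = (\<integral>\<^sup>+x\<in>snd c ` (fst c \<inter> B). ennreal (vol (patch c \<phi>) x) \<partial>lborel)"
    using B op by (intro emeasure_riemannian c) auto
  also have "\<dots> = emeasure (chart_measure c (vol (patch c \<phi>))) B"
    using emeasure_chart_measure[OF atlas_chart[OF atlas c] vol_continuous[OF atlas imm c] _ B]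
      vol_pos[OF atlas imm c] by (simp add: less_imp_le Int_commute)
  finally show "emeasure (density ?\<mu> (\<lambda>q. ennreal (indicator (fst c) q))) B = emeasure (chart_measure c (vol (patch c \<phi>))) B" .
qed

text \<open>The density is bounded on the compact coordinate image of \<open>K\<close>, so
  \<open>K\<close> has finite measure; as \<open>g\<close> is bounded on \<open>K\<close>, it is
  integrable. Off the chart domain \<open>g\<close> vanishes, so the measure may be restricted to
  that domain.\<close>

lemma integral_supported_in_chart:
  fixes g :: "'a \<Rightarrow> real"
  assumes c: "c \<in> \<A>" and g: "continuous_on UNIV g" and K: "compact K" "K \<subseteq> fst c" "\<And>q. q \<notin> K \<Longrightarrow> g q = 0"
  shows "integrable (riemannian_measure \<A> \<phi>) g"
    and "integral\<^sup>L (riemannian_measure \<A> \<phi>) g = (LINT x:crng c|lborel. vol (patch c \<phi>) x * patch c g x)"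
proof -
  let ?\<mu> = "riemannian_measure \<A> \<phi>"
  have mg: "g \<in> borel_measurable borel"
    using g by (rule borel_measurable_continuous_onI)
  have Kb: "K \<in> sets borel"
    using compact_imp_closed[OF K(1)] by simp
  have cK: "compact (snd c ` K)"
    by (intro compact_continuous_image continuous_on_subset[OF chartD(3)[OF atlas c] K(2)] K(1))
  have subK: "snd c ` K \<subseteq> crng c"
    using K(2) by auto
  obtain C where C: "\<And>x. x \<in> snd c ` K \<Longrightarrow> \<bar>vol (patch c \<phi>) x\<bar> \<le> C"
    using compact_imp_bounded[OF compact_continuous_image[OF continuous_on_subset[OF vol_continuous[OF atlas imm c] subK] cK]]
    unfolding bounded_iff by auto
  have "emeasure ?\<mu> K = (\<integral>\<^sup>+x. ennreal (vol (patch c \<phi>) x) * indicator (snd c ` K) x \<partial>lborel)"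
    by (rule emeasure_riemannian[OF c Kb K(2)])
  also have "\<dots> \<le> (\<integral>\<^sup>+x. ennreal C * indicator (snd c ` K) x \<partial>lborel)"
  proof (rule nn_integral_mono)
    fix x
    show "ennreal (vol (patch c \<phi>) x) * indicator (snd c ` K) x \<le> ennreal C * indicator (snd c ` K) x"
      using C[of x] by (cases "x \<in> snd c ` K") (auto intro!: ennreal_leI)
  qed
  also have "\<dots> = ennreal C * emeasure lborel (snd c ` K)"
    using compact_imp_closed[OF cK] by (intro nn_integral_cmult_indicator) auto
  also have "\<dots> < \<infinity>"
    using emeasure_compact_finite[OF cK] by (simp add: ennreal_mult_less_top)
  finally have finK: "emeasure ?\<mu> K < \<infinity>" .
  obtain C' where C': "\<And>q. q \<in> K \<Longrightarrow> norm (g q) \<le> C'"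
    using compact_imp_bounded[OF compact_continuous_image[OF continuous_on_subset[OF g subset_UNIV] K(1)]]
    unfolding bounded_iff by auto
  show "integrable ?\<mu> g"
    by (rule integrableI_bounded_set[where A = K and B = C'])
      (use finK C' K(3) Kb mg in \<open>auto simp: sets_riemannian borel_measurable_riemannian\<close>)
  have "integral\<^sup>L ?\<mu> g = integral\<^sup>L ?\<mu> (\<lambda>q. indicator (fst c) q *\<^sub>R g q)"
  proof (rule Bochner_Integration.integral_cong[OF refl])
    show "g q = indicator (fst c) q *\<^sub>R g q" for q
      using K(2,3) by (cases "q \<in> fst c") auto
  qed
  also have "\<dots> = integral\<^sup>L (density ?\<mu> (\<lambda>q. ennreal (indicator (fst c) q))) g"
    using mg chartD(1)[OF atlas c]
    by (intro integral_density[symmetric]) (auto simp: borel_measurable_riemannian sets_riemannian)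
  also have "\<dots> = (LINT x:crng c|lborel. vol (patch c \<phi>) x * g (chart_inv c x))"
    unfolding riemannian_measure_chart[OF c]
    by (rule integral_chart_measure[OF atlas_chart[OF atlas c] vol_continuous[OF atlas imm c] less_imp_le[OF vol_pos[OF atlas imm c]] mg])
  finally show "integral\<^sup>L ?\<mu> g = (LINT x:crng c|lborel. vol (patch c \<phi>) x * patch c g x)"
    by (simp add: patch_def)
qed

lemma grad_eq_0:
  assumes "open V" "q \<in> V" "\<And>q'. q' \<in> V \<Longrightarrow> f q' = 0"
  shows "grad \<A> \<phi> f q = 0"
proof -
  let ?d = "chart_at \<A> q"
  note d = chart_at[OF atlas, of q]
  have "pd (patch ?d f) i (snd ?d q) = 0" for i
  proof (rule pd_eq_0)
    show "open (snd ?d ` (fst ?d \<inter> V))"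
      by (intro open_chart_image[OF atlas_chart[OF atlas d(1)]] open_Int chartD(1)[OF atlas d(1)] assms(1)) auto
    show "patch ?d f x = 0" if "x \<in> snd ?d ` (fst ?d \<inter> V)" for x
      using that by (auto simp: patch_chart[OF atlas d(1)] assms(3))
  qed (use d assms in auto)
  then show ?thesis
    by (simp add: grad_def chart_grad_def)
qed

lemma variation_eq_0:
  assumes "open V" "q \<in> V" "\<And>q'. q' \<in> V \<Longrightarrow> f q' = 0"
  shows "variation \<A> \<phi> P z f q = 0"
  using grad_eq_0[OF assms] assms by (simp add: variation_def)

lemma variation_sum:
  assumes "\<And>i. i \<in> I \<Longrightarrow> C1_map \<A> (f i)"
  shows "variation \<A> \<phi> P z (\<lambda>q. \<Sum>i\<in>I. f i q) q = (\<Sum>i\<in>I. variation \<A> \<phi> P z (f i) q)"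
proof -
  let ?d = "chart_at \<A> q"
  note d = chart_at[OF atlas, of q]
  have "pd (patch ?d (\<lambda>q. \<Sum>i\<in>I. f i q)) k (snd ?d q) = (\<Sum>i\<in>I. pd (patch ?d (f i)) k (snd ?d q))" for k
    using pd_sum[of I "\<lambda>i. patch ?d (f i)" "snd ?d q" k] C1_map_differentiable[OF assms d]
    by (simp add: patch_def o_def)
  then have "grad \<A> \<phi> (\<lambda>q. \<Sum>i\<in>I. f i q) q = (\<Sum>i\<in>I. grad \<A> \<phi> (f i) q)"
    unfolding grad_def chart_grad_def by (simp add: scaleR_sum_left) (rule sum.swap)
  then show ?thesis
    by (simp add: variation_def sum.distrib sum_distrib_right inner_sum_left)
qed

lemma first_variation_in_chart:
  assumes min: "minimal_immersion \<A> \<phi>" and P: "bounded_linear P"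
    and c: "c \<in> \<A>" and f: "C1_map \<A> f" and K: "compact K" "K \<subseteq> fst c" "\<And>q. q \<notin> K \<Longrightarrow> f q = 0"
  shows "integrable (riemannian_measure \<A> \<phi>) (variation \<A> \<phi> P z f)"
    and "integral\<^sup>L (riemannian_measure \<A> \<phi>) (variation \<A> \<phi> P z f) = 0"
proof -
  have op: "open (- K)"
    using compact_imp_closed[OF K(1)] by (simp add: open_Compl)
  have v0: "variation \<A> \<phi> P z f q = 0" if "q \<notin> K" for q
    by (rule variation_eq_0[OF op]) (use that K(3) in auto)
  note sup = integral_supported_in_chart[OF c continuous_variation[OF atlas imm P f] K(1,2) v0]
  show "integrable (riemannian_measure \<A> \<phi>) (variation \<A> \<phi> P z f)"
    by (rule sup(1))
  have "integral\<^sup>L (riemannian_measure \<A> \<phi>) (variation \<A> \<phi> P z f)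
     = (LINT x:crng c|lborel. vol (patch c \<phi>) x * patch c (variation \<A> \<phi> P z f) x)"
    by (rule sup(2))
  also have "\<dots> = (LINT x:crng c|lborel. vol (patch c \<phi>) x *
      (patch c f x * (\<Sum>i\<in>UNIV. coframe (patch c \<phi>) i x \<bullet> P (pd (patch c \<phi>) i x))
      + (\<Sum>i\<in>UNIV. pd (patch c f) i x *\<^sub>R coframe (patch c \<phi>) i x) \<bullet> (P (patch c \<phi> x) - z)))"
    using chartD(2)[OF atlas c]
    by (intro set_lebesgue_integral_cong) (auto simp: variation_patch[OF atlas imm c P f])
  also have "\<dots> = 0"
  proof (rule first_variation_chart[OF regular_patch[OF atlas imm c] _ P])
    show "mean_curvature (patch c \<phi>) x = 0" if "x \<in> crng c" for x
      using min c that by (auto simp: minimal_immersion_def patch_def)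
    show "C1_on (crng c) (patch c f)"
      using f c by (simp add: C1_map_def)
    show "compact (snd c ` K)"
      by (intro compact_continuous_image continuous_on_subset[OF chartD(3)[OF atlas c] K(2)] K(1))
    show "snd c ` K \<subseteq> crng c"
      using K(2) by auto
    show "patch c f x = 0" if "x \<in> crng c - snd c ` K" for x
    proof -
      have "chart_inv c x \<notin> K"
        using that chartD(7)[OF atlas c] by (metis DiffD1 DiffD2 imageI)
      then show ?thesis
        by (simp add: patch_def K(3))
    qed
  qed
  finally show "integral\<^sup>L (riemannian_measure \<A> \<phi>) (variation \<A> \<phi> P z f) = 0" .
qed

text \<open>Dividing by the sum of finitely many bump functions instead of normalising them gives the
  partition of unity on the support of \<open>f\<close>; the junk value \<open>x / 0 = 0\<close> occurs only off the support.\<close>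

theorem first_variation:
  assumes min: "minimal_immersion \<A> \<phi>" and P: "bounded_linear P"
    and f: "C1_map \<A> f" and K: "compact K" "\<And>q. q \<notin> K \<Longrightarrow> f q = 0"
  shows "integrable (riemannian_measure \<A> \<phi>) (variation \<A> \<phi> P z f)"
    and "integral\<^sup>L (riemannian_measure \<A> \<phi>) (variation \<A> \<phi> P z f) = 0"
proof -
  have "\<forall>q. \<exists>c b K. c \<in> \<A> \<and> C1_map \<A> b \<and> (\<forall>q. 0 \<le> b q) \<and> b q > (0::real) \<and> compact K \<and> K \<subseteq> fst c
      \<and> (\<forall>q. q \<notin> K \<longrightarrow> b q = 0)"
    using exists_bump[OF atlas] by metis
  then obtain c b k where cbk: "\<And>q. c q \<in> \<A>" "\<And>q. C1_map \<A> (b q)" "\<And>q q'. 0 \<le> b q q'" "\<And>q. b q q > (0::real)"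
    "\<And>q. compact (k q)" "\<And>q. k q \<subseteq> fst (c q)" "\<And>q q'. q' \<notin> k q \<Longrightarrow> b q q' = 0"
    by metis
  have "open {q'. b q q' > 0}" for q
    using C1_map_continuous[OF atlas cbk(2)] by (intro open_Collect_less continuous_on_const)
  moreover have "K \<subseteq> (\<Union>q\<in>K. {q'. b q q' > 0})"
    using cbk(4) by auto
  ultimately obtain I where I: "finite I" "K \<subseteq> (\<Union>q\<in>I. {q'. b q q' > 0})"
    using compactE_image[OF K(1), of K "\<lambda>q. {q'. b q q' > 0}"] by metis
  define B where "B q' = (\<Sum>q\<in>I. b q q')" for q'
  have C1B: "C1_map \<A> B"
    unfolding B_def by (intro C1_map_sum cbk(2))
  have Bpos: "B q > 0" if q: "q \<in> K" for q
  proof -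
    obtain q0 where "q0 \<in> I" "b q0 q > 0"
      using I(2) q by blast
    then show ?thesis
      unfolding B_def using I(1) cbk(3) by (intro sum_pos2[of I q0]) auto
  qed
  define g where "g q = f q / B q" for q
  have g0: "g q = 0" if "q \<notin> K" for q
    using K(2) that by (simp add: g_def)
  have C1g: "C1_map \<A> g"
  proof (rule C1_map_local[OF atlas])
    fix q
    show "\<exists>V. open V \<and> q \<in> V \<and> (\<forall>d\<in>\<A>. C1_on (snd d ` (fst d \<inter> V)) (patch d g))"
    proof (cases "q \<in> K")
      case True
      \<comment> \<open>The denominator is positive on an open set containing \<open>K\<close>, so
        \<open>g\<close> is C1 there; on the open complement of \<open>K\<close> it is 0.\<close>
      have "C1_on (snd d ` (fst d \<inter> {q. B q > 0})) (patch d g)" if d: "d \<in> \<A>" for d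
      proof -
        have "C1_on (snd d ` (fst d \<inter> {q. B q > 0})) (\<lambda>x. patch d f x / patch d B x)"
          by (rule C1_on_divide[OF C1_map_Int[OF f d] C1_map_Int[OF C1B d]])
            (auto simp: patch_chart[OF atlas d])
        then show ?thesis
          by (simp add: patch_def o_def g_def)
      qed
      moreover have "open {q. B q > 0}"
        using C1_map_continuous[OF atlas C1B] by (intro open_Collect_less continuous_on_const)
      ultimately show ?thesis
        using Bpos[OF True] by (intro exI[of _ "{q. B q > 0}"]) auto
    next
      case False
      have op: "open (- K)"
        using compact_imp_closed[OF K(1)] by (simp add: open_Compl)
      have "C1_on (snd d ` (fst d \<inter> - K)) (patch d g)" if d: "d \<in> \<A>" for d
        by (rule C1_on_patch_cong[OF atlas d op, where g = "\<lambda>_. 0"]) (auto simp: g0 patch_def o_def)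
      then show ?thesis
        using False op by (intro exI[of _ "- K"]) auto
    qed
  qed
  have C1gb: "C1_map \<A> (\<lambda>q'. g q' * b q q')" for q
    by (intro C1_map_mult C1g cbk(2))
  have f_eq: "f = (\<lambda>q'. \<Sum>q\<in>I. g q' * b q q')"
  proof
    fix q'
    show "f q' = (\<Sum>q\<in>I. g q' * b q q')"
    proof (cases "q' \<in> K")
      case True
      have "(\<Sum>q\<in>I. g q' * b q q') = g q' * B q'"
        by (simp add: B_def sum_distrib_left)
      then show ?thesis
        using Bpos[OF True] by (simp add: g_def)
    next
      case False
      then show ?thesis
        using K(2) g0 by simp
    qed
  qed
  have var: "variation \<A> \<phi> P z f = (\<lambda>q'. \<Sum>q\<in>I. variation \<A> \<phi> P z (\<lambda>q'. g q' * b q q') q')"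
    by (subst f_eq) (intro ext variation_sum C1gb)
  \<comment> \<open>Each product is supported in the compact set \<open>k q\<close>, which lies
    inside a single chart domain.\<close>
  note fv = first_variation_in_chart[OF min P cbk(1) C1gb cbk(5,6)]
  have fv0: "g q' * b q q' = 0" if "q' \<notin> k q" for q q'
    using cbk(7) that by simp
  show "integrable (riemannian_measure \<A> \<phi>) (variation \<A> \<phi> P z f)"
    unfolding var using fv(1)[OF fv0] by (intro Bochner_Integration.integrable_sum) auto
  show "integral\<^sup>L (riemannian_measure \<A> \<phi>) (variation \<A> \<phi> P z f) = 0"
    unfolding var using fv[OF fv0] by (subst Bochner_Integration.integral_sum) auto
qed

end

section \<open>Stability\<close>

text \<open>Young's inequality with exponents \<open>p\<close> and \<open>p / (p - 1)\<close> for
  \<open>N\<close> and \<open>s powr (p - 1)\<close>, multiplied by \<open>p\<close>.\<close>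

lemma young_powr:
  fixes p s N :: real
  assumes p: "p > 1" and s: "s \<ge> 0" and N: "N \<ge> 0"
  shows "p * (s powr (p - 1) * N) \<le> N powr p + (p - 1) * s powr p"
proof -
  have "N * s powr (p - 1) \<le> N powr p / p + (s powr (p - 1)) powr (p / (p - 1)) / (p / (p - 1))"
    using p s N by (intro Youngs_inequality) (auto simp: field_simps)
  also have "(s powr (p - 1)) powr (p / (p - 1)) = s powr p"
    using p by (simp add: powr_powr)
  finally show ?thesis
    using p by (simp add: field_simps)
qed

lemma smooth_map_C1: "smooth_map \<A> u \<Longrightarrow> C1_map \<A> u"
  unfolding smooth_map_def C1_map_def patch_def using smooth_on_imp_C1_on by blast

lemma C1_map_abs_powr:
  assumes p: "p > 1" and u: "C1_map \<A> u"
  shows "C1_map \<A> (\<lambda>q. \<bar>u q\<bar> powr p)"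
  unfolding C1_map_def
proof
  fix c assume "c \<in> \<A>"
  then have "C1_on (crng c) (patch c u)"
    using u by (simp add: C1_map_def)
  then have "C1_on (crng c) (\<lambda>x. \<bar>patch c u x\<bar> powr p)"
    by (rule C1_on_real_compose[OF _ DERIV_abs_powr[OF p] continuous_abs_powr_deriv[OF p] subset_UNIV])
  then show "C1_on (crng c) (patch c (\<lambda>q. \<bar>u q\<bar> powr p))"
    by (simp add: patch_def o_def)
qed

text \<open>Coordinate balls make the manifold locally connected: a small one around
  \<open>q\<close> stays in \<open>S\<close>, is connected, and lies in the component by maximality.
  Openness makes the component a Borel set.\<close>

lemma open_component:
  fixes \<A> :: "('a::{t2_space,second_countable_topology}, 'm::finite) chart set"
  assumes atlas: "smooth_atlas \<A>" and S: "open (S :: 'a set)" and \<Omega>: "\<Omega> \<in> components S"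
  shows "open \<Omega>"
proof (subst open_subopen, rule ballI)
  fix q assume q: "q \<in> \<Omega>"
  obtain c where c: "c \<in> \<A>" "q \<in> fst c"
    using atlas_cover[OF atlas] by blast
  note ch = is_chartD[OF atlas_chart[OF atlas c(1)]]
  have qS: "q \<in> S"
    using q \<Omega> in_components_subset by blast
  have "open (snd c ` (fst c \<inter> S))"
    using S ch(1) by (intro open_chart_image[OF atlas_chart[OF atlas c(1)]]) auto
  moreover have "snd c q \<in> snd c ` (fst c \<inter> S)"
    using qS c(2) by blast
  ultimately obtain e where e: "e > 0" "ball (snd c q) e \<subseteq> snd c ` (fst c \<inter> S)"
    using openE by blast
  let ?T = "fst c \<inter> snd c -` ball (snd c q) e"
  have oT: "open ?T"
    by (rule continuous_open_preimage[OF ch(3,1) open_ball])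
  have qT: "q \<in> ?T"
    using c(2) e(1) by simp
  have sub: "ball (snd c q) e \<subseteq> crng c"
    using e(2) by blast
  have T: "?T = chart_inv c ` ball (snd c q) e"
  proof
    show "?T \<subseteq> chart_inv c ` ball (snd c q) e"
    proof
      fix y assume "y \<in> ?T"
      then show "y \<in> chart_inv c ` ball (snd c q) e"
        using ch(5)[of y] by (intro image_eqI[of _ _ "snd c y"]) auto
    qed
    show "chart_inv c ` ball (snd c q) e \<subseteq> ?T"
    proof
      fix y assume "y \<in> chart_inv c ` ball (snd c q) e"
      then obtain x where "x \<in> ball (snd c q) e" "y = chart_inv c x"
        by blast
      then show "y \<in> ?T"
        using ch(6,7)[of x] sub by auto
    qed
  qed
  have "connected ?T"
    unfolding T by (intro connected_continuous_image continuous_on_subset[OF ch(4) sub] connected_ball)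
  moreover have "?T \<subseteq> S"
  proof
    fix y assume y: "y \<in> ?T"
    then have "snd c y \<in> snd c ` (fst c \<inter> S)"
      using e(2) by auto
    then obtain y' where "y' \<in> fst c" "y' \<in> S" "snd c y = snd c y'"
      by auto
    then show "y \<in> S"
      using y ch(5) by (metis IntD1)
  qed
  ultimately have "?T \<subseteq> \<Omega>"
    using components_maximal[OF \<Omega>] q qT by blast
  then show "\<exists>T. open T \<and> q \<in> T \<and> T \<subseteq> \<Omega>"
    using oT qT by blast
qed

context
  fixes \<A> :: "('a::{t2_space,second_countable_topology}, 'm::finite) chart set"
    and \<phi> :: "'a \<Rightarrow> 'e::euclidean_space"
  assumes atlas: "smooth_atlas \<A>" and imm: "immersion \<A> \<phi>"
begin

lemma grad_abs_powr:
  assumes p: "p > 1" and u: "C1_map \<A> u"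
  shows "grad \<A> \<phi> (\<lambda>q. \<bar>u q\<bar> powr p) q = (p * \<bar>u q\<bar> powr (p - 1) * sgn (u q)) *\<^sub>R grad \<A> \<phi> u q"
proof -
  let ?d = "chart_at \<A> q"
  note d = chart_at[OF atlas, of q]
  have "pd (patch ?d (\<lambda>q. \<bar>u q\<bar> powr p)) i (snd ?d q)
    = (p * \<bar>u q\<bar> powr (p - 1) * sgn (u q)) * pd (patch ?d u) i (snd ?d q)" for i
    using pd_real_compose(2)[OF C1_map_differentiable[OF u d] DERIV_abs_powr[OF p], of i]
    by (simp add: patch_chart[OF atlas d]) (simp add: patch_def o_def)
  then show ?thesis
    by (simp add: grad_def chart_grad_def scaleR_sum_right)
qed

end

text \<open>The map is the identity minus the projection to the line spanned by
  \<open>(0, 1)\<close>. The identity has trace \<open>CARD('m)\<close>, and the tangential trace of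
  the projection to a unit vector is at most 1.\<close>

lemma tangent_trace_fst:
  fixes \<A> :: "('a::{t2_space,second_countable_topology}, 'm::finite) chart set"
    and \<phi> :: "'a \<Rightarrow> 'e::euclidean_space \<times> real"
  assumes atlas: "smooth_atlas \<A>" and imm: "immersion \<A> \<phi>"
  shows "tangent_trace \<A> \<phi> (\<lambda>v. (fst v, 0)) q \<ge> real CARD('m) - 1"
proof -
  let ?d = "chart_at \<A> q"
  note d = chart_at[OF atlas, of q]
  note rg = regular_patch[OF atlas imm d(1)] and x = snd_in_crng[OF d(2)]
  let ?e = "(0, 1) :: 'e \<times> real"
  define v where "v i = pd (patch ?d \<phi>) i (snd ?d q)" for i
  have fr: "frame v"
    unfolding v_def[abs_def] by (rule frame_pd[OF rg x])
  have co: "coframe (patch ?d \<phi>) i (snd ?d q) = dual_frame v i" for i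
    by (simp add: coframe_def v_def[abs_def])
  have "tangent_trace \<A> \<phi> (\<lambda>v. (fst v, 0)) q = (\<Sum>i\<in>UNIV. dual_frame v i \<bullet> (fst (v i), 0))"
    by (simp add: tangent_trace_def chart_trace_def co) (simp add: v_def)
  also have "\<dots> = (\<Sum>i\<in>UNIV. 1 - (v i \<bullet> ?e) * (dual_frame v i \<bullet> ?e))"
  proof (rule sum.cong[OF refl])
    fix i
    have "dual_frame v i \<bullet> v i = 1"
      by (simp add: dual_frame_inner[OF fr])
    then show "dual_frame v i \<bullet> (fst (v i), 0) = 1 - (v i \<bullet> ?e) * (dual_frame v i \<bullet> ?e)"
      by (simp add: inner_prod_def algebra_simps)
  qed
  also have "\<dots> = real CARD('m) - (\<Sum>i\<in>UNIV. (v i \<bullet> ?e) * (dual_frame v i \<bullet> ?e))"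
    by (simp add: sum_subtractf)
  also have "\<dots> \<ge> real CARD('m) - 1"
    using sum_dual_frame_comp[OF fr, of ?e] by (simp add: norm_Pair)
  finally show ?thesis .
qed

text \<open>All estimates are made pointwise, so that integration only has to remove the left side.
  \<open>A\<close> stands for the norm of the second fundamental form at \<open>q\<close>; the
  weight of \<open>variation\<close> is chosen so that Young's inequality applies with
  \<open>l * a\<close> and \<open>norm G\<close>.\<close>

lemma variation_lower_bound:
  fixes \<A> :: "('a::{t2_space,second_countable_topology}, 'm::finite) chart set"
    and \<phi> :: "'a \<Rightarrow> 'e::euclidean_space \<times> real"
  assumes atlas: "smooth_atlas \<A>" and imm: "immersion \<A> \<phi>" and u: "C1_map \<A> u"
    and p: "p > 1" and r: "r > 0" and q: "dist x0 (fst (\<phi> q)) < r"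
    and m: "real CARD('m) > 1"
    and V: "0 \<le> A" "A \<le> (real CARD('m) - 1) / (p * r)"
  shows "- (((real CARD('m) - 1) / (p * r)) powr (p - 1) / r
        * variation \<A> \<phi> (\<lambda>v. (fst v, 0)) (x0, 0) (\<lambda>q. \<bar>u q\<bar> powr p) q)
    \<le> grad_norm \<A> \<phi> u q powr p - A powr p * \<bar>u q\<bar> powr p"
proof -
  let ?P = "\<lambda>v :: 'e \<times> real. (fst v, 0 :: real)"
  define l where "l = (real CARD('m) - 1) / (p * r)"
  define a where "a = \<bar>u q\<bar>"
  define G where "G = grad \<A> \<phi> u q"
  define X where "X = ?P (\<phi> q) - (x0, 0)"
  define w where "w = variation \<A> \<phi> ?P (x0, 0) (\<lambda>q. \<bar>u q\<bar> powr p) q"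
  have l: "l > 0" "p * r * l = real CARD('m) - 1"
    using m p r by (auto simp: l_def)
  have a: "a \<ge> 0"
    by (simp add: a_def)
  have "X = (fst (\<phi> q) - x0, 0)"
    by (simp add: X_def)
  then have X: "norm X \<le> r"
    using q by (simp add: norm_Pair dist_norm norm_minus_commute)
  have w: "w = a powr p * tangent_trace \<A> \<phi> ?P q + p * a powr (p - 1) * (sgn (u q) * (G \<bullet> X))"
    by (simp add: w_def variation_def grad_abs_powr[OF atlas imm p u] a_def G_def X_def)
  have GX: "- (sgn (u q) * (G \<bullet> X)) \<le> norm G * r"
  proof -
    have "\<bar>sgn (u q) * (G \<bullet> X)\<bar> \<le> \<bar>G \<bullet> X\<bar>"
      by (auto simp: abs_mult sgn_if)
    also have "\<dots> \<le> norm G * norm X"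
      by (rule Cauchy_Schwarz_ineq2)
    also have "\<dots> \<le> norm G * r"
      using X by (rule mult_left_mono) simp
    finally show ?thesis by linarith
  qed
  \<comment> \<open>The trace bound serves the first term of \<open>variation\<close>, and
    Cauchy-Schwarz with \<open>norm X \<le> r\<close> the second.\<close>
  have "a powr p * (p * r * l) - p * a powr (p - 1) * (norm G * r) \<le> w"
  proof -
    have "a powr p * (p * r * l) \<le> a powr p * tangent_trace \<A> \<phi> ?P q"
      unfolding l(2) using tangent_trace_fst[OF atlas imm] by (rule mult_left_mono) simp
    moreover have "p * a powr (p - 1) * - (sgn (u q) * (G \<bullet> X)) \<le> p * a powr (p - 1) * (norm G * r)"
      using GX p by (intro mult_left_mono) auto
    ultimately show ?thesis
      unfolding w by simp
  qed
  then have "l powr (p - 1) / r * (a powr p * (p * r * l) - p * a powr (p - 1) * (norm G * r)) \<le> l powr (p - 1) / r * w"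
    using r by (intro mult_left_mono) auto
  \<comment> \<open>The weight turns both terms into powers of \<open>l * a\<close>: in the first
    one the missing factor \<open>l\<close> comes from the trace bound, and \<open>r\<close> cancels
    in each.\<close>
  moreover have "l powr (p - 1) / r * (a powr p * (p * r * l) - p * a powr (p - 1) * (norm G * r))
    = p * (l * a) powr p - p * ((l * a) powr (p - 1) * norm G)"
  proof -
    have "l powr p = l powr (p - 1) * l"
      using l(1) by (simp add: powr_diff)
    then show ?thesis
      using l(1) a r by (simp add: powr_mult field_simps)
  qed
  moreover have "p * ((l * a) powr (p - 1) * norm G) \<le> norm G powr p + (p - 1) * (l * a) powr p"
    using l a by (intro young_powr p) auto
  moreover have "p * (l * a) powr p = (l * a) powr p + (p - 1) * (l * a) powr p"
    by (simp add: algebra_simps)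
  moreover have "A powr p * a powr p \<le> (l * a) powr p"
  proof -
    have "A powr p \<le> l powr p"
      using V p by (intro powr_mono2) (auto simp: l_def)
    then show ?thesis
      using l(1) a by (simp add: powr_mult mult_right_mono)
  qed
  ultimately have "- (l powr (p - 1) / r * w) \<le> norm G powr p - A powr p * a powr p"
    by linarith
  then show ?thesis
    by (simp only: l_def w_def G_def a_def grad_norm_eq[OF atlas imm])
qed

theorem corollary1p8:
  fixes \<A> :: "('a::{t2_space,second_countable_topology}, 'm::finite) chart set"
    and \<phi> :: "'a \<Rightarrow> (real^'k::finite) \<times> real"
    and p r :: real
    and x0 :: "real^'k"
    and \<Omega> :: "'a set"
  assumes "p > 1" and "CARD('m) \<ge> 3" and "r > 0"
    and "smooth_atlas \<A>"
    and "minimal_immersion \<A> \<phi>"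
    and "complete_immersion \<A> \<phi>"
    and "\<Omega> \<in> components (\<phi> -` (ball x0 r \<times> UNIV))"
    and "\<And>q. q \<in> \<Omega> \<Longrightarrow> second_ff_norm \<A> \<phi> q \<le> (real CARD('m) - 1) / (p * r)"
  shows "p_stable p \<A> \<phi> \<Omega> (\<lambda>q. second_ff_norm \<A> \<phi> q powr p)"
proof -
  let ?\<mu> = "riemannian_measure \<A> \<phi>"
  let ?V = "\<lambda>q. second_ff_norm \<A> \<phi> q powr p"
  let ?l = "(real CARD('m) - 1) / (p * r)"
  note atlas = \<open>smooth_atlas \<A>\<close> and p = \<open>p > 1\<close> and r = \<open>r > 0\<close>
  have imm: "immersion \<A> \<phi>"
    using \<open>minimal_immersion \<A> \<phi>\<close> by (simp add: minimal_immersion_def)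
  have "open (\<phi> -` (ball x0 r \<times> UNIV))"
    using continuous_param[OF atlas imm] by (intro open_vimage open_Times) auto
  then have op: "open \<Omega>"
    using open_component[OF atlas] assms(7) by blast
  have in_cyl: "dist x0 (fst (\<phi> q)) < r" if "q \<in> \<Omega>" for q
  proof -
    have "\<phi> q \<in> ball x0 r \<times> UNIV"
      using in_components_subset[OF assms(7)] that by auto
    then show ?thesis
      by (auto simp: mem_Times_iff)
  qed
  have mV: "?V \<in> borel_measurable borel"
    using borel_measurable_continuous_onI[OF continuous_second_ff_norm[OF atlas imm]] by simp
  have "set_borel_measurable ?\<mu> \<Omega> ?V"
    unfolding set_borel_measurable_def borel_measurable_riemannian[OF atlas imm]
    using mV op by (intro borel_measurable_scaleR borel_measurable_indicator) auto
  \<comment> \<open>The curvature bound raised to the power \<open>p\<close> serves as the essential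
    bound.\<close>
  moreover have "\<exists>C. AE q\<in>\<Omega> in ?\<mu>. 0 \<le> ?V q \<and> ?V q \<le> C"
    using p assms(8) second_ff_norm_nonneg[OF atlas imm]
    by (intro exI[of _ "?l powr p"] AE_I2) (auto intro!: powr_mono2)
  moreover have "0 \<le> (LINT q:\<Omega>|?\<mu>. grad_norm \<A> \<phi> u q powr p - ?V q * \<bar>u q\<bar> powr p)"
    if test: "u \<in> test_functions \<A> \<Omega>" for u
  proof -
    let ?P = "\<lambda>v :: (real^'k) \<times> real. (fst v, 0 :: real)"
    define K where "K = closure {q. u q \<noteq> 0}"
    have K: "compact K" "K \<subseteq> \<Omega>" and u: "C1_map \<A> u"
      using test smooth_map_C1 by (auto simp: test_functions_def K_def)
    have u0: "u q = 0" if "q \<notin> K" for q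
      using that closure_subset by (force simp: K_def)
    define f where "f = (\<lambda>q. \<bar>u q\<bar> powr p)"
    have f0: "f q = 0" if "q \<notin> K" for q
      using u0[OF that] by (simp add: f_def)
    define w where "w = variation \<A> \<phi> ?P (x0, 0) f"
    have "bounded_linear ?P"
      by (intro bounded_linear_Pair bounded_linear_fst bounded_linear_zero)
    moreover have "C1_map \<A> f"
      unfolding f_def by (rule C1_map_abs_powr[OF p u])
    ultimately have w: "integrable ?\<mu> w" "integral\<^sup>L ?\<mu> w = 0"
      using first_variation[OF atlas imm assms(5) _ _ K(1) f0] by (auto simp: w_def)
    define k where "k = ?l powr (p - 1) / r"
    let ?I = "\<lambda>q. indicator \<Omega> q *\<^sub>R (grad_norm \<A> \<phi> u q powr p - ?V q * \<bar>u q\<bar> powr p)"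
    \<comment> \<open>Outside \<open>\<Omega>\<close> both sides are 0: the right one by the
      indicator, the left one because the support of \<open>u\<close> lies in
      \<open>\<Omega>\<close>. The integral over \<open>\<Omega>\<close> can thus be compared with
      one over the whole manifold, where the first variation formula holds.\<close>
    have le: "- (k * w q) \<le> ?I q" for q
    proof (cases "q \<in> \<Omega>")
      case True
      have "real CARD('m) > 1"
        using assms(2) by simp
      then show ?thesis
        using variation_lower_bound[OF atlas imm u p r in_cyl[OF True] _ second_ff_norm_nonneg[OF atlas imm] assms(8)[OF True]] True
        by (simp add: k_def w_def f_def)
    next
      case False
      have "open (- K)"
        using compact_imp_closed[OF K(1)] by (simp add: open_Compl)
      then have "w q = 0"
        unfolding w_def by (rule variation_eq_0[OF atlas imm]) (use False K(2) f0 in auto)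
      then show ?thesis
        using False by simp
    qed
    have "0 \<le> integral\<^sup>L ?\<mu> ?I"
    \<comment> \<open>Monotonicity of the integral asks for both sides to be integrable, and
      \<open>w\<close> is so by the first variation formula. If the right side were not, its Bochner
      integral would be 0 by convention and the claim trivial.\<close>
    proof (cases "integrable ?\<mu> ?I")
      case True
      have "integral\<^sup>L ?\<mu> (\<lambda>q. - (k * w q)) \<le> integral\<^sup>L ?\<mu> ?I"
        using w(1) True le by (intro integral_mono) auto
      then show ?thesis
        using w by simp
    next
      case False
      then show ?thesis
        by (simp add: not_integrable_integral_eq)
    qed
    then show ?thesis
      by (simp add: set_lebesgue_integral_def)
  qed
  ultimately show ?thesis
    unfolding p_stable_def by blast
qed

end
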